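(* Let $\mathcal{T}$ be a tanglegram that has exactly one cross-responsible set. Then $\operatorname{crt}(\mathcal{T})=1$. Equivalently, every $2$-crossing-critical tanglegram contains at least $2$ cross-responsible sets.
   Context: A rooted tree is a tree with at least two vertices and a designated root vertex of degree $1$. Its leaves are the non-root vertices of degree $1$; its internal vertices are the vertices of degree at least $2$. A rooted binary tree is a rooted tree in which every internal vertex has degree $3$. For vertices $x,y$, $x$ is an ancestor of $y$ if $x$ lies on the path from the root to $y$; the parent of $y$ is its adjacent ancestor. Two leaves form a cherry if they have the same parent. An isomorphism of rooted trees is a graph isomorphism mapping root to root. For a rooted binary tree $T$ and a set $S$ of its leaves, let $T\llbracket S\rrbracket$ be the union of the root-to-$s$ paths over $s\in S$, and let the induced binary subtree $T[S]$ be obtained from $T\llbracket S\rrbracket$ by suppressing all degree-$2$ vertices. A tanglegram $\mathcal{T}=(L_{\mathcal{T}},R_{\mathcal{T}},\sigma_{\mathcal{T}})$ is the graph formed by two rooted binary trees $L_{\mathcal{T}}$ (left tree) and $R_{\mathcal{T}}$ (right tree) with the same number of leaves and a perfect matching $\sigma_{\mathcal{T}}$ between their leaf sets (its edges are the matching edges). Two tanglegrams are isomorphic if there is a graph isomorphism between them mapping left root to left root and right root to right root. For $Z\subseteq \sigma_{\mathcal{T}}$, the induced subtanglegram $\mathcal{T}[Z]$ has left tree $L_{\mathcal{T}}[S_1]$, right tree $R_{\mathcal{T}}[S_2]$ and matching $Z$, where $S_1,S_2$ are the sets of left and right leaves covered by $Z$. A plane drawing of a rooted tree is a straight-line drawing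 without edge crossings in which all leaves lie on a line (the leaf-line), all other vertices lie in one open half-plane of it, and every vertex is strictly closer to the leaf-line than each of its proper ancestors. A layout of a tanglegram is a straight-line drawing in which the left and right trees are drawn as plane drawings whose leaf-lines are parallel, both trees lie outside the strip between the two leaf-lines, and the matching edges are straight segments. The crossing number of a layout is the number of unordered pairs of matching edges that cross; the tangle crossing number $\operatorname{crt}(\mathcal{T})$ is the minimum crossing number over all layouts of $\mathcal{T}$. $\mathcal{K}_1$ is the tanglegram of size $4$ in which each of the two trees has root $r$ adjacent to an internal vertex whose two children each have two leaf children (so the left tree has cherries $\{l_1,l_2\},\{l_3,l_4\}$ and the right tree has cherries $\{r_1,r_2\},\{r_3,r_4\}$), with matching $l_1r_1,\ l_2r_3,\ l_3r_2,\ l_4r_4$. $\mathcal{K}_2$ is the tanglegram of size $4$ whose left tree is: root adjacent to $v_1$; $v_1$ has children leaf $l_1$ and vertex $v_2$; $v_2$ has children leaf $l_2$ and vertex $v_3$; $v_3$ has leaf children $l_3,l_4$; whose right tree is analogously root adjacent to $w_1$, $w_1$ has children leaf $r_1$ and $w_2$, $w_2$ has children leaf $r_2$ and $w_3$, $w_3$ has leaf children $r_3,r_4$; and whose matching is $l_1r_4,\ l_2r_2,\ l_3r_3,\ l_4r_1$. A set $X\subseteq\sigma_{\mathcal{T}}$ is cross-responsible if $\mathcal{T}[X]$ is isomorphic to $\mathcal{K}_1$ or to $\mathcal{K}_2$. A tanglegram $\mathcal{T}$ is $2$-crossing-critical if $\operatorname{crt}(\mathcal{T})\ge 2$ but every proper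 induced subtanglegram has tangle crossing number less than $2$. *)

theory Defs
  imports "HOL-Analysis.Analysis"
begin

section \<open>Graphs and trees\<close>

text \<open>Finite simple undirected graphs; an edge is the two-element set of its ends.\<close>

record 'a graph =
  verts :: "'a set"
  edges :: "'a set set"

definition simple_graph :: "('a, 'x) graph_scheme \<Rightarrow> bool" where
  "simple_graph G \<longleftrightarrow> finite (verts G) \<and>
     (\<forall>e\<in>edges G. \<exists>u\<in>verts G. \<exists>v\<in>verts G. u \<noteq> v \<and> e = {u, v})"

definition gdegree :: "('a, 'x) graph_scheme \<Rightarrow> 'a \<Rightarrow> nat" where
  "gdegree G v = card {e \<in> edges G. v \<in> e}"

definition path_edges :: "'a list \<Rightarrow> 'a set set" where
  "path_edges p = {{p ! i, p ! Suc i} | i. Suc i < length p}"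

definition gpath :: "('a, 'x) graph_scheme \<Rightarrow> 'a \<Rightarrow> 'a list \<Rightarrow> 'a \<Rightarrow> bool" where
  "gpath G u p v \<longleftrightarrow> p \<noteq> [] \<and> hd p = u \<and> last p = v \<and> distinct p \<and>
     set p \<subseteq> verts G \<and> path_edges p \<subseteq> edges G"

definition tree :: "('a, 'x) graph_scheme \<Rightarrow> bool" where
  "tree G \<longleftrightarrow> simple_graph G \<and> verts G \<noteq> {} \<and>
     (\<forall>u\<in>verts G. \<forall>v\<in>verts G. \<exists>!p. gpath G u p v)"

record 'a rooted_graph = "'a graph" +
  root_vertex :: 'a

definition leaves :: "('a, 'x) rooted_graph_scheme \<Rightarrow> 'a set" where
  "leaves T = {v \<in> verts T. v \<noteq> root_vertex T \<and> gdegree T v = 1}"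

definition internal_verts :: "('a, 'x) rooted_graph_scheme \<Rightarrow> 'a set" where
  "internal_verts T = {v \<in> verts T. gdegree T v \<ge> 2}"

definition rooted_tree :: "('a, 'x) rooted_graph_scheme \<Rightarrow> bool" where
  "rooted_tree T \<longleftrightarrow> tree T \<and> card (verts T) \<ge> 2 \<and>
     root_vertex T \<in> verts T \<and> gdegree T (root_vertex T) = 1"

definition rooted_binary_tree :: "('a, 'x) rooted_graph_scheme \<Rightarrow> bool" where
  "rooted_binary_tree T \<longleftrightarrow> rooted_tree T \<and> (\<forall>v\<in>internal_verts T. gdegree T v = 3)"

definition ancestor :: "('a, 'x) rooted_graph_scheme \<Rightarrow> 'a \<Rightarrow> 'a \<Rightarrow> bool" where
  "ancestor T x y \<longleftrightarrow> (\<exists>p. gpath T (root_vertex T) p y \<and> x \<in> set p)"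


section \<open>Induced binary subtrees\<close>

text \<open>The union of the paths from the root to the vertices in \<open>S\<close>.\<close>

definition root_path_union :: "('a, 'x) rooted_graph_scheme \<Rightarrow> 'a set \<Rightarrow> 'a graph" where
  "root_path_union T S =
     \<lparr>verts = \<Union>{set p | p s. s \<in> S \<and> gpath T (root_vertex T) p s},
      edges = \<Union>{path_edges p | p s. s \<in> S \<and> gpath T (root_vertex T) p s}\<rparr>"

text \<open>
  Suppressing all vertices of degree 2 at once: the remaining vertices \<open>u\<close> and \<open>v\<close> become
  adjacent when some path between them has only vertices of degree 2 in its interior
  (possibly none, so an edge between remaining vertices is kept).  On trees, where no loops or
  multiple edges can arise, this agrees with suppressing the vertices one after the other.
\<close>

definition suppress_degree2 :: "('a, 'x) graph_scheme \<Rightarrow> 'a graph" where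
  "suppress_degree2 G =
     (let K = {v \<in> verts G. gdegree G v \<noteq> 2} in
      \<lparr>verts = K,
       edges = {{u, v} | u v. u \<in> K \<and> v \<in> K \<and> u \<noteq> v \<and>
                  (\<exists>p. gpath G u p v \<and> (\<forall>x \<in> set p - {u, v}. gdegree G x = 2))}\<rparr>)"

definition induced_subtree :: "('a, 'x) rooted_graph_scheme \<Rightarrow> 'a set \<Rightarrow> 'a rooted_graph" where
  "induced_subtree T S =
     (let G = suppress_degree2 (root_path_union T S) in
      \<lparr>verts = verts G, edges = edges G, root_vertex = root_vertex T\<rparr>)"


section \<open>Tanglegrams\<close>

record 'a tanglegram_data =
  left_tree :: "'a rooted_graph"
  right_tree :: "'a rooted_graph"
  matching :: "'a set set"

definition tanglegram :: "'a tanglegram_data \<Rightarrow> bool" where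
  "tanglegram \<T> \<longleftrightarrow>
     rooted_binary_tree (left_tree \<T>) \<and> rooted_binary_tree (right_tree \<T>) \<and>
     verts (left_tree \<T>) \<inter> verts (right_tree \<T>) = {} \<and>
     card (leaves (left_tree \<T>)) = card (leaves (right_tree \<T>)) \<and>
     (\<forall>m\<in>matching \<T>. \<exists>l\<in>leaves (left_tree \<T>). \<exists>r\<in>leaves (right_tree \<T>). m = {l, r}) \<and>
     (\<forall>v \<in> leaves (left_tree \<T>) \<union> leaves (right_tree \<T>). \<exists>!m. m \<in> matching \<T> \<and> v \<in> m)"

definition tanglegram_graph :: "'a tanglegram_data \<Rightarrow> 'a graph" where
  "tanglegram_graph \<T> =
     \<lparr>verts = verts (left_tree \<T>) \<union> verts (right_tree \<T>),
      edges = edges (left_tree \<T>) \<union> edges (right_tree \<T>) \<union> matching \<T>\<rparr>"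

definition graph_iso :: "('a \<Rightarrow> 'b) \<Rightarrow> 'a graph \<Rightarrow> 'b graph \<Rightarrow> bool" where
  "graph_iso \<phi> G H \<longleftrightarrow> bij_betw \<phi> (verts G) (verts H) \<and>
     (\<forall>u\<in>verts G. \<forall>v\<in>verts G. {u, v} \<in> edges G \<longleftrightarrow> {\<phi> u, \<phi> v} \<in> edges H)"

definition tanglegram_iso :: "'a tanglegram_data \<Rightarrow> 'b tanglegram_data \<Rightarrow> bool" where
  "tanglegram_iso \<S> \<T> \<longleftrightarrow>
     (\<exists>\<phi>. graph_iso \<phi> (tanglegram_graph \<S>) (tanglegram_graph \<T>) \<and>
          \<phi> (root_vertex (left_tree \<S>)) = root_vertex (left_tree \<T>) \<and>
          \<phi> (root_vertex (right_tree \<S>)) = root_vertex (right_tree \<T>))"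

definition induced_subtanglegram :: "'a tanglegram_data \<Rightarrow> 'a set set \<Rightarrow> 'a tanglegram_data" where
  "induced_subtanglegram \<T> Z =
     \<lparr>left_tree = induced_subtree (left_tree \<T>) (leaves (left_tree \<T>) \<inter> \<Union>Z),
      right_tree = induced_subtree (right_tree \<T>) (leaves (right_tree \<T>) \<inter> \<Union>Z),
      matching = Z\<rparr>"


section \<open>Layouts and the tangle crossing number\<close>

type_synonym point = "real \<times> real"

text \<open>An edge \<open>e\<close> is drawn as the segment \<open>convex hull (f ` e)\<close> between its two end points.\<close>

definition crossing_free_drawing :: "('a, 'x) graph_scheme \<Rightarrow> ('a \<Rightarrow> point) \<Rightarrow> bool" where
  "crossing_free_drawing G f \<longleftrightarrow> inj_on f (verts G) \<and>
     (\<forall>v\<in>verts G. \<forall>e\<in>edges G. f v \<in> convex hull (f ` e) \<longrightarrow> v \<in> e) \<and>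
     (\<forall>e\<in>edges G. \<forall>e'\<in>edges G. e \<noteq> e' \<longrightarrow>
        convex hull (f ` e) \<inter> convex hull (f ` e') = f ` (e \<inter> e'))"

text \<open>
  The leaf-line is \<open>{z. n \<bullet> z = c}\<close> and the remaining vertices lie in the open half-plane
  \<open>{z. n \<bullet> z < c}\<close>.  Each line and each of its two sides arise from some \<open>n \<noteq> 0\<close> and \<open>c\<close>, as
  \<open>(n, c)\<close> and \<open>(- n, - c)\<close> give the same line with opposite sides.
\<close>

definition plane_drawing ::
    "('a, 'x) rooted_graph_scheme \<Rightarrow> ('a \<Rightarrow> point) \<Rightarrow> point \<Rightarrow> real \<Rightarrow> bool" where
  "plane_drawing T f n c \<longleftrightarrow> crossing_free_drawing T f \<and>
     (\<forall>v\<in>leaves T. n \<bullet> f v = c) \<and>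
     (\<forall>v \<in> verts T - leaves T. n \<bullet> f v < c) \<and>
     (\<forall>x\<in>verts T. \<forall>y\<in>verts T. ancestor T x y \<and> x \<noteq> y \<longrightarrow>
        infdist (f y) {z. n \<bullet> z = c} < infdist (f x) {z. n \<bullet> z = c})"

text \<open>
  The parallel leaf-lines are \<open>{z. n \<bullet> z = c}\<close> and \<open>{z. n \<bullet> z = d}\<close>; taking \<open>c < d\<close> only fixes
  the sign of \<open>n\<close>.  Since each tree lies outside the strip between them, the left tree lies in
  \<open>{z. n \<bullet> z \<le> c}\<close> and the right tree in \<open>{z. n \<bullet> z \<ge> d}\<close>.
\<close>

definition layout :: "'a tanglegram_data \<Rightarrow> ('a \<Rightarrow> point) \<Rightarrow> bool" where
  "layout \<T> f \<longleftrightarrow> (\<exists>n c d. n \<noteq> 0 \<and> c < d \<and>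
     plane_drawing (left_tree \<T>) f n c \<and>
     plane_drawing (right_tree \<T>) f (- n) (- d))"

text \<open>
  Distinct matching edges have no common vertex, so in a layout their segments have distinct ends
  on both leaf-lines and can meet only in an interior point of both.
\<close>

definition crossing_number :: "'a tanglegram_data \<Rightarrow> ('a \<Rightarrow> point) \<Rightarrow> nat" where
  "crossing_number \<T> f =
     card {{e, e'} | e e'. e \<in> matching \<T> \<and> e' \<in> matching \<T> \<and> e \<noteq> e' \<and>
                           convex hull (f ` e) \<inter> convex hull (f ` e') \<noteq> {}}"

definition crt :: "'a tanglegram_data \<Rightarrow> nat" where
  "crt \<T> = (LEAST k. \<exists>f. layout \<T> f \<and> crossing_number \<T> f = k)"


section \<open>Cross-responsible sets and criticality\<close>

datatype kvertex = LRoot | LInner nat | LLeaf nat | RRoot | RInner nat | RLeaf nat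

definition K1 :: "kvertex tanglegram_data" where
  "K1 = \<lparr>
     left_tree = \<lparr>
       verts = {LRoot, LInner 1, LInner 2, LInner 3, LLeaf 1, LLeaf 2, LLeaf 3, LLeaf 4},
       edges = {{LRoot, LInner 1}, {LInner 1, LInner 2}, {LInner 1, LInner 3},
                {LInner 2, LLeaf 1}, {LInner 2, LLeaf 2}, {LInner 3, LLeaf 3}, {LInner 3, LLeaf 4}},
       root_vertex = LRoot\<rparr>,
     right_tree = \<lparr>
       verts = {RRoot, RInner 1, RInner 2, RInner 3, RLeaf 1, RLeaf 2, RLeaf 3, RLeaf 4},
       edges = {{RRoot, RInner 1}, {RInner 1, RInner 2}, {RInner 1, RInner 3},
                {RInner 2, RLeaf 1}, {RInner 2, RLeaf 2}, {RInner 3, RLeaf 3}, {RInner 3, RLeaf 4}},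
       root_vertex = RRoot\<rparr>,
     matching = {{LLeaf 1, RLeaf 1}, {LLeaf 2, RLeaf 3}, {LLeaf 3, RLeaf 2}, {LLeaf 4, RLeaf 4}}\<rparr>"

definition K2 :: "kvertex tanglegram_data" where
  "K2 = \<lparr>
     left_tree = \<lparr>
       verts = {LRoot, LInner 1, LInner 2, LInner 3, LLeaf 1, LLeaf 2, LLeaf 3, LLeaf 4},
       edges = {{LRoot, LInner 1}, {LInner 1, LLeaf 1}, {LInner 1, LInner 2},
                {LInner 2, LLeaf 2}, {LInner 2, LInner 3}, {LInner 3, LLeaf 3}, {LInner 3, LLeaf 4}},
       root_vertex = LRoot\<rparr>,
     right_tree = \<lparr>
       verts = {RRoot, RInner 1, RInner 2, RInner 3, RLeaf 1, RLeaf 2, RLeaf 3, RLeaf 4},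
       edges = {{RRoot, RInner 1}, {RInner 1, RLeaf 1}, {RInner 1, RInner 2},
                {RInner 2, RLeaf 2}, {RInner 2, RInner 3}, {RInner 3, RLeaf 3}, {RInner 3, RLeaf 4}},
       root_vertex = RRoot\<rparr>,
     matching = {{LLeaf 1, RLeaf 4}, {LLeaf 2, RLeaf 2}, {LLeaf 3, RLeaf 3}, {LLeaf 4, RLeaf 1}}\<rparr>"

definition cross_responsible :: "'a tanglegram_data \<Rightarrow> 'a set set \<Rightarrow> bool" where
  "cross_responsible \<T> X \<longleftrightarrow> X \<subseteq> matching \<T> \<and>
     (tanglegram_iso (induced_subtanglegram \<T> X) K1 \<or>
      tanglegram_iso (induced_subtanglegram \<T> X) K2)"

text \<open>
  The empty set of matching edges is left out because it induces no tanglegram: a rooted tree has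
  at least one leaf.
\<close>

definition two_crossing_critical :: "'a tanglegram_data \<Rightarrow> bool" where
  "two_crossing_critical \<T> \<longleftrightarrow> tanglegram \<T> \<and> crt \<T> \<ge> 2 \<and>
     (\<forall>Z. Z \<subset> matching \<T> \<and> Z \<noteq> {} \<longrightarrow> crt (induced_subtanglegram \<T> Z) < 2)"

end

theory Submission
  imports Defs "HOL-Library.Sublist"
begin

text \<open>
  Identify the leaves of both trees with the matching edges.  Each tree is then encoded by the
  relation ``some vertex lies above \<open>a\<close> and \<open>b\<close> but not above \<open>c\<close>'', and a layout amounts to choosing,
  at every branching vertex of both trees, which child comes first.  Two matching edges whose
  lowest common ancestors are \<open>u\<close> on the left and \<open>v\<close> on the right cross or not depending on whether
  the choices at \<open>u\<close> and \<open>v\<close> agree, so drawing without crossings means balancing a signed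
  bipartite graph on the branching vertices.  Conflicting parallel edges of this graph are copies of
  \<open>K1\<close>, and in the absence of \<open>K1\<close> the vertices adjacent to a given vertex form a chain; a chord
  argument then reduces every unbalanced cycle to an unbalanced 4-cycle, which is a copy of \<open>K2\<close>.

  If there is a single obstruction, it leaves so little room around itself that deleting the
  constraint of one suitable pair of matching edges makes the signed graph balanced: the pair
  \<open>l2 r3\<close>, \<open>l3 r2\<close> for \<open>K1\<close>, and \<open>l2 r2\<close> with one of \<open>l4 r1\<close>, \<open>l1 r4\<close> for \<open>K2\<close>.
  Hence one crossing suffices.  Conversely, root paths in a plane drawing are monotone towards the
  leaf-line, so by the intermediate value theorem the descendants of a vertex are consecutive among
  the leaves, and no common order of the four edges of an obstruction is compatible with both trees.
\<close>

section \<open>Tree-like ternary relations\<close>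

text \<open>Both leaf sets stay complete; only the constraint of one pair is ignored, so a balanced
  labelling is at once a drawing in which that pair alone can cross. The danger is that the ignored
  pair is itself the chord that closes some square of the signed graph, and this governs the choice
  of the pair: for the pairs chosen, such a chord would create a further obstruction or contradict
  one of the trees. For \<open>K2\<close>, dropping \<open>l2 r2\<close> and \<open>l4 r1\<close>
  works unless some matching edge sides with \<open>l2\<close> against \<open>l3\<close> on the left
  but with \<open>r3\<close> against \<open>r2\<close> on the right. Dropping \<open>l2 r2\<close>
  and \<open>l1 r4\<close> has the mirrored exception. Both exceptions cannot occur together,
  because the two witnesses would form a \<open>K1\<close> with \<open>l2 r2\<close> and
  \<open>l3 r3\<close>.\<close>

text \<open>
  Balance is proved by adding the vertices of \<open>U\<close> in order of decreasing rank.  If two neighbours of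
  the new vertex \<open>w\<close> already have other neighbours, the square through \<open>w\<close> and some \<open>x\<close> of higher rank
  makes their demands on \<open>w\<close> agree; the remaining neighbours of \<open>w\<close> are still free.
\<close>

lemma signed_bipartite_balance:
  fixes N :: "'u \<Rightarrow> 'v \<Rightarrow> bool \<Rightarrow> bool" and rk :: "'u \<Rightarrow> nat"
  assumes "finite U"
    and single: "\<And>u v s s'. u \<in> U \<Longrightarrow> N u v s \<Longrightarrow> N u v s' \<Longrightarrow> s = s'"
    and square: "\<And>w u u' v v' s1 s2 s3 s4. \<lbrakk>w \<in> U; u \<in> U; u' \<in> U; u \<noteq> w; u' \<noteq> w;
      rk w \<le> rk u; rk w \<le> rk u'; v \<noteq> v'; N w v s1; N w v' s2; N u v s3; N u' v' s4\<rbrakk>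
      \<Longrightarrow> \<exists>x\<in>U. rk w < rk x \<and> (\<exists>t t'. N x v t \<and> N x v' t' \<and> ((s1 = s2) = (t = t')))"
  shows "\<exists>(f::_ \<Rightarrow> bool) g. \<forall>u\<in>U. \<forall>v s. N u v s \<longrightarrow> (f u = g v) = s"
  using assms
proof (induction "card U" arbitrary: U)
  case 0
  then show ?case by simp
next
  case (Suc n)
  have "U \<noteq> {}" using Suc by auto
  then obtain w where w: "w \<in> U" "\<And>u. u \<in> U \<Longrightarrow> rk w \<le> rk u"
    using ex_has_least_nat[of "\<lambda>u. u \<in> U" _ rk] by blast
  let ?U = "U - {w}"
  have "\<exists>(f::_ \<Rightarrow> bool) g. \<forall>u\<in>?U. \<forall>v s. N u v s \<longrightarrow> (f u = g v) = s"
  proof (rule Suc.hyps(1))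
    show "n = card ?U" using Suc w by simp
    show "finite ?U" using Suc.prems by simp
  next
    fix u v s s' assume "u \<in> ?U" "N u v s" "N u v s'"
    then show "s = s'" using Suc.prems(2) by auto
  next
    fix w' u u' v v' s1 s2 s3 s4
    assume *: "w' \<in> ?U" "u \<in> ?U" "u' \<in> ?U" "u \<noteq> w'" "u' \<noteq> w'"
      "rk w' \<le> rk u" "rk w' \<le> rk u'" "v \<noteq> v'" "N w' v s1" "N w' v' s2" "N u v s3" "N u' v' s4"
    then obtain x where x: "x \<in> U" "rk w' < rk x"
      "\<exists>t t'. N x v t \<and> N x v' t' \<and> ((s1 = s2) = (t = t'))"
      using Suc.prems(3)[OF _ _ _ *(4-12)] *(1-3) unfolding Diff_iff by blast
    \<comment> \<open>\<open>w\<close> has minimal rank in \<open>U\<close>, so a vertex of rank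
      above \<open>rk w'\<close> survives the removal of \<open>w\<close>.\<close>
    have "x \<noteq> w" using x(2) w(2)[of w'] * by auto
    then show "\<exists>x\<in>?U. rk w' < rk x \<and> (\<exists>t t'. N x v t \<and> N x v' t' \<and> ((s1 = s2) = (t = t')))"
      using x(1,2,3) by (intro bexI[of _ x] conjI) simp_all
  qed
  then obtain f :: "_ \<Rightarrow> bool" and g where
    fg0: "\<forall>u\<in>?U. \<forall>v s. N u v s \<longrightarrow> (f u = g v) = s" by (elim exE)
  have fg: "\<And>u v s. u \<in> ?U \<Longrightarrow> N u v s \<Longrightarrow> (f u = g v) = s" using fg0 by simp
  define old where "old v = (\<exists>u\<in>?U. \<exists>s. N u v s)" for v
  have agree: "(s1 = s2) = (g v = g v')"
    if h: "old v" "old v'" "N w v s1" "N w v' s2" for v v' s1 s2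
  proof (cases "v = v'")
    case True
    then show ?thesis using Suc.prems(2)[OF w(1)] h by auto
  next
    case False
    from h obtain u u' s3 s4 where "u \<in> ?U" "u' \<in> ?U" "N u v s3" "N u' v' s4"
      unfolding old_def by blast
    then obtain x t t' where x: "x \<in> U" "rk w < rk x" "N x v t" "N x v' t'" "(s1 = s2) = (t = t')"
      using Suc.prems(3)[OF w(1) _ _ _ _ _ _ False h(3,4)] w(2) by blast
    then have "x \<in> ?U" by auto
    then have "(f x = g v) = t" "(f x = g v') = t'" using fg x by auto
    then show ?thesis using x(5) by auto
  qed
  obtain b where b: "\<And>v s. old v \<Longrightarrow> N w v s \<Longrightarrow> (b = g v) = s"
  proof (cases "\<exists>v s. old v \<and> N w v s")
    case True
    then obtain v0 s0 where v0: "old v0" "N w v0 s0" by blast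
    show ?thesis
    proof (rule that[of "g v0 = s0"])
      fix v s assume "old v" "N w v s"
      then show "((g v0 = s0) = g v) = s" using agree[OF v0(1) _ v0(2)] by auto
    qed
  next
    case False
    then show ?thesis using that by blast
  qed
  define f' where "f' = f(w := b)"
  \<comment> \<open>A fresh neighbour joined to \<open>w\<close> with sign \<open>s\<close> receives
    the value \<open>b = s\<close>, since \<open>b = (b = s)\<close> is equivalent to
    \<open>s\<close>. Vertices with no edge at all get the default \<open>False\<close>.\<close>
  define g' where "g' v = (if old v then g v else (\<exists>s. N w v s \<and> (b = s)))" for v
  have "(f' u = g' v) = s" if "u \<in> U" "N u v s" for u v s
  proof (cases "u = w")
    case True
    show ?thesis
    proof (cases "old v")
      case True
      then show ?thesis using b that \<open>u = w\<close> by (auto simp: f'_def g'_def)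
    next
      case False
      have "N w v s' \<longleftrightarrow> s' = s" for s' using Suc.prems(2)[OF w(1)] that \<open>u = w\<close> by auto
      then show ?thesis using False \<open>u = w\<close> by (auto simp: f'_def g'_def)
    qed
  next
    case False
    then have "old v" unfolding old_def using that by auto
    then show ?thesis using fg[of u v s] False that by (auto simp: f'_def g'_def)
  qed
  then show ?case by blast
qed

text \<open>These are the rooted triples ab|c of phylogenetics, with a = b allowed so that single
  leaves count as clusters. By \<open>branch\<close>, a leaf \<open>d\<close> is either inside a
  cluster separating \<open>a\<close>, \<open>b\<close> from \<open>c\<close> or itself separated
  from them; \<open>total\<close> expresses binary branching.\<close>

locale triple_relation =
  fixes X :: "'b set" and t :: "'b \<Rightarrow> 'b \<Rightarrow> 'b \<Rightarrow> bool"
  assumes fin: "finite X"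
    and dom: "t a b c \<Longrightarrow> a \<in> X \<and> b \<in> X \<and> c \<in> X"
    and sym: "t a b c \<Longrightarrow> t b a c"
    and neq: "t a b c \<Longrightarrow> a \<noteq> c"
    and refl: "a \<in> X \<Longrightarrow> c \<in> X \<Longrightarrow> a \<noteq> c \<Longrightarrow> t a a c"
    and asym: "t a b c \<Longrightarrow> \<not> t a c b"
    and trans: "t a b c \<Longrightarrow> t b d c \<Longrightarrow> t a d c"
    and branch: "t a b c \<Longrightarrow> d \<in> X \<Longrightarrow> t a b d \<or> t a d c"
    and total: "a \<in> X \<Longrightarrow> b \<in> X \<Longrightarrow> c \<in> X \<Longrightarrow> a \<noteq> b \<Longrightarrow> a \<noteq> c \<Longrightarrow> b \<noteq> c \<Longrightarrow>
      t a b c \<or> t a c b \<or> t b c a"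
begin

text \<open>For \<open>a\<close> and \<open>b\<close> leaves, \<open>J a b\<close> is the set of leaves below their lowest common ancestor.\<close>

definition J :: "'b \<Rightarrow> 'b \<Rightarrow> 'b set" where
  "J a b = {c \<in> X. \<not> t a b c}"

lemma J_commute: "J a b = J b a"
  unfolding J_def using sym by blast

lemma J_self: "a \<in> X \<Longrightarrow> a \<in> J a b" "b \<in> X \<Longrightarrow> b \<in> J a b"
  unfolding J_def using sym neq by blast+

text \<open>\<open>a\<close> and \<open>c\<close> lie below the same child of the lowest common
  ancestor of \<open>a\<close> and \<open>b\<close>, so either of them represents that node together
  with \<open>b\<close>.\<close>

lemma J_side: assumes "t a c b" shows "J c b = J a b"
proof -
  have "t c b d" if "t a b d" "t a c b" for a b c d
    using branch[OF that(1), of c] asym[OF that(2)] dom[OF that(2)] sym trans that by blast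
  then show ?thesis unfolding J_def using assms sym by blast
qed

lemma J_mono: assumes "c \<in> J a b" "d \<in> J a b" shows "J c d \<subseteq> J a b"
proof
  fix e assume e: "e \<in> J c d"
  have False if "t a b e"
  proof -
    have "t a c e" "t a d e" using branch[OF that] assms unfolding J_def by auto
    then have "t c d e" using sym trans by blast
    then show False using e unfolding J_def by auto
  qed
  then show "e \<in> J a b" using e unfolding J_def by auto
qed

lemma J_sides: assumes "c \<in> J a b" "a \<in> X" "b \<in> X" "a \<noteq> b" shows "t a c b \<or> t b c a"
  using assms total[of a b c] refl unfolding J_def by (cases "c = a \<or> c = b") auto

lemma J_finite: "finite (J a b)" unfolding J_def using fin by simp

text \<open>Any leaf of a node can serve as one of its two representatives: it is paired with
  whichever of \<open>a\<close>, \<open>b\<close> lies on the other side. Intersecting clusters can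
  then be compared through a common leaf.\<close>

lemma J_through: assumes "c \<in> J a b" "a \<in> X" "b \<in> X" "a \<noteq> b"
  obtains d where "d = a \<or> d = b" "J a b = J c d" "c \<noteq> d"
proof -
  from J_sides[OF assms] show ?thesis
  proof
    assume "t a c b"
    then show ?thesis using J_side[of a c b] that[of b] neq sym by metis
  next
    assume "t b c a"
    then show ?thesis using J_side[of b c a] that[of a] neq sym J_commute by metis
  qed
qed

lemma J_laminar:
  assumes "a \<in> X" "b \<in> X" "a \<noteq> b" "c \<in> X" "d \<in> X" "c \<noteq> d"
  shows "J a b \<inter> J c d = {} \<or> J a b \<subseteq> J c d \<or> J c d \<subseteq> J a b"
proof (cases "J a b \<inter> J c d = {}")
  case False
  then obtain e where e: "e \<in> J a b" "e \<in> J c d" by blast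
  obtain x where x: "J a b = J e x" "x \<in> X"
    using J_through[OF e(1)] assms by metis
  obtain y where y: "J c d = J e y" "y \<in> X"
    using J_through[OF e(2)] assms by metis
  have "e \<in> X" using e unfolding J_def by auto
  have "y \<in> J e x \<or> x \<in> J e y" unfolding J_def using asym x y by blast
  then show ?thesis using J_mono J_self \<open>e \<in> X\<close> x y by metis
qed simp

text \<open>
  An arbitrary labelling of the two children of the node \<open>u\<close> by truth values; it has a meaning only if
  \<open>u = J a b\<close> for distinct \<open>a\<close>, \<open>b\<close> and for leaves in \<open>u\<close>.
\<close>

definition side :: "'b set \<Rightarrow> 'b \<Rightarrow> bool" where
  "side u c = (let p = (SOME p. fst p \<in> X \<and> snd p \<in> X \<and> fst p \<noteq> snd p \<and> J (fst p) (snd p) = u)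
     in t c (fst p) (snd p))"

lemma side_rep:
  assumes "a \<in> X" "b \<in> X" "a \<noteq> b"
  obtains a0 b0 where "a0 \<in> X" "b0 \<in> X" "a0 \<noteq> b0" "J a0 b0 = J a b"
    "\<And>c. side (J a b) c = t c a0 b0"
proof -
  let ?P = "\<lambda>p. fst p \<in> X \<and> snd p \<in> X \<and> fst p \<noteq> snd p \<and> J (fst p) (snd p) = J a b"
  have "?P (a, b)" using assms by simp
  then have "?P (SOME p. ?P p)" by (rule someI)
  then show ?thesis using that[of "fst (SOME p. ?P p)" "snd (SOME p. ?P p)"]
    unfolding side_def Let_def by blast
qed

lemma side_neq: assumes "a \<in> X" "b \<in> X" "a \<noteq> b" shows "side (J a b) a \<noteq> side (J a b) b"
proof -
  obtain a0 b0 where r: "a0 \<in> X" "b0 \<in> X" "a0 \<noteq> b0" "J a0 b0 = J a b"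
    "\<And>c. side (J a b) c = t c a0 b0" using side_rep[OF assms] by blast
  have "t a0 a b0 \<or> t b0 a a0" "t a0 b b0 \<or> t b0 b a0"
    using J_sides[of _ a0 b0] r J_self assms by metis+
  \<comment> \<open>If \<open>a\<close> and \<open>b\<close> were on the same side, they would form
    a triple against the opposite representative, which nevertheless belongs to
    \<open>J a b\<close>.\<close>
  moreover have "\<not> (t a0 a b0 \<and> t a0 b b0)" "\<not> (t b0 a a0 \<and> t b0 b a0)"
    using sym trans J_self[of a0 b0] J_self[of b0 a0] r unfolding J_def by blast+
  ultimately show ?thesis using r(5) sym asym by blast
qed

lemma side_eq: assumes "t a c b" shows "side (J a b) c = side (J a b) a"
proof -
  have *: "a \<in> X" "b \<in> X" "c \<in> X" "a \<noteq> b" "c \<noteq> b" using assms dom neq sym by blast+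
  show ?thesis using side_neq[of a b] side_neq[of c b] * J_side[OF assms] by auto
qed

lemma J_opposite:
  assumes "J a b = J c d" "t a c b" "c \<in> X" "d \<in> X" "c \<noteq> d"
  shows "t b d a"
proof (rule ccontr)
  assume "\<not> t b d a"
  have *: "a \<in> X" "b \<in> X" "a \<noteq> b" using assms dom neq sym by blast+
  have "d \<in> J a b" using assms J_self by simp
  then have "t a d b" using J_sides * \<open>\<not> t b d a\<close> by blast
  then show False using side_eq[of a d b] side_eq[of a c b] side_neq[of c d] assms by simp
qed

lemma J_same_sides:
  assumes "J a b = J c d" "a \<in> X" "b \<in> X" "a \<noteq> b" "c \<in> X" "d \<in> X" "c \<noteq> d"
  shows "t a c b \<and> t b d a \<or> t a d b \<and> t b c a"
proof -
  have "c \<in> J a b" using assms J_self by simp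
  then consider "t a c b" | "t b c a" using J_sides assms by blast
  then show ?thesis
  proof cases
    case 1 then show ?thesis using J_opposite[of a b c d] assms by blast
  next
    case 2 then show ?thesis using J_opposite[of b a c d] assms J_commute[of a b] by simp
  qed
qed

definition lt :: "('b set \<Rightarrow> bool) \<Rightarrow> 'b \<Rightarrow> 'b \<Rightarrow> bool" where
  "lt f x y \<longleftrightarrow> x \<in> X \<and> y \<in> X \<and> x \<noteq> y \<and> side (J x y) x = f (J x y)"

lemma lt_total: "x \<in> X \<Longrightarrow> y \<in> X \<Longrightarrow> x \<noteq> y \<Longrightarrow> lt f x y \<longleftrightarrow> \<not> lt f y x"
  unfolding lt_def using side_neq[of x y] J_commute[of x y] by auto

lemma lt_side: assumes "t a b c" shows "lt f a c \<longleftrightarrow> lt f b c"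
  using J_side[OF assms] side_eq[OF assms] dom[OF assms] neq[OF assms] neq[OF sym[OF assms]]
  unfolding lt_def by auto

text \<open>Two of the three leaves are on the same side of the third, so by \<open>lt_side\<close>
  they compare alike with it; with \<open>lt_total\<close> this rules out a cycle.\<close>

lemma lt_trans: assumes "lt f x y" "lt f y z" shows "lt f x z"
proof -
  have *: "x \<in> X" "y \<in> X" "z \<in> X" "x \<noteq> y" "y \<noteq> z" using assms unfolding lt_def by auto
  have "x \<noteq> z" using assms lt_total * by metis
  then show ?thesis using total[of x y z] lt_side lt_total assms * by metis
qed

lemma lt_positions:
  obtains pos :: "'b \<Rightarrow> real" where "\<And>x y. x \<in> X \<Longrightarrow> y \<in> X \<Longrightarrow> pos x < pos y \<longleftrightarrow> lt f x y"
    "inj_on pos X"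
proof -
  define pos where "pos x = real (card {z. lt f z x})" for x
  have fin': "finite {z. lt f z x}" for x by (rule finite_subset[OF _ fin]) (auto simp: lt_def)
  have less: "pos x < pos y" if "lt f x y" for x y
  proof -
    have "x \<in> {z. lt f z y}" "x \<notin> {z. lt f z x}" using that unfolding lt_def by auto
    moreover have "{z. lt f z x} \<subseteq> {z. lt f z y}" using that lt_trans by blast
    ultimately have "{z. lt f z x} \<subset> {z. lt f z y}" by blast
    then show ?thesis unfolding pos_def using psubset_card_mono[OF fin'] by auto
  qed
  show ?thesis
  proof (rule that[of pos])
    fix x y assume "x \<in> X" "y \<in> X"
    then show "pos x < pos y \<longleftrightarrow> lt f x y" using less[of x y] less[of y x] lt_total[of x y f]
      by (cases "x = y") (auto simp: lt_def)
  next
    show "inj_on pos X" using less lt_total unfolding inj_on_def by (metis order_less_irrefl)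
  qed
qed

end

section \<open>Pairs of ternary relations and their obstructions\<close>

locale triple_pair = L: triple_relation X tL + R: triple_relation X tR
  for X :: "'b set" and tL tR
begin

text \<open>
  In \<open>K1q a b c d\<close> the elements stand for the matching edges \<open>l1 r1\<close>, \<open>l2 r3\<close>, \<open>l3 r2\<close>, \<open>l4 r4\<close> of \<open>K1\<close>, and
  in \<open>K2q p q r s\<close> for the matching edges \<open>l1 r4\<close>, \<open>l2 r2\<close>, \<open>l3 r3\<close>, \<open>l4 r1\<close> of \<open>K2\<close>.
\<close>

definition K1q :: "'b \<Rightarrow> 'b \<Rightarrow> 'b \<Rightarrow> 'b \<Rightarrow> bool" where
  "K1q a b c d \<longleftrightarrow> tL a b c \<and> tL c d a \<and> tR a c b \<and> tR b d a"

definition K2q :: "'b \<Rightarrow> 'b \<Rightarrow> 'b \<Rightarrow> 'b \<Rightarrow> bool" where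
  "K2q p q r s \<longleftrightarrow> tL r s q \<and> tL q s p \<and> tR r p q \<and> tR q p s"

definition pat :: "'b set \<Rightarrow> bool" where
  "pat Q \<longleftrightarrow> (\<exists>a b c d. Q = {a, b, c, d} \<and> (K1q a b c d \<or> K2q a b c d))"

text \<open>Since \<open>{x, y}\<close> is never empty, \<open>D = {}\<close> stands for dropping
  nothing.\<close>

definition agree_off :: "'b set \<Rightarrow> bool" where
  "agree_off D \<longleftrightarrow> (\<exists>f g. \<forall>x\<in>X. \<forall>y\<in>X. x \<noteq> y \<longrightarrow> {x, y} \<noteq> D \<longrightarrow> (L.lt f x y \<longleftrightarrow> R.lt g x y))"

text \<open>
  The signed graph on the nodes of both trees, without the constraint coming from the pair \<open>D\<close>; the
  sign tells whether the pair has no crossing when the chosen sides of \<open>u\<close> and \<open>v\<close> have equal labels.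
\<close>

definition adj :: "'b set \<Rightarrow> 'b set \<Rightarrow> 'b set \<Rightarrow> bool \<Rightarrow> bool" where
  "adj D u v s \<longleftrightarrow> (\<exists>x\<in>X. \<exists>y\<in>X. x \<noteq> y \<and> {x, y} \<noteq> D \<and> L.J x y = u \<and> R.J x y = v \<and>
     s = (L.side u x = R.side v x))"

lemma K1q_pat: "K1q a b c d \<Longrightarrow> pat {a, b, c, d}" unfolding pat_def by blast
lemma K2q_pat: "K2q a b c d \<Longrightarrow> pat {a, b, c, d}" unfolding pat_def by blast

lemma swap: "triple_pair X tR tL" by unfold_locales

lemma K1q_swap: "triple_pair.K1q tR tL a b c d = K1q a c b d"
  unfolding triple_pair.K1q_def[OF swap] K1q_def using L.sym R.sym L.asym R.asym
  by blast

lemma K2q_swap: "triple_pair.K2q tR tL p q r s = K2q s q r p"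
  unfolding triple_pair.K2q_def[OF swap] K2q_def using L.sym R.sym by blast

lemma pat_swap_imp: assumes "pat Q" shows "triple_pair.pat tR tL Q"
proof -
  obtain a b c d where q: "Q = {a, c, b, d}" "Q = {d, b, c, a}" "K1q a b c d \<or> K2q a b c d"
    using assms unfolding pat_def by (auto simp: insert_commute)
  then show ?thesis unfolding triple_pair.pat_def[OF swap] K1q_swap K2q_swap by metis
qed

lemma pat_swap: "triple_pair.pat tR tL Q = pat Q"
  using pat_swap_imp triple_pair.pat_swap_imp[OF swap] by blast

lemma agree_off_swap: "triple_pair.agree_off X tR tL D = agree_off D"
  unfolding triple_pair.agree_off_def[OF swap] agree_off_def
  by (intro iffI; elim exE; rule exI, rule exI; fast)

text \<open>Let w and u be the left nodes of the pairs \<open>x y\<close> and \<open>q q'\<close>,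
  and v and v' the right nodes of \<open>x y\<close> and \<open>z p\<close>; the three pairs are the
  edges wv, wv' and uv. As \<open>z\<close> is in w but outside v, and \<open>q\<close> is in v but
  outside w, the pair \<open>z q\<close> joins u to v' and closes a square. Its sign depends only on
  whether \<open>z\<close> at w and \<open>q\<close> at v fall on the side of \<open>x\<close> or of
  \<open>y\<close>. Falling on sides of the same name gives the triples of a \<open>K2\<close>;
  otherwise the square is balanced.\<close>

lemma chord:
  assumes X: "x \<in> X" "y \<in> X" "z \<in> X" "p \<in> X" "q \<in> X" "q' \<in> X" "x \<noteq> y" "z \<noteq> p" "q \<noteq> q'"
    and w: "L.J z p = L.J x y" and v: "R.J q q' = R.J x y"
    and sub: "L.J x y \<subset> L.J q q'" "R.J x y \<subset> R.J z p"
    and zq: "tR x p z" "tL x q' q"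
  shows "tR x y z" "tR x q z" "tL x y q" "tL x z q" "L.J z q = L.J q q'" "R.J z q = R.J z p"
    and "tL x z y \<and> tR x q y \<or> tL y z x \<and> tR y q x \<or>
      (tL x z y \<and> tR y q x \<or> tL y z x \<and> tR x q y) \<and>
      ((L.side (L.J x y) x = R.side (R.J x y) x) = (L.side (L.J z p) z = R.side (R.J z p) z)) =
      ((L.side (L.J q q') q = R.side (R.J q q') q) = (L.side (L.J z q) z = R.side (R.J z q) z))"
proof -
  have v': "R.J z p = R.J x z" and u: "L.J q q' = L.J x q"
    using R.J_side[OF zq(1)] L.J_side[OF zq(2)] R.J_commute L.J_commute by auto
  show 1: "tR x y z"
  proof (rule ccontr)
    assume "\<not> tR x y z"
    then have "R.J x z \<subseteq> R.J x y" using R.J_mono X R.J_self unfolding R.J_def by blast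
    then show False using sub v' by auto
  qed
  show 2: "tL x y q"
  proof (rule ccontr)
    assume "\<not> tL x y q"
    then have "L.J x q \<subseteq> L.J x y" using L.J_mono X L.J_self unfolding L.J_def by blast
    then show False using sub u by auto
  qed
  have qv: "q \<in> R.J x y" and zw: "z \<in> L.J x y" using v w X R.J_self L.J_self by blast+
  show 3: "tR x q z"
  proof (rule ccontr)
    assume "\<not> tR x q z"
    then have "z \<in> R.J x y" using R.J_mono[OF R.J_self(1) qv] X unfolding R.J_def by blast
    then show False using 1 unfolding R.J_def by auto
  qed
  show 4: "tL x z q"
  proof (rule ccontr)
    assume "\<not> tL x z q"
    then have "q \<in> L.J x y" using L.J_mono[OF L.J_self(1) zw] X unfolding L.J_def by blast
    then show False using 2 unfolding L.J_def by auto
  qed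
  show 5: "L.J z q = L.J q q'" using L.J_side[OF 4] u by simp
  show 6: "R.J z q = R.J z p" using R.J_side[OF 3] v' R.J_commute by metis
  have zw': "tL x z y \<or> tL y z x" and qv': "tR x q y \<or> tR y q x"
    using L.J_sides[OF zw] R.J_sides[OF qv] X by auto
  have "z \<noteq> q" using 4 L.neq L.sym by blast
  \<comment> \<open>The labels at the larger nodes cancel: at the left one \<open>z\<close> and
    \<open>q\<close> are opposite, and at the right one both pairs containing \<open>z\<close> use
    its label. What remains is the comparison at the two smaller nodes.\<close>
  have s: "L.side (L.J z q) z \<noteq> L.side (L.J z q) q" using L.side_neq X \<open>z \<noteq> q\<close> by blast
  have sw: "L.side (L.J x y) x \<noteq> L.side (L.J x y) y" "R.side (R.J x y) x \<noteq> R.side (R.J x y) y"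
    using L.side_neq R.side_neq X by blast+
  have a: "tL x z y \<Longrightarrow> L.side (L.J x y) z = L.side (L.J x y) x"
    "tL y z x \<Longrightarrow> L.side (L.J x y) z = L.side (L.J x y) y"
    "tR x q y \<Longrightarrow> R.side (R.J x y) q = R.side (R.J x y) x"
    "tR y q x \<Longrightarrow> R.side (R.J x y) q = R.side (R.J x y) y"
    using L.side_eq R.side_eq L.J_commute R.J_commute by metis+
  show "tL x z y \<and> tR x q y \<or> tL y z x \<and> tR y q x \<or>
      (tL x z y \<and> tR y q x \<or> tL y z x \<and> tR x q y) \<and>
      ((L.side (L.J x y) x = R.side (R.J x y) x) = (L.side (L.J z p) z = R.side (R.J z p) z)) =
      ((L.side (L.J q q') q = R.side (R.J q q') q) = (L.side (L.J z q) z = R.side (R.J z q) z))"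
    using zw' qv' s sw a unfolding 5 6 w v by auto
qed

text \<open>
  Two disjoint neighbours of a node yield copies of \<open>K1\<close>, so uniqueness forces them to be cherries.
\<close>

lemma cherry:
  assumes uniq: "\<And>P P'. pat P \<Longrightarrow> pat P' \<Longrightarrow> P = P'"
    and X: "x \<in> X" "y \<in> X" "p \<in> X" "p' \<in> X" "x \<noteq> y" "p \<noteq> p'"
    and w: "L.J x y = L.J p p'" and disj: "R.J x y \<inter> R.J p p' = {}" and e: "e \<in> R.J x y"
  shows "e = x \<or> e = y"
proof -
  have goal: "e = x \<or> e = y" if X': "p \<in> X" "p' \<in> X" "p \<noteq> p'" and w: "L.J x y = L.J p p'"
    and disj: "R.J x y \<inter> R.J p p' = {}" and t: "tL x p y" for p p'
  proof (rule ccontr)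
    assume ne: "\<not> (e = x \<or> e = y)"
    have eX: "e \<in> X" using e unfolding R.J_def by auto
    have "tL y p' x" using L.J_opposite[OF w t] X' by blast
    note t = t this
    have out: "tR a b c" if "c \<in> X" "c \<notin> R.J a b" for a b c using that unfolding R.J_def by auto
    have "x \<notin> R.J p p'" "y \<notin> R.J p p'" "e \<notin> R.J p p'" "p \<notin> R.J x y" "p' \<notin> R.J x y"
      using disj e R.J_self X X' by blast+
    then have r: "tR x y p" "tR x y p'" "tR p p' x" "tR p p' y" "tR p p' e"
      using out X X' eX by auto
    have d: "e \<noteq> p" "e \<noteq> p'" using disj e R.J_self X' by blast+
    have P: "pat {x, p, y, p'}" by (rule K1q_pat) (simp add: K1q_def t r)
    have Re: "tR x e p" "tR y e p" "tR x e p'" "tR y e p'" "\<not> tR x y e"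
    proof -
      show n: "\<not> tR x y e" using e unfolding R.J_def by auto
      show "tR x e p" "tR x e p'" using R.branch[OF r(1) eX] R.branch[OF r(2) eX] n by auto
      show "tR y e p" "tR y e p'"
        using R.branch[OF R.sym[OF r(1)] eX] R.branch[OF R.sym[OF r(2)] eX] n R.sym by blast+
    qed
    \<comment> \<open>A further leaf \<open>e\<close> of the right node leads to a second
      obstruction: a \<open>K2\<close> if \<open>e\<close> lies outside the left node, and otherwise
      a \<open>K1\<close> in which \<open>e\<close> replaces \<open>x\<close> or
      \<open>y\<close>.\<close>
    show False
    proof (cases "tL x y e")
      case True
      have le: "tL y p e" "tL x p' e"
      proof -
        have "p \<in> L.J x y" "p' \<in> L.J x y" using w L.J_self X' by auto
        then have n: "\<not> tL x y p" "\<not> tL x y p'" unfolding L.J_def by auto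
        show "tL y p e" using L.branch[OF True, of p] n L.branch[OF L.sym[OF True], of p] L.sym X'(1) by blast
        show "tL x p' e" using L.branch[OF True, of p'] n X'(2) by blast
      qed
      from R.J_sides[OF e] X have "tR x e y \<or> tR y e x" by auto
      then show False
      proof
        assume "tR x e y"
        then have "K2q e y x p" unfolding K2q_def using t le Re by blast
        then show False using uniq[OF K2q_pat P] ne d by blast
      next
        assume "tR y e x"
        then have "K2q e x y p'" unfolding K2q_def using t le Re by blast
        then show False using uniq[OF K2q_pat P] ne d by blast
      qed
    next
      case False
      then have "tL x e y \<or> tL y e x" using L.total[of x y e] X eX ne by auto
      then show False
      proof
        assume a: "tL x e y"
        have "tL e p y" using a t L.sym L.trans by blast
        moreover have "tL y p' e" using a t L.sym L.branch[OF t(2) eX] L.asym by blast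
        moreover have "tR e y p" using Re R.sym by blast
        ultimately have "K1q e p y p'" using r unfolding K1q_def by blast
        then show False using uniq[OF K1q_pat P] ne d by blast
      next
        assume a: "tL y e x"
        have "tL e p' x" using a t L.sym L.trans by blast
        moreover have "tL x p e" using a t L.sym L.branch[OF t(1) eX] L.asym by blast
        moreover have "tR e x p" using Re R.sym by blast
        ultimately have "K1q x p e p'" using r Re unfolding K1q_def by blast
        then show False using uniq[OF K1q_pat P] ne d by blast
      qed
    qed
  qed
  have "tL x p y \<or> tL x p' y"
    using L.J_same_sides[OF w] X by blast
  then show ?thesis
    using goal[of p p'] goal[of p' p] w disj X L.J_commute[of p p'] R.J_commute[of p p'] by auto
qed

lemma cherry_left:
  assumes uniq: "\<And>P P'. pat P \<Longrightarrow> pat P' \<Longrightarrow> P = P'"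
    and X: "x \<in> X" "y \<in> X" "p \<in> X" "p' \<in> X" "x \<noteq> y" "p \<noteq> p'"
    and "R.J x y = R.J p p'" "L.J x y \<inter> L.J p p' = {}" "e \<in> L.J x y"
  shows "e = x \<or> e = y"
  using triple_pair.cherry[OF swap, unfolded pat_swap, of x y p p' e] assms by blast

text \<open>
  \<open>E0\<close>: parallel edges do not conflict once \<open>D\<close> is dropped; \<open>E1\<close>: every copy of \<open>K2\<close> uses \<open>D\<close>; \<open>E2\<close>: the
  pair \<open>{z, q}\<close> closing a chord, found in \<open>chord\<close>, is never the dropped pair.
\<close>

context
  fixes D
  assumes uniq: "\<And>P P'. pat P \<Longrightarrow> pat P' \<Longrightarrow> P = P'"
    and E1: "\<And>x y z p q. \<lbrakk>K2q q y x z; tR x p z; L.J z p = L.J x y; {z, p} \<noteq> D; x \<in> X; y \<in> X; z \<in> X; p \<in> X; z \<noteq> p\<rbrakk> \<Longrightarrow> False"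
    and E2: "\<And>x y z q. \<lbrakk>tL x y q; tL x z q; tR x y z; tR x q z; tL x z y; tR y q x; x \<noteq> y; {z, q} = D\<rbrakk> \<Longrightarrow> False"
begin

text \<open>The vertex of higher rank required by the balance criterion is \<open>u\<close> itself.
  Once \<open>w \<subset> u\<close> is known, \<open>chord\<close> supplies the missing edge from
  \<open>u\<close> to \<open>v'\<close>.\<close>

lemma adj_square_half:
  assumes adj: "adj D w v s1" "adj D w v' s2" "adj D u v s3"
    and u: "u \<noteq> w" "card w \<le> card u" and v: "v \<subset> v'"
  shows "card w < card u \<and> (\<exists>t t'. adj D u v t \<and> adj D u v' t' \<and> ((s1 = s2) = (t = t')))"
proof -
  obtain x y where xy: "x \<in> X" "y \<in> X" "x \<noteq> y" "{x, y} \<noteq> D" "L.J x y = w" "R.J x y = v"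
    "s1 = (L.side w x = R.side v x)" using adj(1) unfolding adj_def by blast
  \<comment> \<open>Exchanging the two ends of a pair flips both labels and so keeps the sign. Hence
    \<open>x\<close> may be assumed to lie on the side of \<open>p\<close>.\<close>
  obtain z p where zp: "z \<in> X" "p \<in> X" "z \<noteq> p" "{z, p} \<noteq> D" "L.J z p = w" "R.J z p = v'"
    "s2 = (L.side w z = R.side v' z)" "tR x p z"
  proof -
    obtain p1 p2 where p: "p1 \<in> X" "p2 \<in> X" "p1 \<noteq> p2" "{p1, p2} \<noteq> D" "L.J p1 p2 = w" "R.J p1 p2 = v'"
      "s2 = (L.side w p1 = R.side v' p1)" using adj(2) unfolding adj_def by blast
    have "x \<in> R.J p1 p2" using xy v p R.J_self by blast
    then consider "tR x p2 p1" | "tR x p1 p2" using R.J_sides p R.sym by blast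
    then show ?thesis
    proof cases
      case 1 then show ?thesis using that p by blast
    next
      case 2
      have "s2 = (L.side w p2 = R.side v' p2)"
        using p(7) L.side_neq[OF p(1-3)] R.side_neq[OF p(1-3)] p(5,6) by auto
      then show ?thesis using that[of p2 p1] p 2 L.J_commute R.J_commute by (metis insert_commute)
    qed
  qed
  have wu: "w \<subset> u"
  proof -
    obtain q q' where q: "q \<in> X" "q' \<in> X" "q \<noteq> q'" "{q, q'} \<noteq> D" "L.J q q' = u" "R.J q q' = v"
      using adj(3) unfolding adj_def by blast
    \<comment> \<open>As disjoint neighbours of \<open>v\<close>, the nodes \<open>w\<close> and
      \<open>u\<close> would be cherries. Both edges at \<open>w\<close> would then come from the
      same pair, against \<open>v \<noteq> v'\<close>.\<close>
    have "w \<inter> u \<noteq> {}"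
    proof
      assume disj: "w \<inter> u = {}"
      have "z \<in> {x, y}" "p \<in> {x, y}"
        using cherry_left[OF uniq xy(1,2) q(1,2) xy(3) q(3), of z]
          cherry_left[OF uniq xy(1,2) q(1,2) xy(3) q(3), of p] L.J_self(1)[of z p] L.J_self(2)[of p z]
        unfolding xy q zp using disj zp by auto
      then have "{z, p} = {x, y}" using zp by auto
      then have "R.J z p = R.J x y" using R.J_commute by (metis doubleton_eq_iff)
      then show False using xy zp v by auto
    qed
    then have "w \<subseteq> u \<or> u \<subseteq> w" using L.J_laminar[OF xy(1-3) q(1-3)] xy q by auto
    then show ?thesis using u card_seteq[of w u] L.J_finite xy(5) by blast
  qed
  obtain q q' where q: "q \<in> X" "q' \<in> X" "q \<noteq> q'" "{q, q'} \<noteq> D" "L.J q q' = u" "R.J q q' = v"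
    "s3 = (L.side u q = R.side v q)" "tL x q' q"
  proof -
    obtain p1 p2 where p: "p1 \<in> X" "p2 \<in> X" "p1 \<noteq> p2" "{p1, p2} \<noteq> D" "L.J p1 p2 = u" "R.J p1 p2 = v"
      "s3 = (L.side u p1 = R.side v p1)" using adj(3) unfolding adj_def by blast
    have "x \<in> L.J p1 p2" using xy wu p L.J_self by blast
    then consider "tL x p2 p1" | "tL x p1 p2" using L.J_sides p L.sym by blast
    then show ?thesis
    proof cases
      case 1 then show ?thesis using that p by blast
    next
      case 2
      have "s3 = (L.side u p2 = R.side v p2)"
        using p(7) L.side_neq[OF p(1-3)] R.side_neq[OF p(1-3)] p(5,6) by auto
      then show ?thesis using that[of p2 p1] p 2 L.J_commute R.J_commute by (metis insert_commute)
    qed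
  qed
  have sub: "L.J x y \<subset> L.J q q'" "R.J x y \<subset> R.J z p" "L.J z p = L.J x y" "R.J q q' = R.J x y"
    using wu v xy zp q by auto
  note ch = chord[OF xy(1,2) zp(1,2) q(1,2) xy(3) zp(3) q(3) sub(3,4,1,2) zp(8) q(8)]
  have sy: "tL y x q" "tL y z q" "tR y x z" "tR y q z"
    using ch(1-4) L.sym R.sym L.trans R.trans by blast+
  have ryp: "tR y p z" using zp(8) ch(1) R.sym R.trans by blast
  have nK: "\<not> (tL x z y \<and> tR x q y)" "\<not> (tL y z x \<and> tR y q x)"
  proof -
    have "K2q q y x z" if "tL x z y" "tR x q y" unfolding K2q_def using that ch sy R.sym L.sym by blast
    then show "\<not> (tL x z y \<and> tR x q y)" using E1[OF _ zp(8) sub(3) zp(4) xy(1,2) zp(1-3), of q] by blast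
    have "K2q q x y z" if "tL y z x" "tR y q x" unfolding K2q_def using that ch sy R.sym L.sym by blast
    then show "\<not> (tL y z x \<and> tR y q x)"
      using E1[OF _ ryp sub(3)[unfolded L.J_commute[of x y]] zp(4) xy(2,1) zp(1-3), of q] by blast
  qed
  have nD: "{z, q} \<noteq> D"
  proof
    assume D: "{z, q} = D"
    show False
      using ch(7) E2[OF ch(3,4,1,2) _ _ xy(3) D] E2[OF sy _ _ _ D] xy(3) nK by blast
  qed
  have "z \<noteq> q" using ch(4) L.neq L.sym by blast
  define t' where "t' = (L.side (L.J z q) z = R.side (R.J z q) z)"
  have "adj D u v' t'" unfolding adj_def using zp(1) q(1) \<open>z \<noteq> q\<close> nD ch(5,6) q(5) zp(6) t'_def by metis
  moreover have "(s1 = s2) = (s3 = t')"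
    using ch(7) nK unfolding t'_def xy(7) zp(7) q(7) xy(5,6) zp(5,6) q(5,6) by blast
  moreover have "card w < card u" using wu psubset_card_mono[of u w] L.J_finite q(5) by metis
  ultimately show ?thesis using adj(3) by blast
qed

text \<open>The rank of a left node is its number of leaves. Two neighbours \<open>v\<close>,
  \<open>v'\<close> of \<open>w\<close> are nested, since disjoint ones would be cherries; the other
  left node attached to the smaller of them completes the square.\<close>

lemma resolve:
  assumes E0: "\<And>x y x' y'. K1q x x' y' y \<Longrightarrow> {x, y} = D \<or> {x', y'} = D"
  shows "agree_off D"
proof -
  let ?U = "{L.J x y | x y. x \<in> X \<and> y \<in> X \<and> x \<noteq> y}"
  have "\<exists>(f::_ \<Rightarrow> bool) g. \<forall>u\<in>?U. \<forall>v s. adj D u v s \<longrightarrow> (f u = g v) = s"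
  proof (rule signed_bipartite_balance[where rk = card])
    have "?U \<subseteq> Pow X" unfolding L.J_def by auto
    then show "finite ?U" using L.fin finite_subset by blast
  next
    fix u v s s' assume a: "u \<in> ?U" "adj D u v s" "adj D u v s'"
    obtain x y where xy: "x \<in> X" "y \<in> X" "x \<noteq> y" "{x, y} \<noteq> D" "L.J x y = u" "R.J x y = v"
      "s = (L.side u x = R.side v x)" using a(2) unfolding adj_def by blast
    obtain p p' where p: "p \<in> X" "p' \<in> X" "p \<noteq> p'" "{p, p'} \<noteq> D" "L.J p p' = u" "R.J p p' = v"
      "s' = (L.side u p = R.side v p)" using a(3) unfolding adj_def by blast
    show "s = s'"
    proof (rule ccontr)
      assume ne: "s \<noteq> s'"
      have l: "tL x p y \<and> tL y p' x \<or> tL x p' y \<and> tL y p x"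
        using L.J_same_sides[of x y p p'] xy p by simp
      have r: "tR x p y \<and> tR y p' x \<or> tR x p' y \<and> tR y p x"
        using R.J_same_sides[of x y p p'] xy p by simp
      have sl: "tL x p y \<Longrightarrow> L.side u p = L.side u x" "tL y p x \<Longrightarrow> L.side u p = L.side u y"
         "tR x p y \<Longrightarrow> R.side v p = R.side v x" "tR y p x \<Longrightarrow> R.side v p = R.side v y"
        using xy L.side_eq R.side_eq L.J_commute R.J_commute by metis+
      have sn: "L.side u x \<noteq> L.side u y" "R.side v x \<noteq> R.side v y"
        using xy L.side_neq R.side_neq by metis+
      \<comment> \<open>Different signs mean that the two pairs match up one way in the left tree
        and the other way in the right tree. This is a \<open>K1\<close> whose diagonals are the two
        pairs.\<close>
      have k: "tL x p y \<and> tL y p' x \<and> tR x p' y \<and> tR y p x \<or> tL x p' y \<and> tL y p x \<and> tR x p y \<and> tR y p' x"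
        using l r ne sl sn xy(7) p(7) by metis
      have "K1q x p p' y \<or> K1q x p' p y"
      proof -
        have *: "K1q x a b y" if "tL x a y" "tL y b x" "tR x b y" "tR y a x" for a b
        proof -
          have "tL x a b" using that L.branch[of x a y b] L.dom L.asym L.sym by meson
          moreover have "tR x b a" using that R.branch[of x b y a] R.dom R.asym R.sym by meson
          ultimately show ?thesis unfolding K1q_def using that L.sym R.sym by blast
        qed
        show ?thesis using k *[of p p'] *[of p' p] by blast
      qed
      then show False using E0 xy(4) p(4) by (metis insert_commute)
    qed
  next
    fix w u u' v v' s1 s2 s3 s4
    assume h: "w \<in> ?U" "u \<in> ?U" "u' \<in> ?U" "u \<noteq> w" "u' \<noteq> w" "card w \<le> card u" "card w \<le> card u'"
      "v \<noteq> v'" "adj D w v s1" "adj D w v' s2" "adj D u v s3" "adj D u' v' s4"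
    obtain x y where xy: "x \<in> X" "y \<in> X" "x \<noteq> y" "L.J x y = w" "R.J x y = v"
      using h(9) unfolding adj_def by blast
    obtain p p' where p: "p \<in> X" "p' \<in> X" "p \<noteq> p'" "L.J p p' = w" "R.J p p' = v'"
      using h(10) unfolding adj_def by blast
    obtain q q' where q: "q \<in> X" "q' \<in> X" "q \<noteq> q'" "L.J q q' = u" "R.J q q' = v"
      using h(11) unfolding adj_def by blast
    have "v \<inter> v' \<noteq> {}"
    proof
      assume disj: "v \<inter> v' = {}"
      have "q \<in> {x, y}" "q' \<in> {x, y}"
        using cherry[OF uniq xy(1,2) p(1,2) xy(3) p(3), of q]
          cherry[OF uniq xy(1,2) p(1,2) xy(3) p(3), of q'] R.J_self[of q q'] R.J_self[of q' q]
        unfolding xy p q R.J_commute[of q' q] using disj q xy p by auto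
      then have "{q, q'} = {x, y}" using q by auto
      then have "L.J q q' = L.J x y" using L.J_commute by (metis doubleton_eq_iff)
      then show False using q xy h by auto
    qed
    then have "v \<subset> v' \<or> v' \<subset> v" using R.J_laminar[OF xy(1-3) p(1-3)] xy p h(8) by auto
    then show "\<exists>x\<in>?U. card w < card x \<and> (\<exists>t t'. adj D x v t \<and> adj D x v' t' \<and> ((s1 = s2) = (t = t')))"
    proof
      assume "v \<subset> v'"
      from adj_square_half[OF h(9-11,4,6) this] h(2) show ?thesis by blast
    next
      assume "v' \<subset> v"
      from adj_square_half[OF h(10,9,12,5,7) this]
      obtain t t' where "card w < card u'" "adj D u' v' t" "adj D u' v t'" "(s2 = s1) = (t = t')"
        by blast
      then show ?thesis using h(3) by (intro bexI[of _ u'] conjI exI[of _ t'] exI[of _ t]) auto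
    qed
  qed
  then obtain f :: "_ \<Rightarrow> bool" and g where "\<forall>u\<in>?U. \<forall>v s. adj D u v s \<longrightarrow> (f u = g v) = s"
    by (elim exE)
  then have fg: "(f u = g v) = s" if "u \<in> ?U" "adj D u v s" for u v s using that by simp
  have "L.lt f x y \<longleftrightarrow> R.lt g x y" if xy: "x \<in> X" "y \<in> X" "x \<noteq> y" "{x, y} \<noteq> D" for x y
  proof -
    have "adj D (L.J x y) (R.J x y) (L.side (L.J x y) x = R.side (R.J x y) x)"
      unfolding adj_def using xy by blast
    from fg[OF _ this] xy show ?thesis unfolding L.lt_def R.lt_def by auto
  qed
  then show ?thesis unfolding agree_off_def by blast
qed

end

end

section \<open>Rigidity of the obstructions and the choice of the dropped pair\<close>

context triple_pair begin

lemma K1q_full: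
  assumes "K1q a b c d"
  shows "tL a b c" "tL a b d" "tL c d a" "tL c d b" "tR a c b" "tR a c d" "tR b d a" "tR b d c"
    "a \<noteq> b" "a \<noteq> c" "a \<noteq> d" "b \<noteq> c" "b \<noteq> d" "c \<noteq> d"
proof -
  have h: "tL a b c" "tL c d a" "tR a c b" "tR b d a" using assms unfolding K1q_def by auto
  note [dest] = L.neq R.neq
  show l: "tL a b c" "tL a b d" "tL c d a" "tL c d b"
    using h L.branch[OF h(1), of d] L.branch[OF h(2), of b] L.dom L.sym L.asym by meson+
  show "tR a c b" "tR a c d" "tR b d a" "tR b d c"
    using h R.branch[OF h(3), of d] R.branch[OF h(4), of c] R.dom R.sym R.asym by meson+
  then show "a \<noteq> b" "a \<noteq> c" "a \<noteq> d" "b \<noteq> c" "b \<noteq> d" "c \<noteq> d"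
    using l L.neq R.neq L.sym R.sym by blast+
qed

lemma K2q_full:
  assumes "K2q p q r s"
  shows "tL r s q" "tL r s p" "tL q r p" "tL q s p" "tR r p q" "tR r p s" "tR q p s" "tR q r s"
    "p \<noteq> q" "p \<noteq> r" "p \<noteq> s" "q \<noteq> r" "q \<noteq> s" "r \<noteq> s"
proof -
  have h: "tL r s q" "tL q s p" "tR r p q" "tR q p s" using assms unfolding K2q_def by auto
  show l1: "tL r s q" "tL q s p" "tR r p q" "tR q p s" by (fact h)+
  show l2: "tL r s p" using h(1,2) L.branch[OF h(1), of p] L.dom L.sym L.asym L.trans by meson
  show l3: "tR r p s" using h(3,4) R.branch[OF h(3), of s] R.dom R.sym R.asym R.trans by meson
  show l4: "tL q r p" using l2 h L.sym L.trans by meson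
  show l5: "tR q r s" using l3 h R.sym R.trans by meson
  show "p \<noteq> q" "p \<noteq> r" "p \<noteq> s" "q \<noteq> r" "q \<noteq> s" "r \<noteq> s"
    using h l2 l3 l4 l5 L.neq R.neq L.sym R.sym L.asym R.asym by blast+
qed

text \<open>In the left tree of a \<open>K2\<close>, the three elements other than \<open>p\<close>
  form a cluster that avoids \<open>p\<close>. In a \<open>K1\<close> every element shares a left
  cherry with another one, so none is split off in this way.\<close>

lemma K1q_K2q_exclusive:
  assumes "K1q a b c d" "K2q p q r s" "{p, q, r, s} = {a, b, c, d}"
  shows False
proof -
  note k = K1q_full[OF assms(1)] and l = K2q_full[OF assms(2)]
  have X: "e \<in> X" if "e \<in> {p, q, r, s}" for e using that l L.dom by blast
  have *: "tL e f p" if "e \<in> {a, b, c, d}" "f \<in> {a, b, c, d}" "e \<noteq> p" "f \<noteq> p" for e f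
    using that unfolding assms(3)[symmetric]
    by (elim insertE emptyE) (simp_all add: l l(1-4)[THEN L.sym] L.refl X)
  have "p \<in> {a, b, c, d}" using assms(3) by auto
  moreover have "\<not> tL b c a" "\<not> tL a c b" "\<not> tL d a c" "\<not> tL c a d"
    using k(1-4) k(1-4)[THEN L.sym] by (auto dest: L.asym)
  ultimately show False using *[of b c] *[of a c] *[of d a] *[of c a] k(9-14)
    by (elim insertE emptyE) simp_all
qed

text \<open>Among the pairs from these four elements, only \<open>a d\<close> and \<open>b c\<close>
  are split at the topmost branching in both trees. A different labelling of the same four elements
  therefore has the same diagonals.\<close>

lemma K1q_diagonals:
  assumes "K1q a b c d" "K1q x x' y' y" "{x, x', y', y} = {a, b, c, d}"
  shows "{x, y} = {b, c} \<or> {x', y'} = {b, c}"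
proof -
  note k = K1q_full[OF assms(1)] and l = K1q_full[OF assms(2)]
  have m: "x \<in> {a, b, c, d}" "y \<in> {a, b, c, d}" using assms(3) by auto
  have P: "(tL x e y \<or> tL y e x) \<and> (tR x e y \<or> tR y e x)" if "e \<in> {a, b, c, d}" "e \<noteq> x" "e \<noteq> y" for e
    using that unfolding assms(3)[symmetric] using l L.sym R.sym by blast
  have n: "\<not> tL a c b" "\<not> tL b c a" "\<not> tL c a d" "\<not> tL d a c"
    "\<not> tR a b c" "\<not> tR c b a" "\<not> tR b a d" "\<not> tR d a b"
    using k(1-8) k(1-4)[THEN L.sym] k(5-8)[THEN R.sym] by (auto dest: L.asym R.asym)
  have "\<not> (x = a \<and> y = b)" "\<not> (x = b \<and> y = a)" "\<not> (x = c \<and> y = d)" "\<not> (x = d \<and> y = c)"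
    "\<not> (x = a \<and> y = c)" "\<not> (x = c \<and> y = a)" "\<not> (x = b \<and> y = d)" "\<not> (x = d \<and> y = b)"
    using P[of a] P[of b] P[of c] n k(9-14) by (intro notI; elim conjE; simp)+
  then have "{x, y} = {b, c} \<or> {x, y} = {a, d}" using m l(11) by auto
  moreover have "{x', y'} = {b, c}" if "{x, y} = {a, d}"
  proof -
    have "{x', y'} = {x, x', y', y} - {x, y}" using l(9-14) by auto
    also have "\<dots> = {b, c}" unfolding assms(3) that using k(9-14) by auto
    finally show ?thesis .
  qed
  ultimately show ?thesis by blast
qed

text \<open>The labels can be recovered: \<open>p\<close> is the element split off first on the
  left, \<open>s\<close> the one split off first on the right, and \<open>r\<close> is the left
  cherry partner of \<open>s\<close>.\<close>

lemma K2q_labels: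
  assumes "K2q p q r s" "K2q p' q' r' s'" "{p', q', r', s'} = {p, q, r, s}"
  shows "p' = p" "q' = q" "r' = r" "s' = s"
proof -
  note k = K2q_full[OF assms(1)] and l = K2q_full[OF assms(2)]
  have X: "e \<in> X" if "e \<in> {p, q, r, s}" for e using that k L.dom by blast
  have 1: "tL e f p" if "e \<in> {p, q, r, s}" "f \<in> {p, q, r, s}" "e \<noteq> p" "f \<noteq> p" for e f
    using that by (elim insertE emptyE) (simp_all add: k k(1-4)[THEN L.sym] L.refl X)
  have 2: "tL e f p'" if "e \<in> {p, q, r, s}" "f \<in> {p, q, r, s}" "e \<noteq> p'" "f \<noteq> p'" for e f
    using that unfolding assms(3)[symmetric]
    by (elim insertE emptyE) (simp_all add: l l(1-4)[THEN L.sym] L.refl X[folded assms(3)])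
  have 3: "tR e f s" if "e \<in> {p, q, r, s}" "f \<in> {p, q, r, s}" "e \<noteq> s" "f \<noteq> s" for e f
    using that by (elim insertE emptyE) (simp_all add: k k(5-8)[THEN R.sym] R.refl X)
  have 4: "tR e f s'" if "e \<in> {p, q, r, s}" "f \<in> {p, q, r, s}" "e \<noteq> s'" "f \<noteq> s'" for e f
    using that unfolding assms(3)[symmetric]
    by (elim insertE emptyE) (simp_all add: l l(5-8)[THEN R.sym] R.refl X[folded assms(3)])
  have pm: "p \<in> {p, q, r, s}" "s \<in> {p, q, r, s}" "p' \<in> {p, q, r, s}" "s' \<in> {p, q, r, s}"
    using assms(3) by auto
  have third: "\<exists>e\<in>{p, q, r, s}. e \<noteq> u \<and> e \<noteq> v" for u v using k(9-14) by auto
  show p: "p' = p"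
  proof (rule ccontr)
    assume ne: "p' \<noteq> p"
    obtain e where "e \<in> {p, q, r, s}" "e \<noteq> p" "e \<noteq> p'" using third by blast
    then have "tL e p' p" "tL e p p'" 
      using 1[of e p'] 2[of e p] ne pm by (simp_all del: insert_iff)
    then show False using L.asym by blast
  qed
  show s: "s' = s"
  proof (rule ccontr)
    assume ne: "s' \<noteq> s"
    obtain e where "e \<in> {p, q, r, s}" "e \<noteq> s" "e \<noteq> s'" using third by blast
    then have "tR e s' s" "tR e s s'" 
      using 3[of e s'] 4[of e s] ne pm by (simp_all del: insert_iff)
    then show False using R.asym by blast
  qed
  have "q' = q \<and> r' = r \<or> q' = r \<and> r' = q" using assms(3) p s k(9-14) l(9-14) by auto
  then have "q' = q \<and> r' = r" using k(1) l(1) s L.asym L.sym by blast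
  then show "q' = q" "r' = r" by auto
qed

lemma agree_off_empty:
  assumes "\<And>Q. \<not> pat Q"
  shows "agree_off {}"
proof (rule resolve)
  show "False" if "K2q q y x z" for q y x z using K2q_pat[OF that] assms by blast
  show "{x, y} = {} \<or> {x', y'} = {}" if "K1q x x' y' y" for x x' y' y
    using K1q_pat[OF that] assms by blast
qed (use assms in auto)

text \<open>If the closing chord \<open>z q\<close> were \<open>b c\<close>, each of
  \<open>x\<close> and \<open>y\<close> could take the place of \<open>a\<close>, or each the place
  of \<open>d\<close>. Uniqueness of the obstruction would then make \<open>x\<close> and
  \<open>y\<close> equal.\<close>

lemma agree_off_K1q:
  assumes uniq: "\<And>P P'. pat P \<Longrightarrow> pat P' \<Longrightarrow> P = P'" and K: "K1q a b c d"
  shows "agree_off {b, c}"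
proof (rule resolve)
  note k = K1q_full[OF K]
  show "P = P'" if "pat P" "pat P'" for P P' using uniq that .
  show "{x, y} = {b, c} \<or> {x', y'} = {b, c}" if "K1q x x' y' y" for x x' y' y
    using K1q_diagonals[OF K that] uniq[OF K1q_pat[OF that] K1q_pat[OF K]] by blast
  show "False" if "K2q q y x z" for q y x z
    using K1q_K2q_exclusive[OF K that uniq[OF K2q_pat[OF that] K1q_pat[OF K]]] .
  fix x y z q
  assume h: "tL x y q" "tL x z q" "tR x y z" "tR x q z" "x \<noteq> y" "{z, q} = {b, c}"
  have y: "tL y z q" "tR y q z" using h L.sym L.trans R.sym R.trans by blast+
  have "z = b \<and> q = c \<or> z = c \<and> q = b" using h(6) by (auto simp: doubleton_eq_iff)
  then show False
  proof
    assume e: "z = b \<and> q = c"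
    have "x = a" if l: "tL x b c" and r: "tR x c b" for x
    proof -
      have "tL c d x" using L.branch[OF k(4), of x] l L.dom L.sym L.asym by meson
      moreover have "tR b d x" using R.branch[OF k(8), of x] r R.dom R.sym R.asym by meson
      ultimately have K': "K1q x b c d" unfolding K1q_def using l r by blast
      have "x \<in> {a, b, c, d}" using uniq[OF K1q_pat[OF K'] K1q_pat[OF K]] by blast
      then show ?thesis using K1q_full(9-14)[OF K'] by simp
    qed
    then show False using h y e by blast
  next
    assume e: "z = c \<and> q = b"
    have "x = d" if l: "tL x c b" and r: "tR x b c" for x
    proof -
      have X: "x \<in> X" "a \<in> X" using l k L.dom by blast+
      have "\<not> tL x a b" "\<not> tR x a c"
        using L.trans[OF L.sym l] L.asym[OF k(1)] R.trans[OF R.sym r] R.asym[OF k(5)] by blast+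
      then have "tL c x a" "tR b x a" using L.branch[OF l X(2)] R.branch[OF r X(2)] L.sym R.sym by blast+
      then have K': "K1q a b c x" unfolding K1q_def using k by blast
      have "x \<in> {a, b, c, d}" using uniq[OF K1q_pat[OF K'] K1q_pat[OF K]] by blast
      then show ?thesis using K1q_full(9-14)[OF K'] by simp
    qed
    then show False using h y e by blast
  qed
qed

text \<open>The unbalanced square behind the \<open>K2\<close> consists of the pairs
  \<open>k j\<close>, \<open>l j\<close>, \<open>i j\<close> and the chord \<open>i l\<close>.
  Dropping \<open>j l\<close> destroys it unless another pair \<open>l m\<close> yields the same
  edge, and such an \<open>m\<close> could replace \<open>j\<close> in the \<open>K2\<close>. The
  hypothesis \<open>wlog\<close> makes this replacement possible.\<close>

lemma agree_off_K2q:
  assumes uniq: "\<And>P P'. pat P \<Longrightarrow> pat P' \<Longrightarrow> P = P'" and K: "K2q i j k l"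
    and wlog: "\<And>e. \<not> (tL e j k \<and> tR e k j)"
  shows "agree_off {j, l}"
proof (rule resolve)
  note k = K2q_full[OF K]
  have iX: "i \<in> X" "j \<in> X" "k \<in> X" "l \<in> X" using k L.dom by blast+
  have noK1: "\<not> K1q a b c d" for a b c d
    using K1q_K2q_exclusive[OF _ K uniq[OF K2q_pat[OF K] K1q_pat]] by blast
  have eq: "{p, q, r, s} = {i, j, k, l}" if "K2q p q r s" for p q r s
    using uniq[OF K2q_pat[OF that] K2q_pat[OF K]] .
  show "P = P'" if "pat P" "pat P'" for P P' using uniq that .
  show "{x, y} = {j, l} \<or> {x', y'} = {j, l}" if "K1q x x' y' y" for x x' y' y
    using noK1 that by blast
  show False if h: "K2q q y x z" "tR x m z" "L.J z m = L.J x y" "{z, m} \<noteq> {j, l}" "m \<in> X" "z \<noteq> m"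
    for x y z m q
  proof -
    have e: "q = i" "y = j" "x = k" "z = l" using K2q_labels[OF K h(1) eq[OF h(1)]] by auto
    have m: "tL j m k" using L.J_opposite[of k j l m] h e k(1) iX by simp
    have "m \<noteq> j" using h(4) e by auto
    have "tL k l m" using L.branch[OF k(1) h(5)] m L.sym L.asym by blast
    moreover have "tL m l i"
      using L.branch[OF m, of i] k(3,4) m iX L.sym L.asym L.trans by meson
    \<comment> \<open>The alternative offered by \<open>branch\<close> is \<open>tR k m j\<close>;
      together with \<open>tL j m k\<close> it is excluded by \<open>wlog\<close>.\<close>
    moreover have "tR k i m" using R.branch[OF k(5) h(5)] wlog[of m] m R.sym L.sym by blast
    moreover have "tR m i l" using h(2) e k(6) R.sym R.trans by blast
    ultimately have "K2q i m k l" unfolding K2q_def by blast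
    then show False using K2q_labels[OF K _ eq] \<open>m \<noteq> j\<close> by blast
  qed
  fix x y z q
  assume h: "tL x y q" "tL x z q" "tR x y z" "tR x q z" "tL x z y" "x \<noteq> y" "{z, q} = {j, l}"
  have hy: "tL y z q" "tR y q z" using h L.sym L.trans R.sym R.trans by blast+
  have "z = l \<and> q = j \<or> z = j \<and> q = l" using h(7) by (auto simp: doubleton_eq_iff)
  then show False
  proof
    assume e: "z = l \<and> q = j"
    \<comment> \<open>Any position of \<open>x\<close> other than the asserted one gives a
      \<open>K2\<close> with labels different from \<open>i\<close>, \<open>j\<close>,
      \<open>k\<close>, \<open>l\<close>. Applied to \<open>x\<close> and to \<open>y\<close>, the
      claim groups both with \<open>k\<close> against \<open>l\<close>, contrary to
      \<open>tL x l y\<close>.\<close>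
    have *: "tL x k l" if l: "tL x l j" and r: "tR x j l" for x
    proof -
      have xX: "x \<in> X" using l L.dom by blast
      have ne: "x \<noteq> j" "x \<noteq> l" using l r L.neq R.neq by blast+
      have "\<not> tR j k x"
      proof
        assume a: "tR j k x"
        have "tL k x j" using l k L.sym L.trans by blast
        moreover have "tL j x i"
          using L.branch[OF l iX(1)] l k(4) L.sym L.trans L.asym by meson
        moreover have "tR j i x" using R.branch[OF a iX(1)] k(5) R.sym R.asym by blast
        ultimately have "K2q i j k x" unfolding K2q_def using k by blast
        then show False using K2q_labels[OF K _ eq] ne by blast
      qed
      then consider "x = k" | "tR x k j" | "tR x j k" "x \<noteq> k"
        using R.total[of j k x] ne iX xX k R.sym by metis
      then show ?thesis
      proof cases
        case 1
        then show ?thesis using L.refl iX k by simp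
      next
        case 2
        then have "tR x i j" using k R.trans by blast
        then have "K2q i j x l" unfolding K2q_def using l k by blast
        then have "x = k" using K2q_labels[OF K _ eq] by blast
        then show ?thesis using L.refl iX k by simp
      next
        case 3
        have "\<not> tL k l x"
        proof
          assume a: "tL k l x"
          have "tL x l i" using L.branch[OF l iX(1)] l k(4) L.sym L.trans L.asym by meson
          moreover have "tR k i x" using R.branch[OF k(5) xX] 3 R.sym R.asym by blast
          moreover have "tR x i l" using r k R.trans by blast
          ultimately have "K2q i x k l" unfolding K2q_def using a by blast
          then show False using K2q_labels[OF K _ eq] ne by blast
        qed
        moreover have "\<not> tL x l k"
        proof
          assume a: "tL x l k"
          have "K2q j k x l" unfolding K2q_def using a k 3 L.sym R.sym by blast
          then show False using K2q_labels[OF K _ eq] k by blast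
        qed
        ultimately show ?thesis using L.total[of x k l] xX iX ne 3 k L.sym by metis
      qed
    qed
    have "tL x k l" "tL y k l" using * h hy e by blast+
    then show False using h(5) e L.sym L.trans L.asym by blast
  next
    assume e: "z = j \<and> q = l"
    have x: "x \<in> X" using h L.dom by blast
    have "tL l k x" using L.branch[OF L.sym[OF k(1)] x] h e L.sym L.asym by blast
    moreover have "tR j k x" using R.branch[OF k(8) x] h e R.sym R.asym by blast
    ultimately have "K1q x j l k" unfolding K1q_def using h e by blast
    then show False using noK1 by blast
  qed
qed

lemma agree_off_unique:
  assumes uniq: "\<And>P P'. pat P \<Longrightarrow> pat P' \<Longrightarrow> P = P'"
  shows "\<exists>D. agree_off D"
proof (cases "\<exists>Q. pat Q")
  case False
  then show ?thesis using agree_off_empty by blast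
next
  case True
  then obtain i j k l where K: "K1q i j k l \<or> K2q i j k l" unfolding pat_def by blast
  show ?thesis
  proof (cases "K1q i j k l")
    case True
    then show ?thesis using agree_off_K1q[OF uniq] by blast
  next
    case False
    then have K: "K2q i j k l" using K by blast
    show ?thesis
    proof (cases "\<exists>e. tL e j k \<and> tR e k j")
      case False
      then show ?thesis using agree_off_K2q[OF uniq K] by blast
    next
      case True
      then obtain e where e: "tL e j k" "tR e k j" by blast
      have "\<not> (tR e' j k \<and> tL e' k j)" for e'
      proof
        assume a: "tR e' j k \<and> tL e' k j"
        have X: "e \<in> X" "e' \<in> X" using a e L.dom by blast+
        have "\<not> tL e' e j" "\<not> tR e' e k"
          using L.trans[of e e' j k] L.sym[of e' e j] L.asym[OF e(1)] R.trans[of e e' k j] R.sym[of e' e k]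
            R.asym[OF e(2)] a by blast+
        then have "tL e' k e" "tR e' j e" using L.branch[of e' k j e] R.branch[of e' j k e] a X by blast+
        then have K1: "K1q e j k e'" unfolding K1q_def using e L.sym R.sym by blast
        show False
          using K1q_K2q_exclusive[OF K1 K uniq[OF K2q_pat[OF K] K1q_pat[OF K1]]] .
      qed
      \<comment> \<open>Exchanging the two trees exchanges \<open>i\<close> with \<open>l\<close>
        and keeps \<open>j\<close> and \<open>k\<close>, so the dropped pair \<open>j l\<close>
        becomes \<open>j i\<close>.\<close>
      then have "triple_pair.agree_off X tR tL {j, i}"
        using triple_pair.agree_off_K2q[OF swap, unfolded pat_swap K2q_swap, where i = l and j = j and k = k and l = i] K uniq
        by blast
      then show ?thesis unfolding agree_off_swap by blast
    qed
  qed
qed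

lemma agree_off_positions:
  assumes "agree_off D"
  obtains posL posR :: "'b \<Rightarrow> real" where "inj_on posL X" "inj_on posR X"
    "\<And>a b c. tL a b c \<Longrightarrow> posL a < posL c \<longleftrightarrow> posL b < posL c"
    "\<And>a b c. tR a b c \<Longrightarrow> posR a < posR c \<longleftrightarrow> posR b < posR c"
    "\<And>x y. \<lbrakk>x \<in> X; y \<in> X; x \<noteq> y; {x, y} \<noteq> D\<rbrakk> \<Longrightarrow> posL x < posL y \<longleftrightarrow> posR x < posR y"
proof -
  obtain f g where
    "\<forall>x\<in>X. \<forall>y\<in>X. x \<noteq> y \<longrightarrow> {x, y} \<noteq> D \<longrightarrow> (L.lt f x y \<longleftrightarrow> R.lt g x y)"
    using assms unfolding agree_off_def by (elim exE)
  then have fg: "\<And>x y. \<lbrakk>x \<in> X; y \<in> X; x \<noteq> y; {x, y} \<noteq> D\<rbrakk> \<Longrightarrow> L.lt f x y \<longleftrightarrow> R.lt g x y" by simp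
  obtain posL :: "'b \<Rightarrow> real" where L: "\<And>x y. x \<in> X \<Longrightarrow> y \<in> X \<Longrightarrow> posL x < posL y \<longleftrightarrow> L.lt f x y" "inj_on posL X"
    using L.lt_positions[of f] by blast
  obtain posR :: "'b \<Rightarrow> real" where R: "\<And>x y. x \<in> X \<Longrightarrow> y \<in> X \<Longrightarrow> posR x < posR y \<longleftrightarrow> R.lt g x y" "inj_on posR X"
    using R.lt_positions[of g] by blast
  show ?thesis
  proof (rule that[of posL posR])
    show "posL a < posL c \<longleftrightarrow> posL b < posL c" if "tL a b c" for a b c
      using L L.dom[OF that] L.lt_side[OF that] by simp
    show "posR a < posR c \<longleftrightarrow> posR b < posR c" if "tR a b c" for a b c
      using R R.dom[OF that] R.lt_side[OF that] by simp
    show "posL x < posL y \<longleftrightarrow> posR x < posR y" if "x \<in> X" "y \<in> X" "x \<noteq> y" "{x, y} \<noteq> D" for x y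
      using fg that L R by simp
  qed (use L R in auto)
qed

end

section \<open>Root paths in binary trees\<close>

lemma path_edges_simps [simp]:
  "path_edges [] = {}" "path_edges [x] = {}"
  "path_edges (x # y # zs) = insert {x, y} (path_edges (y # zs))"
proof -
  show "path_edges (x # y # zs) = insert {x, y} (path_edges (y # zs))"
  proof (intro set_eqI iffI)
    fix e assume "e \<in> path_edges (x # y # zs)"
    then obtain i where "e = {(x # y # zs) ! i, (x # y # zs) ! Suc i}" "Suc i < length (x # y # zs)"
      unfolding path_edges_def by blast
    then show "e \<in> insert {x, y} (path_edges (y # zs))"
      unfolding path_edges_def by (cases i) auto
  next
    fix e assume "e \<in> insert {x, y} (path_edges (y # zs))"
    then consider "e = {x, y}" | i where "e = {(y # zs) ! i, (y # zs) ! Suc i}" "Suc i < length (y # zs)"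
      unfolding path_edges_def by blast
    then show "e \<in> path_edges (x # y # zs)"
    proof cases
      case 1
      then show ?thesis unfolding path_edges_def by (intro CollectI exI[of _ 0]) auto
    next
      case (2 i)
      then show ?thesis unfolding path_edges_def by (intro CollectI exI[of _ "Suc i"]) auto
    qed
  qed
qed (auto simp: path_edges_def)

lemma path_edges_append:
  "xs \<noteq> [] \<Longrightarrow> ys \<noteq> [] \<Longrightarrow> path_edges (xs @ ys) = path_edges xs \<union> path_edges ys \<union> {{last xs, hd ys}}"
proof (induction xs)
  case (Cons x xs)
  show ?case
  proof (cases xs)
    case Nil
    then show ?thesis using Cons.prems by (cases ys) auto
  next
    case (Cons x' xs')
    then show ?thesis using Cons.IH Cons.prems by auto
  qed
qed simp

lemma path_edges_rev: "path_edges (rev p) = path_edges p"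
proof (induction p)
  case IH: (Cons x p)
  then show ?case
  proof (cases p)
    case (Cons y ys)
    then have "path_edges (rev p @ [x]) = path_edges (rev p) \<union> {{y, x}}"
      using path_edges_append[of "rev p" "[x]"] by (simp add: last_rev)
    then show ?thesis using IH Cons by (simp add: insert_commute)
  qed simp
qed simp

locale binary_tree =
  fixes T :: "'a rooted_graph"
  assumes binary: "rooted_binary_tree T"
begin

abbreviation "r \<equiv> root_vertex T"
abbreviation "V \<equiv> verts T"
abbreviation "anc \<equiv> ancestor T"

lemma tree_T: "tree T" and root_in: "r \<in> V" and card_V: "card V \<ge> 2" and root_degree: "gdegree T r = 1"
  using binary unfolding rooted_binary_tree_def rooted_tree_def by auto

lemma finite_V: "finite V" using tree_T unfolding tree_def simple_graph_def by auto

lemma edge_cases: assumes "e \<in> edges T" obtains u v where "u \<in> V" "v \<in> V" "u \<noteq> v" "e = {u, v}"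
  using tree_T assms unfolding tree_def simple_graph_def by blast

definition rp :: "'a \<Rightarrow> 'a list" where "rp v = (THE p. gpath T r p v)"

lemma rp_gpath: "v \<in> V \<Longrightarrow> gpath T r (rp v) v"
  unfolding rp_def using tree_T root_in unfolding tree_def by (metis theI')

lemma gpath_unique: "gpath T u p v \<Longrightarrow> gpath T u q v \<Longrightarrow> p = q"
proof -
  assume a: "gpath T u p v" "gpath T u q v"
  then have "u \<in> V" "v \<in> V" unfolding gpath_def by (metis hd_in_set last_in_set subsetD)+
  then show ?thesis using a tree_T unfolding tree_def by blast
qed

lemma gpath_last_in: "gpath T u p v \<Longrightarrow> v \<in> V" unfolding gpath_def by (metis last_in_set subsetD)

lemma rp_eq: "gpath T r p v \<Longrightarrow> rp v = p" using gpath_unique rp_gpath gpath_last_in by blast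

lemma rp_props: assumes "v \<in> V"
  shows "rp v \<noteq> []" "hd (rp v) = r" "last (rp v) = v" "distinct (rp v)" "set (rp v) \<subseteq> V"
    "path_edges (rp v) \<subseteq> edges T"
  using rp_gpath[OF assms] unfolding gpath_def by auto

lemma rp_split: assumes "y \<in> V" "rp y = xs @ [x] @ ys" shows "rp x = xs @ [x]" "x \<in> V"
proof -
  have "gpath T r (xs @ [x]) x"
    unfolding gpath_def
  proof (intro conjI)
    show "hd (xs @ [x]) = r" using rp_props(2)[OF assms(1)] assms(2) by (cases xs) auto
    show "path_edges (xs @ [x]) \<subseteq> edges T"
      using rp_props(6)[OF assms(1)] unfolding assms(2)
      by (cases "ys = []") (auto simp: path_edges_append[of "xs @ [x]" ys, simplified])
    show "distinct (xs @ [x])" using rp_props(4)[OF assms(1)] assms(2) by auto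
    show "set (xs @ [x]) \<subseteq> V" using rp_props(5)[OF assms(1)] assms(2) by auto
  qed auto
  then show "rp x = xs @ [x]" "x \<in> V" using rp_eq gpath_last_in by auto
qed

lemma anc_iff: "anc x y \<longleftrightarrow> y \<in> V \<and> x \<in> set (rp y)"
  unfolding ancestor_def using rp_eq rp_gpath gpath_last_in by blast

text \<open>Ancestry becomes the prefix order on root paths: order laws, comparability above a
  vertex and lowest common ancestors turn into facts about lists.\<close>

lemma anc_prefix: "anc x y \<longleftrightarrow> x \<in> V \<and> y \<in> V \<and> prefix (rp x) (rp y)"
proof
  assume a: "anc x y"
  then have y: "y \<in> V" "x \<in> set (rp y)" using anc_iff by auto
  then obtain xs ys where s: "rp y = xs @ [x] @ ys" by (metis append_Cons append_Nil split_list)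
  show "x \<in> V \<and> y \<in> V \<and> prefix (rp x) (rp y)" using rp_split[OF y(1) s] y s by auto
next
  assume a: "x \<in> V \<and> y \<in> V \<and> prefix (rp x) (rp y)"
  then have "x \<in> set (rp x)" using rp_props by (metis last_in_set)
  then show "anc x y" using a set_mono_prefix unfolding anc_iff by blast
qed

lemma rp_inj: "x \<in> V \<Longrightarrow> y \<in> V \<Longrightarrow> rp x = rp y \<Longrightarrow> x = y" using rp_props(3) by metis

lemma anc_in: "anc x y \<Longrightarrow> x \<in> V \<and> y \<in> V" using anc_prefix by blast
lemma anc_refl: "x \<in> V \<Longrightarrow> anc x x" using anc_prefix by auto
lemma anc_trans: "anc x y \<Longrightarrow> anc y z \<Longrightarrow> anc x z" using anc_prefix prefix_order.trans by blast
lemma anc_antisym: "anc x y \<Longrightarrow> anc y x \<Longrightarrow> x = y" using anc_prefix rp_inj prefix_order.antisym by metis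
lemma anc_chain: "anc x z \<Longrightarrow> anc y z \<Longrightarrow> anc x y \<or> anc y x"
  unfolding anc_prefix by (auto dest: prefix_same_cases)
lemma rp_root: "rp r = [r]"
  by (rule rp_eq) (use root_in in \<open>simp add: gpath_def\<close>)
lemma anc_root: "v \<in> V \<Longrightarrow> anc r v"
  using rp_props(1,2)[of v] unfolding anc_iff by (metis hd_in_set)

text \<open>Parenthood is encoded by root paths instead of edges, which makes uniqueness of the
  parent a statement about lists; \<open>edges_eq\<close> recovers the edges.\<close>

definition par :: "'a \<Rightarrow> 'a \<Rightarrow> bool" where "par u v \<longleftrightarrow> u \<in> V \<and> v \<in> V \<and> rp v = rp u @ [v]"

lemma edge_par: assumes "{u, v} \<in> edges T" shows "par u v \<or> par v u"
proof -
  obtain a b where "a \<in> V" "b \<in> V" "a \<noteq> b" "{u, v} = {a, b}" using edge_cases[OF assms] by blast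
  then have V: "u \<in> V" "v \<in> V" "u \<noteq> v" by (auto simp: doubleton_eq_iff)
  have ext: "rp w = rp u @ [w]" if "u \<in> V" "w \<in> V" "{u, w} \<in> edges T" "w \<notin> set (rp u)" for u w :: 'a
  proof (rule rp_eq)
    show "gpath T r (rp u @ [w]) w"
      unfolding gpath_def using rp_props[OF that(1)] that by (auto simp: path_edges_append)
  qed
  show ?thesis
  proof (cases "v \<in> set (rp u)")
    case False
    then show ?thesis using ext[OF V(1,2) assms] V unfolding par_def by simp
  next
    case True
    then have "anc v u" using anc_iff V by simp
    then have "\<not> anc u v" using anc_antisym V by blast
    then have "u \<notin> set (rp v)" using anc_iff V by simp
    then show ?thesis using ext[of v u] V assms unfolding par_def by (simp add: insert_commute)
  qed
qed

lemma par_edge: assumes "par u v" shows "{u, v} \<in> edges T"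
proof -
  have "path_edges (rp u @ [v]) \<subseteq> edges T" using rp_props(6)[of v] assms unfolding par_def by simp
  then show ?thesis using rp_props[of u] assms unfolding par_def by (auto simp: path_edges_append)
qed

lemma edges_eq: "edges T = {{u, v} | u v. par u v}"
proof (intro set_eqI iffI)
  fix e assume e: "e \<in> edges T"
  then obtain u v where "e = {u, v}" using edge_cases by metis
  then show "e \<in> {{u, v} | u v. par u v}" using edge_par[of u v] e by (auto simp: insert_commute)
qed (use par_edge in auto)

lemma par_in: "par u v \<Longrightarrow> u \<in> V \<and> v \<in> V" unfolding par_def by simp
lemma par_anc: assumes "par u v" shows "anc u v" "u \<noteq> v"
  using assms rp_props(4)[of v] rp_props(1,3)[of u] unfolding par_def anc_prefix by auto
lemma par_not_root: assumes "par u v" shows "v \<noteq> r"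
  using assms rp_root rp_props(1)[of u] unfolding par_def by auto
lemma par_unique: "par u v \<Longrightarrow> par u' v \<Longrightarrow> u = u'" unfolding par_def using rp_inj by auto
lemma par_exists: assumes "v \<in> V" "v \<noteq> r" shows "\<exists>u. par u v"
proof -
  obtain xs where xs: "rp v = xs @ [v]" using rp_props[OF assms(1)] by (metis append_butlast_last_id)
  have "xs \<noteq> []" using rp_props(2)[OF assms(1)] xs assms(2) by auto
  then obtain ys u where "xs = ys @ [u]" by (metis append_butlast_last_id)
  then show ?thesis using rp_split[of v ys u "[v]"] xs assms unfolding par_def by auto
qed
lemma anc_par: assumes "anc x v" "x \<noteq> v" "par u v" shows "anc x u"
proof -
  have "prefix (rp x) (rp u @ [v])" "x \<in> V" using assms(1,3) unfolding anc_prefix par_def by auto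
  moreover have "rp x \<noteq> rp u @ [v]" using rp_inj assms calculation unfolding par_def by metis
  ultimately show ?thesis using assms(3) unfolding anc_prefix par_def by auto
qed

lemma child_toward: assumes "anc u v" "u \<noteq> v" obtains c where "par u c" "anc c v"
proof -
  obtain zs where zs: "rp v = rp u @ zs" using assms unfolding anc_prefix prefix_def by auto
  have "zs \<noteq> []" using zs assms rp_inj anc_in by (metis append_Nil2)
  then obtain c ws where "zs = c # ws" by (cases zs) auto
  then have "rp c = rp u @ [c]" "c \<in> V" using rp_split[of v "rp u" c ws] zs assms anc_in by auto
  then show ?thesis using that[of c] zs \<open>zs = c # ws\<close> assms anc_in unfolding par_def anc_prefix by auto
qed

lemma siblings: assumes "par u c" "par u c'" "c \<noteq> c'" shows "\<not> anc c c'"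
  using assms anc_par par_anc anc_antisym by blast

lemma siblings_disjoint: assumes "par u c" "par u c'" "anc c x" "anc c' x" shows "c = c'"
  using assms siblings anc_chain by blast

text \<open>The edges are indexed by their lower ends in \<open>W\<close>, a form shared by the
  whole tree and by a union of root paths. A vertex in \<open>W\<close> contributes one edge
  upwards.\<close>

lemma degree_of_child_set:
  assumes W: "W \<subseteq> V - {r}" and E: "edges G = {{u, c} | u c. par u c \<and> c \<in> W}" and v: "v \<in> V"
  shows "gdegree G v = (if v \<in> W then 1 else 0) + card {c \<in> W. par v c}"
proof -
  have fin: "finite {c \<in> W. par v c}" using finite_subset[OF _ finite_V, of "{c \<in> W. par v c}"] par_in by auto
  have eq: "{e \<in> edges G. v \<in> e} = (\<lambda>u. {u, v}) ` {u. par u v \<and> v \<in> W} \<union> (\<lambda>c. {v, c}) ` {c \<in> W. par v c}"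
    unfolding E by auto
  have one: "{u. par u v \<and> v \<in> W} = (if v \<in> W then {THE u. par u v} else {})"
  proof (cases "v \<in> W")
    case True
    then obtain u where u: "par u v" using par_exists W v by blast
    then have "(THE u. par u v) = u" using par_unique by blast
    then show ?thesis using True u par_unique by auto
  qed simp
  have "card {e \<in> edges G. v \<in> e} = card ((\<lambda>u. {u, v}) ` {u. par u v \<and> v \<in> W}) + card ((\<lambda>c. {v, c}) ` {c \<in> W. par v c})"
    unfolding eq
  proof (rule card_Un_disjoint)
    show "finite ((\<lambda>u. {u, v}) ` {u. par u v \<and> v \<in> W})" unfolding one by simp
    show "(\<lambda>u. {u, v}) ` {u. par u v \<and> v \<in> W} \<inter> (\<lambda>c. {v, c}) ` {c \<in> W. par v c} = {}"
    proof -
      have False if "par u v" "par v c" "{u, v} = {v, c}" for u c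
        using that par_anc anc_antisym by (metis doubleton_eq_iff)
      then show ?thesis by blast
    qed
  qed (use fin in simp)
  also have "card ((\<lambda>c. {v, c}) ` {c \<in> W. par v c}) = card {c \<in> W. par v c}"
    by (rule card_image) (auto simp: inj_on_def doubleton_eq_iff)
  also have "card ((\<lambda>u. {u, v}) ` {u. par u v \<and> v \<in> W}) = (if v \<in> W then 1 else 0)"
    unfolding one by simp
  finally show ?thesis unfolding gdegree_def .
qed

lemma degree_T: assumes "v \<in> V" shows "gdegree T v = (if v = r then 0 else 1) + card {c. par v c}"
proof -
  have "edges T = {{u, c} | u c. par u c \<and> c \<in> V - {r}}"
    unfolding edges_eq using par_in par_not_root by blast
  from degree_of_child_set[OF _ this assms]
  have "gdegree T v = (if v \<in> V - {r} then 1 else 0) + card {c \<in> V - {r}. par v c}" by simp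
  also have "{c \<in> V - {r}. par v c} = {c. par v c}" using par_in par_not_root by blast
  finally show ?thesis using assms by simp
qed

lemma finite_children: "finite {c. par v c}"
  by (rule finite_subset[OF _ finite_V]) (use par_in in auto)

lemma leaf_iff: "v \<in> leaves T \<longleftrightarrow> v \<in> V \<and> v \<noteq> r \<and> (\<forall>c. \<not> par v c)"
proof -
  have "card {c. par v c} = 0 \<longleftrightarrow> (\<forall>c. \<not> par v c)" using finite_children[of v] by auto
  then show ?thesis unfolding leaves_def using degree_T[of v] by auto
qed

lemma card_children: assumes "v \<in> V" "v \<notin> leaves T"
  shows "card {c. par v c} = (if v = r then 1 else 2)"
proof (cases "v = r")
  case True
  then show ?thesis using degree_T[OF assms(1)] root_degree by auto
next
  case False
  have "card {c. par v c} \<noteq> 0" using assms False leaf_iff finite_children[of v] by auto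
  then have "v \<in> internal_verts T" unfolding internal_verts_def using degree_T assms False by auto
  then have "gdegree T v = 3" using binary unfolding rooted_binary_tree_def by blast
  then show ?thesis using degree_T[OF assms(1)] False by auto
qed

lemma par_not_leaf: "par u c \<Longrightarrow> u \<notin> leaves T" using leaf_iff by blast

lemma third_child: assumes "par u a" "par u b" "par u c" shows "a = b \<or> a = c \<or> b = c"
proof (rule ccontr)
  assume "\<not> ?thesis"
  then have "card {a, b, c} = 3" by auto
  moreover have "card {a, b, c} \<le> card {c. par u c}"
    using assms by (intro card_mono finite_children) auto
  ultimately show False using card_children[of u] par_in[OF assms(1)] par_not_leaf[OF assms(1)] by (auto split: if_splits)
qed

lemma sibling_exists: assumes "par u c" "u \<noteq> r" obtains c' where "par u c'" "c' \<noteq> c"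
proof -
  have "card {c. par u c} = 2" using card_children[of u] par_in[OF assms(1)] par_not_leaf[OF assms(1)] assms(2) by auto
  then have "\<not> {c. par u c} \<subseteq> {c}" using card_mono[of "{c}" "{c. par u c}"] by auto
  then show ?thesis using that by auto
qed

lemma root_child: obtains c where "par r c"
proof -
  have "r \<notin> leaves T" using leaf_iff by auto
  then have "card {c. par r c} = 1" using card_children root_in by auto
  then show ?thesis using that by (metis card_1_singletonE mem_Collect_eq singletonI)
qed

lemma root_child_unique: assumes "par r c" "par r c'" shows "c = c'"
proof -
  have "r \<notin> leaves T" using leaf_iff by auto
  then have "card {c. par r c} = 1" using card_children root_in by auto
  then show ?thesis using assms by (metis card_1_singletonE mem_Collect_eq singletonD)
qed

lemma leaf_anc: assumes "l \<in> leaves T" "anc l x" shows "x = l"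
  using assms child_toward leaf_iff by metis

text \<open>A descendant of \<open>v\<close> with a longest root path has no child, and it is not
  the root because the root has one.\<close>

lemma leaf_below: assumes "v \<in> V" obtains l where "l \<in> leaves T" "anc v l"
proof -
  let ?D = "{w. anc v w}"
  have "finite ?D" by (rule finite_subset[OF _ finite_V]) (use anc_in in auto)
  moreover have "v \<in> ?D" using anc_refl assms by simp
  ultimately obtain w where w: "w \<in> ?D" "\<And>x. x \<in> ?D \<Longrightarrow> length (rp x) \<le> length (rp w)"
    using Max_in[of "(\<lambda>x. length (rp x)) ` ?D"] Max_ge[of "(\<lambda>x. length (rp x)) ` ?D"]
    by (smt (verit) empty_iff finite_imageI image_iff image_is_empty)
  have n: "\<not> par w c" for c
  proof
    assume p: "par w c"
    then have "anc v c" using w(1) par_anc anc_trans by blast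
    then show False using w(2)[of c] p unfolding par_def by simp
  qed
  then have "w \<noteq> r" using root_child by metis
  then have "w \<in> leaves T" using leaf_iff w(1) anc_in n by auto
  then show ?thesis using that w by auto
qed

section \<open>Lowest common ancestors and the triples of a tree\<close>

definition meet :: "'a \<Rightarrow> 'a \<Rightarrow> 'a" where "meet a b = last (longest_common_prefix (rp a) (rp b))"

lemma rp_meet: assumes "a \<in> V" "b \<in> V"
  shows "meet a b \<in> V" "rp (meet a b) = longest_common_prefix (rp a) (rp b)"
proof -
  let ?l = "longest_common_prefix (rp a) (rp b)"
  have "prefix [r] (rp a)" "prefix [r] (rp b)" using anc_root assms rp_root anc_prefix by metis+
  then have "prefix [r] ?l" by (rule longest_common_prefix_max_prefix)
  then have "?l \<noteq> []" by auto
  then have "?l = butlast ?l @ [meet a b]" unfolding meet_def by simp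
  moreover obtain ys where "rp a = ?l @ ys" using longest_common_prefix_prefix1 prefixE by metis
  ultimately have "rp a = butlast ?l @ [meet a b] @ ys" by (metis append_assoc)
  from rp_split[OF assms(1) this]
  show "meet a b \<in> V" "rp (meet a b) = ?l" using \<open>?l = butlast ?l @ [meet a b]\<close> by auto
qed

lemma anc_meet: assumes "a \<in> V" "b \<in> V" shows "anc x (meet a b) \<longleftrightarrow> anc x a \<and> anc x b"
  unfolding anc_prefix rp_meet(2)[OF assms] using rp_meet(1)[OF assms] assms
    longest_common_prefix_max_prefix longest_common_prefix_prefix1 longest_common_prefix_prefix2
    prefix_order.trans by blast

lemma meet_anc: "a \<in> V \<Longrightarrow> b \<in> V \<Longrightarrow> anc (meet a b) a" "a \<in> V \<Longrightarrow> b \<in> V \<Longrightarrow> anc (meet a b) b"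
  using anc_meet anc_refl rp_meet(1) by blast+

definition trip :: "'a \<Rightarrow> 'a \<Rightarrow> 'a \<Rightarrow> bool" where
  "trip a b c \<longleftrightarrow> a \<in> leaves T \<and> b \<in> leaves T \<and> c \<in> leaves T \<and> (\<exists>v. anc v a \<and> anc v b \<and> \<not> anc v c)"

lemma leaves_in: "l \<in> leaves T \<Longrightarrow> l \<in> V" using leaf_iff by blast

lemma trip_meet: "trip a b c \<longleftrightarrow> a \<in> leaves T \<and> b \<in> leaves T \<and> c \<in> leaves T \<and> \<not> anc (meet a b) c"
proof
  assume "trip a b c"
  then obtain v where v: "a \<in> leaves T" "b \<in> leaves T" "c \<in> leaves T" "anc v a" "anc v b" "\<not> anc v c"
    unfolding trip_def by blast
  then have "anc v (meet a b)" using anc_meet leaves_in by blast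
  then show "a \<in> leaves T \<and> b \<in> leaves T \<and> c \<in> leaves T \<and> \<not> anc (meet a b) c" using v anc_trans by blast
next
  assume a: "a \<in> leaves T \<and> b \<in> leaves T \<and> c \<in> leaves T \<and> \<not> anc (meet a b) c"
  then have "anc (meet a b) a" "anc (meet a b) b" using meet_anc leaves_in by blast+
  then show "trip a b c" unfolding trip_def using a by (intro conjI exI[of _ "meet a b"]) auto
qed

lemma trip_relation: "triple_relation (leaves T) trip"
proof
  show "finite (leaves T)" using finite_subset[OF _ finite_V] leaves_in by blast
  show "trip a b c \<Longrightarrow> a \<in> leaves T \<and> b \<in> leaves T \<and> c \<in> leaves T" for a b c unfolding trip_def by simp
  show "trip a b c \<Longrightarrow> trip b a c" for a b c unfolding trip_def by blast
  show "trip a b c \<Longrightarrow> a \<noteq> c" for a b c unfolding trip_def by blast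
  show "trip a a c" if "a \<in> leaves T" "c \<in> leaves T" "a \<noteq> c" for a c
  proof -
    have "anc a a" "\<not> anc a c" using anc_refl leaves_in leaf_anc that by auto
    then show ?thesis unfolding trip_def using that by blast
  qed
  show "\<not> trip a c b" if t: "trip a b c" for a b c
  proof
    assume "trip a c b"
    then obtain v w where "anc v a" "anc v b" "\<not> anc v c" "anc w a" "anc w c" "\<not> anc w b"
      using t unfolding trip_def by blast
    then show False using anc_chain[of v a w] anc_trans[of v w] anc_trans[of w v] by blast
  qed
  show "trip a d c" if t: "trip a b c" "trip b d c" for a b c d
  proof -
    obtain v w where vw: "anc v a" "anc v b" "\<not> anc v c" "anc w b" "anc w d" "\<not> anc w c"
      using t unfolding trip_def by blast
    then have "anc v d \<or> anc w a" using anc_chain[of v b w] anc_trans[of v w] anc_trans[of w v] by blast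
    then show ?thesis using vw t unfolding trip_def by blast
  qed
  show "trip a b c \<Longrightarrow> d \<in> leaves T \<Longrightarrow> trip a b d \<or> trip a d c" for a b c d
    unfolding trip_def by blast
  fix a b c assume l: "a \<in> leaves T" "b \<in> leaves T" "c \<in> leaves T" "a \<noteq> b" "a \<noteq> c" "b \<noteq> c"
  show "trip a b c \<or> trip a c b \<or> trip b c a"
  proof (rule ccontr)
    assume n: "\<not> ?thesis"
    define v where "v = meet a b"
    have v: "anc v a" "anc v b" "anc v c"
      using n l trip_meet meet_anc leaves_in unfolding v_def by blast+
    have "v \<noteq> a" "v \<noteq> b" "v \<noteq> c" using v l leaf_anc by blast+
    then obtain a' b' c' where ch: "par v a'" "anc a' a" "par v b'" "anc b' b" "par v c'" "anc c' c"
      using child_toward v by metis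
    have top: "False" if "anc w a" "anc w b" "par v w" for w
      using that anc_meet[of a b w] l leaves_in par_anc anc_antisym unfolding v_def by blast
    \<comment> \<open>Binary branching enters here: with three distinct children below
      \<open>v\<close>, the three leaves could remain unresolved.\<close>
    have "a' = b' \<or> a' = c' \<or> b' = c'" using third_child ch by blast
    then show False
    proof (elim disjE)
      assume "a' = b'" then show False using top ch by blast
    next
      assume e: "a' = c'"
      then have "anc a' b" using n l ch unfolding trip_def by blast
      then show False using top ch by blast
    next
      assume e: "b' = c'"
      then have "anc b' a" using n l ch unfolding trip_def by blast
      then show False using top ch by blast
    qed
  qed
qed

end

section \<open>Plane drawings from leaf orders\<close>

lemma infdist_hyperplane:
  fixes n z :: "'a::euclidean_space"
  assumes "n \<noteq> 0"
  shows "infdist z {w. n \<bullet> w = c} = \<bar>n \<bullet> z - c\<bar> / norm n"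
proof (rule antisym)
  \<comment> \<open>\<open>w\<close> is the foot of the perpendicular from \<open>z\<close>.\<close>
  define w where "w = z - ((n \<bullet> z - c) / (n \<bullet> n)) *\<^sub>R n"
  have nn: "n \<bullet> n \<noteq> 0" using assms by simp
  have w: "w \<in> {w. n \<bullet> w = c}" unfolding w_def using nn by (simp add: inner_diff_right)
  have "dist z w = \<bar>n \<bullet> z - c\<bar> / (n \<bullet> n) * norm n" unfolding w_def dist_norm using inner_ge_zero[of n] by simp
  also have "\<dots> = \<bar>n \<bullet> z - c\<bar> / norm n"
    using assms by (simp add: dot_square_norm power2_eq_square)
  finally show "infdist z {w. n \<bullet> w = c} \<le> \<bar>n \<bullet> z - c\<bar> / norm n" using infdist_le[OF w, of z] by simp
  have "{w. n \<bullet> w = c} \<noteq> {}" using w by auto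
  moreover have "\<bar>n \<bullet> z - c\<bar> / norm n \<le> dist z v" if "v \<in> {w. n \<bullet> w = c}" for v
  proof -
    have "n \<bullet> z - c = n \<bullet> (z - v)" using that by (simp add: inner_diff_right)
    then have "\<bar>n \<bullet> z - c\<bar> \<le> norm n * norm (z - v)" using Cauchy_Schwarz_ineq2 by simp
    then show ?thesis using assms by (simp add: dist_norm divide_le_eq mult.commute)
  qed
  ultimately show "\<bar>n \<bullet> z - c\<bar> / norm n \<le> infdist z {w. n \<bullet> w = c}"
    unfolding infdist_def by (auto intro!: cINF_greatest)
qed

lemma crossing_free_drawing_compose:
  assumes "crossing_free_drawing G f" "inj A" "\<And>S. convex hull (A ` S) = A ` (convex hull S)"
  shows "crossing_free_drawing G (A \<circ> f)"
proof -
  have im: "(A \<circ> f) ` e = A ` f ` e" for e by (simp add: image_comp)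
  have "inj_on (A \<circ> f) (verts G)"
    using assms(1) inj_on_subset[OF assms(2)] unfolding crossing_free_drawing_def by (intro comp_inj_on) auto
  then show ?thesis
    using assms(1) unfolding crossing_free_drawing_def im assms(3) image_Int[OF assms(2), symmetric]
    by (simp add: inj_image_mem_iff[OF assms(2)] inj_image_eq_iff[OF assms(2)])
qed

context binary_tree begin

section \<open>Vertices as intervals of leaf positions\<close>

context
  fixes pos :: "'a \<Rightarrow> real"
  assumes pos_inj: "inj_on pos (leaves T)"
    and pos_trip: "trip a b c \<Longrightarrow> pos a < pos c \<longleftrightarrow> pos b < pos c"
begin

definition below :: "'a \<Rightarrow> 'a set" where "below v = {l \<in> leaves T. anc v l}"
definition lo :: "'a \<Rightarrow> real" where "lo v = Min (pos ` below v)"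
definition hi :: "'a \<Rightarrow> real" where "hi v = Max (pos ` below v) + (if v = r then 1 else 0)"

lemma finite_below: "finite (below v)"
  by (rule finite_subset[OF _ finite_V]) (auto simp: below_def leaves_in)

lemma below_bounds: assumes "l \<in> leaves T" "anc v l" shows "lo v \<le> pos l" "pos l \<le> hi v"
proof -
  have l: "l \<in> below v" using assms unfolding below_def by simp
  show "lo v \<le> pos l" unfolding lo_def using l finite_below by (intro Min_le) auto
  have "pos l \<le> Max (pos ` below v)" using l finite_below by (intro Max_ge) auto
  then show "pos l \<le> hi v" unfolding hi_def by auto
qed

lemma lo_attained: assumes "v \<in> V" obtains l where "l \<in> leaves T" "anc v l" "lo v = pos l"
proof -
  have "below v \<noteq> {}" using leaf_below[OF assms] unfolding below_def by blast
  then have "lo v \<in> pos ` below v" unfolding lo_def using finite_below by (intro Min_in) auto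
  then show ?thesis using that unfolding below_def by auto
qed

lemma hi_attained: assumes "v \<in> V" obtains l where "l \<in> leaves T" "anc v l" "hi v = pos l + (if v = r then 1 else 0)"
proof -
  have "below v \<noteq> {}" using leaf_below[OF assms] unfolding below_def by blast
  then have "Max (pos ` below v) \<in> pos ` below v" using finite_below by (intro Max_in) auto
  then show ?thesis using that unfolding below_def hi_def by auto
qed

text \<open>The extreme leaves of \<open>v\<close> form a triple against any leaf that is not below
  \<open>v\<close>, so \<open>pos_trip\<close> keeps such a leaf from lying between them.\<close>

lemma below_convex: assumes "v \<in> V" "l \<in> leaves T" "lo v \<le> pos l" "pos l \<le> hi v" shows "anc v l"
proof (rule ccontr)
  assume n: "\<not> anc v l"
  then have v: "v \<noteq> r" using anc_root leaves_in assms by blast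
  obtain a where a: "a \<in> leaves T" "anc v a" "lo v = pos a" using lo_attained assms(1) .
  obtain b where b: "b \<in> leaves T" "anc v b" "hi v = pos b + (if v = r then 1 else 0)" using hi_attained assms(1) .
  have "trip a b l" unfolding trip_def using a b assms n by blast
  moreover have "pos a \<noteq> pos l" "pos b \<noteq> pos l" using pos_inj a b assms n unfolding inj_on_def by metis+
  ultimately show False using pos_trip[of a b l] a b v assms by auto
qed

lemma anc_bounds: assumes "anc x y" shows "lo x \<le> lo y" "hi y \<le> hi x"
proof -
  have V: "x \<in> V" "y \<in> V" using assms anc_in by auto
  obtain l where "l \<in> leaves T" "anc y l" "lo y = pos l" using lo_attained V(2) .
  then show "lo x \<le> lo y" using below_bounds anc_trans assms by metis
  obtain l where l: "l \<in> leaves T" "anc y l" "hi y = pos l + (if y = r then 1 else 0)" using hi_attained V(2) .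
  show "hi y \<le> hi x"
  proof (cases "y = r")
    case True
    then show ?thesis using anc_antisym anc_root assms V by blast
  next
    case False
    then show ?thesis using l below_bounds anc_trans assms by simp
  qed
qed

lemma root_hi: assumes "x \<in> V" "hi r \<le> hi x" shows "x = r"
proof (rule ccontr)
  assume n: "x \<noteq> r"
  obtain l where l: "l \<in> leaves T" "anc x l" "hi x = pos l + (if x = r then 1 else 0)" using hi_attained assms(1) .
  have "pos l \<le> Max (pos ` below r)"
    using finite_below l anc_root leaves_in by (intro Max_ge) (auto simp: below_def)
  then show False using l n assms unfolding hi_def by simp
qed

text \<open>Containment of the intervals puts every leaf of \<open>y\<close> below \<open>x\<close>.
  Were \<open>x\<close> a proper descendant of \<open>y\<close>, the child of \<open>y\<close> not
  leading to \<open>x\<close> would still have a leaf, and it is not below \<open>x\<close>.\<close>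

lemma bounds_anc: assumes "x \<in> V" "y \<in> V" "lo x \<le> lo y" "hi y \<le> hi x" shows "anc x y"
proof (cases "y = r")
  case True
  then show ?thesis using root_hi anc_root assms by blast
next
  case False
  have all: "anc x l" if "l \<in> leaves T" "anc y l" for l
    using that below_convex[of x l] below_bounds[of l y] assms by auto
  obtain l where l: "l \<in> leaves T" "anc y l" using leaf_below assms(2) by blast
  show ?thesis
  proof (rule ccontr)
    assume n: "\<not> anc x y"
    then have "anc y x" "y \<noteq> x" using anc_chain all l anc_refl assms by blast+
    then obtain c where c: "par y c" "anc c x" using child_toward by blast
    obtain c' where c': "par y c'" "c' \<noteq> c" using sibling_exists c False by blast
    obtain l' where l': "l' \<in> leaves T" "anc c' l'" using leaf_below par_in c' by blast
    then have "anc y l'" using c' par_anc anc_trans by blast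
    then have "anc c l'" using all l' c anc_trans by blast
    then show False using siblings_disjoint c c' l' by blast
  qed
qed

lemma bounds_inj: assumes "x \<in> V" "y \<in> V" "lo x = lo y" "hi x = hi y" shows "x = y"
  using assms bounds_anc[of x y] bounds_anc[of y x] anc_antisym by simp

lemma leaf_bounds: assumes "l \<in> leaves T" shows "lo l = pos l" "hi l = pos l"
proof -
  have "below l = {l}" unfolding below_def using assms leaf_anc anc_refl leaves_in by blast
  moreover have "l \<noteq> r" using assms leaf_iff by blast
  ultimately show "lo l = pos l" "hi l = pos l" unfolding lo_def hi_def by auto
qed

lemma length_strict: assumes "anc x y" "x \<noteq> y" shows "hi y - lo y < hi x - lo x"
  using anc_bounds[OF assms(1)] bounds_inj[of x y] anc_in[OF assms(1)] assms(2) by linarith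

lemma inner_bounds: assumes "v \<in> V" "v \<notin> leaves T" shows "lo v < hi v"
proof -
  obtain l where l: "l \<in> leaves T" "anc v l" using leaf_below assms(1) by blast
  then have "hi l - lo l < hi v - lo v" using length_strict assms by blast
  then show ?thesis using leaf_bounds l by simp
qed

text \<open>If an extreme leaf of \<open>p\<close> is below \<open>v\<close>, the intervals share
  that end. If both extremes were below the sibling, the sibling would have the same interval as
  \<open>p\<close>, against \<open>bounds_inj\<close>.\<close>

lemma child_side: assumes "par p v" shows "lo p = lo v \<or> hi p = hi v"
proof (cases "p = r")
  case True
  have V: "p \<in> V" "v \<in> V" using assms par_in by auto
  obtain a where a: "a \<in> leaves T" "anc p a" "lo p = pos a" using lo_attained V(1) .
  have "p \<noteq> a" using a True leaf_iff by blast
  then obtain c where "par p c" "anc c a" using child_toward a by blast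
  then have "anc v a" using root_child_unique assms True by blast
  then have "lo v \<le> lo p" using below_bounds a by simp
  then show ?thesis using anc_bounds[OF par_anc(1)[OF assms]] by simp
next
  case False
  have V: "p \<in> V" "v \<in> V" using assms par_in by auto
  obtain c' where c': "par p c'" "c' \<noteq> v" using sibling_exists assms False by blast
  have split: "anc v a \<or> anc c' a" if a: "a \<in> leaves T" "anc p a" for a
  proof -
    have "p \<noteq> a" using a par_not_leaf assms by blast
    then obtain c where "par p c" "anc c a" using child_toward a by blast
    then show ?thesis using third_child[OF assms c'(1), of c] c' by blast
  qed
  obtain a where a: "a \<in> leaves T" "anc p a" "lo p = pos a" using lo_attained V(1) .
  obtain b where b: "b \<in> leaves T" "anc p b" "hi p = pos b + (if p = r then 1 else 0)" using hi_attained V(1) .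
  note ab = anc_bounds[OF par_anc(1)[OF assms]] anc_bounds[OF par_anc(1)[OF c'(1)]]
  consider "anc v a" | "anc v b" | "anc c' a" "anc c' b" using split a b by blast
  then show ?thesis
  proof cases
    case 1 then show ?thesis using below_bounds[of a v] a ab by simp
  next
    case 2 then show ?thesis using below_bounds[of b v] b ab False by simp
  next
    case 3
    then have "lo p = lo c'" "hi p = hi c'"
      using below_bounds[of a c'] below_bounds[of b c'] a b ab False by simp_all
    then show ?thesis using bounds_inj[of p c'] par_in c' par_anc by blast
  qed
qed

text \<open>
  In these coordinates the leaf-line is the diagonal and the edge from a parent to its left (right)
  child is vertical (horizontal).  The summand 1 in \<open>hi\<close> separates the root from its only child.
\<close>

definition draw :: "'a \<Rightarrow> point" where "draw v = (lo v, hi v)"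

abbreviation seg :: "'a \<Rightarrow> 'a \<Rightarrow> point set" where "seg p v \<equiv> convex hull (draw ` {p, v})"

lemma edge_box: assumes "par p v" "z \<in> seg p v"
  shows "lo p \<le> fst z" "fst z \<le> lo v" "hi v \<le> snd z" "snd z \<le> hi p"
proof -
  let ?B = "{lo p..lo v} \<times> {hi v..hi p}"
  have "seg p v \<subseteq> ?B"
  proof (rule hull_minimal)
    show "draw ` {p, v} \<subseteq> ?B" using anc_bounds[OF par_anc(1)[OF assms(1)]] by (auto simp: draw_def)
    show "convex ?B" by (intro convex_Times) auto
  qed
  then show "lo p \<le> fst z" "fst z \<le> lo v" "hi v \<le> snd z" "snd z \<le> hi p" using assms(2) by auto
qed

text \<open>If one lower end is above the other, the boxes around the edges can touch only when the
  first edge ends where the second begins. If the lower ends are incomparable, their intervals are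
  disjoint, and a common point forces the edges to leave the same parent in different
  directions.\<close>

lemma edges_meet: assumes "par p v" "par p' v'" "v \<noteq> v'"
    and z: "z \<in> seg p v" "z \<in> seg p' v'"
  shows "z \<in> draw ` ({p, v} \<inter> {p', v'})"
proof -
  have nested: "z \<in> draw ` ({p, v} \<inter> {p', v'})"
    if h: "par p v" "par p' v'" "v \<noteq> v'" "z \<in> seg p v"
      "z \<in> seg p' v'" "anc v v'" for p v p' v'
  proof -
    have "anc v p'" using anc_par h by blast
    note b = anc_bounds[OF this] edge_box[OF h(1,4)] edge_box[OF h(2,5)]
    then have "lo v = lo p'" "hi v = hi p'" by auto
    then have "v = p'" using bounds_inj par_in h by blast
    moreover have "z = draw v" using b unfolding draw_def by (auto simp: prod_eq_iff)
    ultimately show ?thesis by auto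
  qed
  have apart: "z \<in> draw ` ({p, v} \<inter> {p', v'})"
    if h: "par p v" "par p' v'" "v \<noteq> v'" "z \<in> seg p v"
      "z \<in> seg p' v'" "\<not> anc v v'" "\<not> anc v' v" "lo v \<le> lo v'" for p v p' v'
  proof -
    note b = edge_box[OF h(1,4)] edge_box[OF h(2,5)]
    have V: "v \<in> V" "v' \<in> V" "p \<in> V" "p' \<in> V" using par_in h by blast+
    have disj: "\<not> (anc v x \<and> anc v' x)" for x using anc_chain h by blast
    obtain x' where x': "x' \<in> leaves T" "anc v' x'" "lo v' = pos x'" using lo_attained V(2) .
    have lt: "hi v < lo v'"
    proof (rule ccontr)
      assume "\<not> hi v < lo v'"
      then have "anc v x'" using below_convex V x' h by simp
      then show False using disj x' by blast
    qed
    obtain x where x: "x \<in> leaves T" "anc v x" "lo v = pos x" using lo_attained V(1) .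
    obtain y where y: "y \<in> leaves T" "anc v' y" "hi v' = pos y + (if v' = r then 1 else 0)" using hi_attained V(2) .
    have v': "v' \<noteq> r" using par_not_root h by blast
    have le: "lo v \<le> hi v" "lo v' \<le> hi v'" using below_bounds[of x v] below_bounds[of x' v'] x x' by auto
    have "hi p \<noteq> hi v" using b lt le by auto
    then have 1: "lo p = lo v" using child_side h by blast
    have "lo p' \<noteq> lo v'" using b lt le by auto
    then have 2: "hi p' = hi v'" using child_side h by blast
    have "anc p' x" using below_convex[OF V(4) x(1)] x b 1 2 lt le by auto
    moreover have "anc p y" using below_convex[OF V(3) y(1)] y v' b 1 2 lt le by auto
    ultimately have "anc p' v" "anc p v'"
      using anc_chain[of p' x v] anc_chain[of p y v'] x y h par_anc anc_trans by blast+
    then have "anc p' p" "anc p p'" using anc_par h par_anc anc_refl V by metis+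
    then have pp: "p = p'" using anc_antisym by blast
    have "z = draw p" unfolding draw_def using b 1 2 pp by (auto simp: prod_eq_iff)
    then show ?thesis using pp by auto
  qed
  consider "anc v v'" | "anc v' v" | "\<not> anc v v'" "\<not> anc v' v" "lo v \<le> lo v'"
    | "\<not> anc v v'" "\<not> anc v' v" "lo v' \<le> lo v" by linarith
  then show ?thesis
  proof cases
    case 1 then show ?thesis using nested assms by blast
  next
    case 2 then show ?thesis using nested[of p' v' p v] assms by blast
  next
    case 3 then show ?thesis using apart[of p v p' v'] assms by blast
  next
    case 4 then show ?thesis using apart[of p' v' p v] assms by blast
  qed
qed

lemma draw_crossing_free: "crossing_free_drawing T draw"
  unfolding crossing_free_drawing_def
proof (intro conjI ballI impI)
  show "inj_on draw V" unfolding inj_on_def draw_def using bounds_inj by auto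
next
  fix x e assume x: "x \<in> V" "e \<in> edges T" "draw x \<in> convex hull (draw ` e)"
  obtain p v where e: "e = {p, v}" "par p v" using x(2) edges_eq by auto
  note b = edge_box[OF e(2) x(3)[unfolded e(1)]]
  then have "anc p x" "anc x v" using bounds_anc[of p x] bounds_anc[of x v] par_in e x by (auto simp: draw_def)
  then show "x \<in> e" using anc_par[OF _ _ e(2)] anc_antisym e by blast
next
  fix e e' assume h: "e \<in> edges T" "e' \<in> edges T" "e \<noteq> e'"
  obtain p v where e: "e = {p, v}" "par p v" using h(1) edges_eq by auto
  obtain p' v' where e': "e' = {p', v'}" "par p' v'" using h(2) edges_eq by auto
  have "v \<noteq> v'" using h(3) e e' par_unique by blast
  show "convex hull (draw ` e) \<inter> convex hull (draw ` e') = draw ` (e \<inter> e')"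
  proof
    show "convex hull (draw ` e) \<inter> convex hull (draw ` e') \<subseteq> draw ` (e \<inter> e')"
      using edges_meet[OF e(2) e'(2) \<open>v \<noteq> v'\<close>] unfolding e e' by blast
    show "draw ` (e \<inter> e') \<subseteq> convex hull (draw ` e) \<inter> convex hull (draw ` e')"
      using hull_subset[of "draw ` e" convex] hull_subset[of "draw ` e'" convex] by auto
  qed
qed

lemma inner_line: "((1, -1)::point) \<bullet> z = fst z - snd z" "((-1, 1)::point) \<bullet> z = snd z - fst z"
  by (cases z; simp)+

lemma draw_left: "plane_drawing T draw (1, -1) 0"
  unfolding plane_drawing_def
proof (intro conjI ballI impI)
  show "crossing_free_drawing T draw" by (rule draw_crossing_free)
  show "(1, -1) \<bullet> draw v = 0" if "v \<in> leaves T" for v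
    using leaf_bounds[OF that] unfolding inner_line by (simp add: draw_def)
  show "(1, -1) \<bullet> draw v < 0" if "v \<in> V - leaves T" for v
    using inner_bounds[of v] that unfolding inner_line by (simp add: draw_def)
  have ge: "lo v \<le> hi v" if "v \<in> V" for v
    using inner_bounds[OF that] leaf_bounds[of v] by (cases "v \<in> leaves T") auto
  fix x y assume "x \<in> V" "y \<in> V" "anc x y \<and> x \<noteq> y"
  then show "infdist (draw y) {z. (1, -1) \<bullet> z = 0} < infdist (draw x) {z. (1, -1) \<bullet> z = 0}"
    using length_strict[of x y] ge
    by (subst (1 2) infdist_hyperplane) (auto simp: zero_prod_def inner_line draw_def intro!: divide_strict_right_mono)
qed

text \<open>Exchanging the coordinates reflects the drawing in the diagonal and so turns the tree to
  the other side without changing the leaf order. The shift by 1 moves the leaf-line to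
  \<open>fst z - snd z = 1\<close>.\<close>

lemma draw_right: "plane_drawing T ((\<lambda>z. (snd z + 1, fst z)) \<circ> draw) (- (1, -1)) (- 1)"
  unfolding plane_drawing_def
proof (intro conjI ballI impI)
  let ?A = "\<lambda>z::point. (snd z + 1, fst z)"
  have n: "- (1, -1) = ((-1, 1)::point)" by simp
  show "crossing_free_drawing T (?A \<circ> draw)"
  proof (rule crossing_free_drawing_compose[OF draw_crossing_free])
    show "inj ?A" by (auto simp: inj_def prod_eq_iff)
    fix S :: "point set"
    have lin: "linear (\<lambda>z::point. (snd z, fst z))" by (rule linearI) auto
    have "?A ` S = (\<lambda>z. (1, 0) + z) ` (\<lambda>z. (snd z, fst z)) ` S" for S :: "point set"
      by (force simp: image_image)
    then show "convex hull (?A ` S) = ?A ` (convex hull S)"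
      by (simp only: convex_hull_translation convex_hull_linear_image[OF lin])
  qed
  show "- (1, -1) \<bullet> (?A \<circ> draw) v = - 1" if "v \<in> leaves T" for v
    using leaf_bounds[OF that] unfolding n inner_line by (simp add: draw_def)
  show "- (1, -1) \<bullet> (?A \<circ> draw) v < - 1" if "v \<in> V - leaves T" for v
    using inner_bounds[of v] that unfolding n inner_line by (simp add: draw_def)
  have ge: "lo v \<le> hi v" if "v \<in> V" for v
    using inner_bounds[OF that] leaf_bounds[of v] by (cases "v \<in> leaves T") auto
  fix x y assume "x \<in> V" "y \<in> V" "anc x y \<and> x \<noteq> y"
  then show "infdist ((?A \<circ> draw) y) {z. - (1, -1) \<bullet> z = - 1} < infdist ((?A \<circ> draw) x) {z. - (1, -1) \<bullet> z = - 1}"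
    using length_strict[of x y] ge unfolding n
    by (subst (1 2) infdist_hyperplane) (auto simp: zero_prod_def inner_line draw_def intro!: divide_strict_right_mono)
qed

end

end

section \<open>Leaf orders from plane drawings\<close>

lemma crossing_free_cells:
  assumes cf: "crossing_free_drawing G f"
    and e: "e \<in> edges G \<or> (\<exists>w\<in>verts G. e = {w})" and e': "e' \<in> edges G \<or> (\<exists>w\<in>verts G. e' = {w})"
    and z: "z \<in> convex hull (f ` e)" "z \<in> convex hull (f ` e')"
  shows "e \<inter> e' \<noteq> {}"
proof -
  have inj: "inj_on f (verts G)"
    and ve: "\<And>v e. v \<in> verts G \<Longrightarrow> e \<in> edges G \<Longrightarrow> f v \<in> convex hull (f ` e) \<Longrightarrow> v \<in> e"
    and ee: "\<And>e e'. e \<in> edges G \<Longrightarrow> e' \<in> edges G \<Longrightarrow> e \<noteq> e' \<Longrightarrow>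
      convex hull (f ` e) \<inter> convex hull (f ` e') = f ` (e \<inter> e')"
    using cf unfolding crossing_free_drawing_def by blast+
  consider "e \<in> edges G" "e' \<in> edges G" "e = e'" | "e \<in> edges G" "e' \<in> edges G" "e \<noteq> e'"
    | w where "w \<in> verts G" "e = {w}" "e' \<in> edges G" | w where "e \<in> edges G" "w \<in> verts G" "e' = {w}"
    | w w' where "w \<in> verts G" "e = {w}" "w' \<in> verts G" "e' = {w'}"
    using e e' by blast
  then show ?thesis
  proof cases
    case 1
    then show ?thesis using z by auto
  next
    case 2
    then show ?thesis using ee[OF 2] z by blast
  next
    case (3 w)
    then have "w \<in> e'" using ve[of w e'] z by simp
    then show ?thesis using 3 by simp
  next
    case (4 w)
    then have "w \<in> e" using ve[of w e] z by simp
    then show ?thesis using 4 by simp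
  next
    case (5 w w')
    then have "f w = f w'" using z by simp
    then show ?thesis using inj 5 unfolding inj_on_def by simp
  qed
qed

text \<open>\<open>m\<close> is \<open>n\<close> turned by a right angle, so the two inner products
  are coordinates across and along the leaf-lines.\<close>

lemma point_zero_if:
  fixes n m z :: point
  assumes "n \<noteq> 0" "m = (- snd n, fst n)" "n \<bullet> z = 0" "m \<bullet> z = 0"
  shows "z = 0"
proof -
  obtain p q where n: "n = (p, q)" by (cases n)
  obtain x y where z: "z = (x, y)" by (cases z)
  have e: "p * x + q * y = 0" "p * y - q * x = 0" using assms unfolding n z by (auto simp: inner_prod_def)
  have "(p * p + q * q) * x = p * (p * x + q * y) - q * (p * y - q * x)"
    "(p * p + q * q) * y = q * (p * x + q * y) + p * (p * y - q * x)" by algebra+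
  then have "(p * p + q * q) * x = 0" "(p * p + q * q) * y = 0" unfolding e by auto
  moreover have "p * p + q * q \<noteq> 0" using assms(1) unfolding n by (auto simp: zero_prod_def sum_squares_eq_zero_iff)
  ultimately show ?thesis unfolding z zero_prod_def by (simp only: mult_eq_0_iff prod.inject) blast
qed

lemma segments_cross:
  fixes n m :: point
  assumes n: "n \<noteq> 0" "m = (- snd n, fst n)"
    and nl: "n \<bullet> l = c" "n \<bullet> l' = c" "n \<bullet> r = d" "n \<bullet> r' = d"
    and order: "m \<bullet> l < m \<bullet> l'" "m \<bullet> r' \<le> m \<bullet> r"
  shows "convex hull {l, r} \<inter> convex hull {l', r'} \<noteq> {}"
proof -
  define \<alpha> where "\<alpha> = m \<bullet> l' - m \<bullet> l"
  define \<beta> where "\<beta> = m \<bullet> r - m \<bullet> r'"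
  \<comment> \<open>In the direction \<open>m\<close>, the second segment is ahead of the first by
    \<alpha> at parameter 0 and behind it by \<beta> at parameter 1; \<open>s\<close> is the zero of
    the affine difference.\<close>
  define s where "s = \<alpha> / (\<alpha> + \<beta>)"
  have ab: "\<alpha> > 0" "\<beta> \<ge> 0" using order unfolding \<alpha>_def \<beta>_def by auto
  then have s: "0 \<le> s" "s \<le> 1" "s * (\<alpha> + \<beta>) = \<alpha>" unfolding s_def by (auto simp: divide_simps)
  let ?z = "(1 - s) *\<^sub>R l + s *\<^sub>R r" and ?z' = "(1 - s) *\<^sub>R l' + s *\<^sub>R r'"
  have "n \<bullet> (?z - ?z') = 0" using nl by (simp add: inner_diff_right inner_add_right)
  moreover have "m \<bullet> (?z - ?z') = s * (\<alpha> + \<beta>) - \<alpha>"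
    unfolding \<alpha>_def \<beta>_def by (simp add: inner_diff_right inner_add_right algebra_simps)
  then have "m \<bullet> (?z - ?z') = 0" using s by simp
  ultimately have "?z - ?z' = 0" using point_zero_if[OF n] by blast
  then have "?z = ?z'" by simp
  moreover have "?z \<in> convex hull {l, r}" "?z' \<in> convex hull {l', r'}"
    unfolding convex_hull_2 mem_Collect_eq using s
    by (intro exI[of _ "1 - s"] exI[of _ s]; simp)+
  ultimately show ?thesis by (metis IntI empty_iff)
qed

context binary_tree begin

lemma plane_drawing_no_interleaving:
  fixes n m :: point
  assumes pd: "plane_drawing T f n c" and n: "n \<noteq> 0" "m = (- snd n, fst n)" and t: "trip a b d"
  shows "\<not> (m \<bullet> f a < m \<bullet> f d \<and> m \<bullet> f d < m \<bullet> f b)"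
proof
  assume btw: "m \<bullet> f a < m \<bullet> f d \<and> m \<bullet> f d < m \<bullet> f b"
  define h where "h z = c - n \<bullet> z" for z :: point
  have cf: "crossing_free_drawing T f" using pd unfolding plane_drawing_def by blast
  have leaf0: "h (f l) = 0" if "l \<in> leaves T" for l using pd that unfolding plane_drawing_def h_def by simp
  have pos: "h (f v) \<ge> 0" if "v \<in> V" for v
  proof (cases "v \<in> leaves T")
    case False
    then have "n \<bullet> f v < c" using pd that unfolding plane_drawing_def by blast
    then show ?thesis unfolding h_def by simp
  qed (use leaf0 in auto)
  have up: "h (f y) < h (f x)" if "anc x y" "x \<noteq> y" for x y
  proof -
    have V: "x \<in> V" "y \<in> V" using anc_in that by auto
    then have "infdist (f y) {z. n \<bullet> z = c} < infdist (f x) {z. n \<bullet> z = c}"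
      using pd that unfolding plane_drawing_def by blast
    then have "\<bar>n \<bullet> f y - c\<bar> < \<bar>n \<bullet> f x - c\<bar>" unfolding infdist_hyperplane[OF n(1)]
      using n(1) by (simp add: divide_less_cancel)
    then show ?thesis using pos[OF V(1)] pos[OF V(2)] unfolding h_def by linarith
  qed
  \<comment> \<open>Each height on a curve will be tagged with a vertex or edge on the path from
    \<open>v\<close> down to \<open>l\<close>, so that a meeting of two curves can be turned back
    into a common vertex of the tree.\<close>
  define cell where "cell v l e \<longleftrightarrow> (e \<in> edges T \<or> (\<exists>w\<in>V. e = {w})) \<and> e \<subseteq> {w. anc v w \<and> anc w l}" for v l e
  let ?on = "\<lambda>v l t x. \<exists>z e. cell v l e \<and> z \<in> convex hull (f ` e) \<and> h z = t \<and> m \<bullet> z = x"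
  have curve: "\<exists>X. continuous_on {0..h (f v)} X \<and> X 0 = m \<bullet> f l \<and> X (h (f v)) = m \<bullet> f v \<and>
      (\<forall>t\<in>{0..h (f v)}. ?on v l t (X t))"
    if l: "l \<in> leaves T" and vl: "anc v l" for v l
    using vl
  proof (induction "length (rp l) - length (rp v)" arbitrary: v rule: less_induct)
    case less
    show ?case
    proof (cases "v = l")
      case True
      have "cell l l {l}" unfolding cell_def using leaves_in[OF l] anc_refl by auto
      then have "\<exists>z e. cell l l e \<and> z \<in> convex hull (f ` e) \<and> h z = 0 \<and> m \<bullet> z = m \<bullet> f l"
        using leaf0[OF l] by (intro exI[of _ "f l"] exI[of _ "{l}"]) simp
      then show ?thesis unfolding True leaf0[OF l]
        by (intro exI[of _ "\<lambda>_. m \<bullet> f l"] conjI ballI) (simp_all only: atLeastAtMost_singleton singleton_iff, simp)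
    next
      case False
      obtain w where w: "par v w" "anc w l" using child_toward less.prems False by blast
      have "length (rp w) = Suc (length (rp v))" using w unfolding par_def by simp
      moreover have "length (rp w) \<le> length (rp l)" using w(2) unfolding anc_prefix by (auto dest: prefix_length_le)
      ultimately have "length (rp l) - length (rp w) < length (rp l) - length (rp v)" by linarith
      then obtain X where X: "continuous_on {0..h (f w)} X" "X 0 = m \<bullet> f l" "X (h (f w)) = m \<bullet> f w"
        "\<forall>t\<in>{0..h (f w)}. ?on w l t (X t)"
        using less.hyps[of w] w(2) by blast
      let ?a = "h (f w)" and ?b = "h (f v)"
      have lt: "?a < ?b" using up[OF par_anc[OF w(1)]] .
      have a0: "0 \<le> ?a" using pos w par_in by blast
      define Y where "Y t = (if t \<le> ?a then X t else m \<bullet> f w + (t - ?a) / (?b - ?a) * (m \<bullet> f v - m \<bullet> f w))" for t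
      have "continuous_on {0..?b} Y" unfolding Y_def
      proof (rule continuous_on_cases_le[where h = "\<lambda>t. t"])
        show "continuous_on {t \<in> {0..?b}. t \<le> ?a} X" by (rule continuous_on_subset[OF X(1)]) auto
        show "continuous_on {t \<in> {0..?b}. ?a \<le> t} (\<lambda>t. m \<bullet> f w + (t - ?a) / (?b - ?a) * (m \<bullet> f v - m \<bullet> f w))"
          by (intro continuous_intros) (use lt in auto)
      qed (use X(3) in auto)
      moreover have "Y 0 = m \<bullet> f l" using X(2) a0 unfolding Y_def by simp
      moreover have "Y ?b = m \<bullet> f v" using lt unfolding Y_def by simp
      moreover have "?on v l t (Y t)" if t: "t \<in> {0..?b}" for t
      proof (cases "t \<le> ?a")
        case True
        then have "t \<in> {0..?a}" using t by simp
        then obtain z e where "cell w l e" "z \<in> convex hull (f ` e)" "h z = t" "m \<bullet> z = X t" using X(4) by blast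
        moreover have "cell v l e" using \<open>cell w l e\<close> anc_trans par_anc(1)[OF w(1)] unfolding cell_def by blast
        moreover have "Y t = X t" unfolding Y_def using True by simp
        ultimately show ?thesis by metis
      next
        case False
        define s where "s = (t - ?a) / (?b - ?a)"
        have s: "0 \<le> s" "s \<le> 1" "s * (?b - ?a) = t - ?a" unfolding s_def using lt False t by (auto simp: divide_simps)
        let ?z = "(1 - s) *\<^sub>R f w + s *\<^sub>R f v"
        have "cell v l {w, v}" unfolding cell_def
          using par_edge[OF w(1)] w less.prems par_anc(1)[OF w(1)] par_in[OF w(1)] anc_refl
          by (simp add: insert_commute)
        moreover have "?z \<in> convex hull (f ` {w, v})"
          unfolding image_insert image_empty convex_hull_2 mem_Collect_eq using s
          by (intro exI[of _ "1 - s"] exI[of _ s]) simp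
        moreover have "h ?z = ?a + s * (?b - ?a)" unfolding h_def by (simp add: inner_add_right algebra_simps)
        then have "h ?z = t" using s by simp
        moreover have "m \<bullet> ?z = Y t" unfolding Y_def s_def[symmetric] using False
          by (simp add: inner_add_right algebra_simps)
        ultimately show ?thesis by blast
      qed
      ultimately show ?thesis by blast
    qed
  qed
  have lv: "a \<in> leaves T" "b \<in> leaves T" "d \<in> leaves T" using t unfolding trip_def by auto
  obtain v where v: "anc v a" "anc v b" "\<not> anc v d" using t unfolding trip_def by blast
  obtain A where A: "continuous_on {0..h (f v)} A" "A 0 = m \<bullet> f a" "A (h (f v)) = m \<bullet> f v"
    "\<forall>t\<in>{0..h (f v)}. ?on v a t (A t)"
    using curve[OF lv(1) v(1)] by blast
  obtain B where B: "continuous_on {0..h (f v)} B" "B 0 = m \<bullet> f b" "B (h (f v)) = m \<bullet> f v"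
    "\<forall>t\<in>{0..h (f v)}. ?on v b t (B t)"
    using curve[OF lv(2) v(2)] by blast
  obtain D where D: "continuous_on {0..h (f r)} D" "D 0 = m \<bullet> f d"
    "\<forall>t\<in>{0..h (f r)}. ?on r d t (D t)"
    using curve[OF lv(3) anc_root] leaves_in lv by blast
  let ?H = "h (f v)"
  have vV: "v \<in> V" using v anc_in by blast
  have H: "0 \<le> ?H" "?H \<le> h (f r)"
    using pos[OF vV] up[OF anc_root[OF vV]] by (auto simp: less_eq_real_def)
  \<comment> \<open>At leaf level \<open>d\<close> lies between \<open>a\<close> and
    \<open>b\<close>, so the product is nonnegative. At the height of \<open>v\<close> the curves
    \<open>A\<close> and \<open>B\<close> coincide, so it is minus a square. At a zero, the path of
    \<open>d\<close> meets one of the other two.\<close>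
  let ?\<phi> = "\<lambda>t. (D t - A t) * (B t - D t)"
  have D': "continuous_on {0..?H} D" by (rule continuous_on_subset[OF D(1)]) (use H in auto)
  have "\<exists>t\<ge>0. t \<le> ?H \<and> ?\<phi> t = 0"
  proof (rule IVT2')
    show "0 \<le> ?\<phi> 0" using btw A B D by simp
    have "?\<phi> ?H = - (D ?H - m \<bullet> f v)\<^sup>2" unfolding A(3) B(3) by (simp add: power2_eq_square algebra_simps)
    then show "?\<phi> ?H \<le> 0" by simp
    show "continuous_on {0..?H} ?\<phi>" using A(1) B(1) D' by (intro continuous_intros)
  qed (use H in auto)
  then obtain t where t: "0 \<le> t" "t \<le> ?H" "D t = A t \<or> D t = B t" by auto
  then have "t \<in> {0..?H}" "t \<in> {0..h (f r)}" using H by auto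
  then obtain l z e where z: "cell v l e" "z \<in> convex hull (f ` e)" "h z = t" "m \<bullet> z = D t"
    using A(4) B(4) t(3) by metis
  obtain z' e' where z': "cell r d e'" "z' \<in> convex hull (f ` e')" "h z' = t" "m \<bullet> z' = D t"
    using D(3) \<open>t \<in> {0..h (f r)}\<close> by blast
  have "n \<bullet> (z - z') = 0" using z z' unfolding h_def by (simp add: inner_diff_right)
  moreover have "m \<bullet> (z - z') = 0" using z z' by (simp add: inner_diff_right)
  ultimately have "z - z' = 0" by (rule point_zero_if[OF n])
  then have "z = z'" by simp
  \<comment> \<open>A common vertex of the two cells is below \<open>v\<close> and above
    \<open>d\<close>, which would make \<open>v\<close> an ancestor of \<open>d\<close>.\<close>
  then have "e \<inter> e' \<noteq> {}" using crossing_free_cells[OF cf, of e e' z] z z' unfolding cell_def by blast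
  then show False using z z' v anc_trans unfolding cell_def by blast
qed

end

section \<open>Induced binary subtrees\<close>

lemma path_edges_iff: "e \<in> path_edges p \<longleftrightarrow> (\<exists>xs u c ys. p = xs @ [u, c] @ ys \<and> e = {u, c})"
proof
  assume "e \<in> path_edges p"
  then obtain i where i: "e = {p ! i, p ! Suc i}" "Suc i < length p" unfolding path_edges_def by blast
  then have "p = take i p @ [p ! i, p ! Suc i] @ drop (Suc (Suc i)) p"
    by (metis Cons_nth_drop_Suc Suc_lessD append_Cons append_Nil append_take_drop_id)
  then show "\<exists>xs u c ys. p = xs @ [u, c] @ ys \<and> e = {u, c}" using i by blast
next
  assume "\<exists>xs u c ys. p = xs @ [u, c] @ ys \<and> e = {u, c}"
  then obtain xs u c ys where "p = xs @ [u, c] @ ys" "e = {u, c}" by blast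
  then show "e \<in> path_edges p"
    unfolding path_edges_def by (intro CollectI exI[of _ "length xs"]) (simp add: nth_append)
qed

context binary_tree begin

lemma path_edges_rp: assumes "s \<in> V" shows "path_edges (rp s) = {{u, c} | u c. par u c \<and> anc c s}"
proof (intro set_eqI iffI)
  fix e assume "e \<in> path_edges (rp s)"
  then obtain xs u c ys where e: "rp s = xs @ [u, c] @ ys" "e = {u, c}" using path_edges_iff by metis
  have u: "rp u = xs @ [u]" "u \<in> V" using rp_split[OF assms, of xs u "c # ys"] e by auto
  have c: "rp c = xs @ [u] @ [c]" "c \<in> V" using rp_split[OF assms, of "xs @ [u]" c ys] e by auto
  have "anc c s" unfolding anc_prefix using c assms e by simp
  moreover have "par u c" unfolding par_def using u c by simp
  ultimately show "e \<in> {{u, c} | u c. par u c \<and> anc c s}" using e(2) by blast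
next
  fix e assume "e \<in> {{u, c} | u c. par u c \<and> anc c s}"
  then obtain u c where e: "e = {u, c}" "par u c" "anc c s" by blast
  obtain zs where zs: "rp s = rp c @ zs" using e(3) unfolding anc_prefix prefix_def by blast
  have "rp u = butlast (rp u) @ [u]" using rp_props[of u] e(2) unfolding par_def by (metis append_butlast_last_id)
  then have "rp s = butlast (rp u) @ [u, c] @ zs" using zs e(2) unfolding par_def by (metis append.assoc append_Cons append_Nil)
  then show "e \<in> path_edges (rp s)" unfolding path_edges_iff using e(1) by blast
qed

lemma meet_commute: "a \<in> V \<Longrightarrow> b \<in> V \<Longrightarrow> meet a b = meet b a"
  by (rule anc_antisym) (simp_all add: anc_meet meet_anc)

lemma meet_not_leaf: assumes "a \<in> leaves T" "b \<in> leaves T" "a \<noteq> b" shows "meet a b \<notin> leaves T"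
proof
  assume "meet a b \<in> leaves T"
  then have "a = meet a b" "b = meet a b" using meet_anc leaf_anc leaves_in assms by metis+
  then show False using assms by simp
qed

lemma meet_children: assumes "a \<in> leaves T" "b \<in> leaves T" "a \<noteq> b"
  obtains c c' where "par (meet a b) c" "anc c a" "par (meet a b) c'" "anc c' b" "c \<noteq> c'"
proof -
  have V: "a \<in> V" "b \<in> V" using leaves_in assms by auto
  have ne: "meet a b \<noteq> a" "meet a b \<noteq> b" using meet_not_leaf assms by metis+
  obtain c where c: "par (meet a b) c" "anc c a" using child_toward[OF meet_anc(1)[OF V] ne(1)] .
  obtain c' where c': "par (meet a b) c'" "anc c' b" using child_toward[OF meet_anc(2)[OF V] ne(2)] .
  have "c \<noteq> c'"
  proof
    assume "c = c'"
    then have "anc c (meet a b)" using anc_meet V c c' by blast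
    then show False using par_anc[OF c(1)] anc_antisym by blast
  qed
  then show ?thesis using that c c' by blast
qed

lemma meet_not_root: assumes "a \<in> leaves T" "b \<in> leaves T" "a \<noteq> b" shows "meet a b \<noteq> r"
  using meet_children[OF assms] root_child_unique by metis

lemma meet_eqI: assumes "par v c" "par v c'" "c \<noteq> c'" "anc c a" "anc c' b" shows "meet a b = v"
proof -
  have V: "a \<in> V" "b \<in> V" using assms anc_in by auto
  have v: "anc v (meet a b)" using anc_meet V assms par_anc anc_trans by blast
  show ?thesis
  proof (rule ccontr)
    assume "meet a b \<noteq> v"
    then obtain d where "par v d" "anc d (meet a b)" using child_toward[OF v] by metis
    then have "d = c" "d = c'" using siblings_disjoint assms anc_meet V by blast+
    then show False using assms by simp
  qed
qed

lemma trip_meet_eq: assumes "trip a b c" shows "meet a c = meet b c"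
proof -
  have V: "a \<in> V" "b \<in> V" "c \<in> V" using assms leaves_in unfolding trip_def by auto
  have *: "anc x b" if "trip a b c" "anc x a" "anc x c" for a b x
  proof -
    obtain v where "anc v a" "anc v b" "\<not> anc v c" using \<open>trip a b c\<close> unfolding trip_def by blast
    then have "anc x v" using that anc_chain anc_trans by blast
    then show ?thesis using \<open>anc v b\<close> anc_trans by blast
  qed
  have "trip b a c" using assms unfolding trip_def by blast
  then have "anc x a \<and> anc x c \<longleftrightarrow> anc x b \<and> anc x c" for x using *[of a b] *[of b a] assms by blast
  then have "anc x (meet a c) \<longleftrightarrow> anc x (meet b c)" for x unfolding anc_meet[OF V(1,3)] anc_meet[OF V(2,3)] .
  then show ?thesis using anc_antisym anc_refl[OF rp_meet(1)] V by blast
qed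

section \<open>Suppressing vertices of degree 2 in a union of root paths\<close>

context
  fixes S
  assumes S: "S \<subseteq> leaves T" "S \<noteq> {}"
begin

abbreviation "G \<equiv> root_path_union T S"

definition span :: "'a set" where "span = {w. \<exists>s\<in>S. anc w s}"

lemma span_in: "w \<in> span \<Longrightarrow> w \<in> V" unfolding span_def using anc_in by blast

lemma verts_root_path_union: "verts G = span"
proof -
  have "gpath T r p s \<longleftrightarrow> s \<in> V \<and> p = rp s" for p s using rp_eq rp_gpath gpath_last_in by blast
  then show ?thesis unfolding root_path_union_def span_def anc_iff using S leaves_in by auto
qed

lemma edges_root_path_union: "edges G = {{u, c} | u c. par u c \<and> c \<in> span}"
proof -
  have g: "gpath T r p s \<longleftrightarrow> s \<in> V \<and> p = rp s" for p s using rp_eq rp_gpath gpath_last_in by blast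
  have "edges G = \<Union> {path_edges (rp s) | s. s \<in> S}"
  proof -
    have "{path_edges p | p s. s \<in> S \<and> gpath T r p s} = {path_edges (rp s) | s. s \<in> S}"
      unfolding g using S leaves_in by blast
    then show ?thesis unfolding root_path_union_def by simp
  qed
  also have "\<dots> = {{u, c} | u c. par u c \<and> c \<in> span}"
  proof -
    have SV: "S \<subseteq> V" using S leaves_in by blast
    have "\<Union> {path_edges (rp s) | s. s \<in> S} = (\<Union>s\<in>S. path_edges (rp s))" by blast
    also have "\<dots> = (\<Union>s\<in>S. {{u, c} | u c. par u c \<and> anc c s})"
      using SV by (intro SUP_cong refl path_edges_rp) blast
    also have "\<dots> = {{u, c} | u c. par u c \<and> c \<in> span}"
    proof (intro equalityI subsetI)
      fix e assume "e \<in> (\<Union>s\<in>S. {{u, c} | u c. par u c \<and> anc c s})"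
      then obtain s u c where "s \<in> S" "e = {u, c}" "par u c" "anc c s" unfolding UN_iff mem_Collect_eq by metis
      then show "e \<in> {{u, c} | u c. par u c \<and> c \<in> span}" unfolding span_def by auto
    next
      fix e assume "e \<in> {{u, c} | u c. par u c \<and> c \<in> span}"
      then obtain s u c where "s \<in> S" "e = {u, c}" "par u c" "anc c s" unfolding span_def by auto
      then show "e \<in> (\<Union>s\<in>S. {{u, c} | u c. par u c \<and> anc c s})" unfolding UN_iff mem_Collect_eq by metis
    qed
    finally show ?thesis .
  qed
  finally show ?thesis .
qed

lemma degree_span: assumes "v \<in> span"
  shows "gdegree G v = (if v = r then 0 else 1) + card {c \<in> span. par v c}"
proof -
  have "edges G = {{u, c} | u c. par u c \<and> c \<in> span - {r}}"
    unfolding edges_root_path_union using par_not_root by blast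
  moreover have "span - {r} \<subseteq> V - {r}" using span_in by blast
  ultimately have "gdegree G v = (if v \<in> span - {r} then 1 else 0) + card {c \<in> span - {r}. par v c}"
    using degree_of_child_set[of "span - {r}" G v] span_in[OF assms] by simp
  also have "{c \<in> span - {r}. par v c} = {c \<in> span. par v c}" using par_not_root by blast
  finally show ?thesis using assms by simp
qed

text \<open>Describing the surviving branching vertices by \<open>meet\<close> allows the shape of
  an induced subtree to be computed from triples alone.\<close>

definition kept :: "'a set" where
  "kept = insert r (S \<union> {meet s t | s t. s \<in> S \<and> t \<in> S \<and> s \<noteq> t})"

lemma kept_span: "kept \<subseteq> span"
proof -
  obtain s where s: "s \<in> S" using S by blast
  have "r \<in> span" unfolding span_def using anc_root leaves_in S s by blast
  moreover have "S \<subseteq> span" unfolding span_def using anc_refl leaves_in S by blast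
  moreover have "meet s t \<in> span" if "s \<in> S" "t \<in> S" for s t
    using that meet_anc(1) leaves_in S unfolding span_def by blast
  ultimately show ?thesis unfolding kept_def by blast
qed

text \<open>Two children in \<open>span\<close> carry leaves of \<open>S\<close> whose
  \<open>meet\<close> is the vertex. With just one such child, a vertex other than the root has
  degree 2; with none, it is a leaf belonging to \<open>S\<close>.\<close>

lemma kept_iff: assumes "v \<in> span" shows "v \<in> kept \<longleftrightarrow> gdegree G v \<noteq> 2"
proof
  have fin: "finite {c \<in> span. par v c}" by (rule finite_subset[OF _ finite_children[of v]]) auto
  assume "v \<in> kept"
  then consider "v = r" | "v \<in> S" | s t where "s \<in> S" "t \<in> S" "s \<noteq> t" "v = meet s t" "v \<noteq> r"
    unfolding kept_def by blast
  then show "gdegree G v \<noteq> 2"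
  proof cases
    case 1
    have "card {c \<in> span. par v c} \<le> card {c. par v c}" by (intro card_mono finite_children) auto
    moreover have "card {c. par v c} = 1" using card_children[OF root_in] leaf_iff[of r] 1 by simp
    ultimately show ?thesis using degree_span[OF assms] 1 by simp
  next
    case 2
    then have none: "{c \<in> span. par v c} = {}" using S leaf_iff by blast
    show ?thesis unfolding degree_span[OF assms] none by simp
  next
    case (3 s t)
    obtain c c' where c: "par v c" "anc c s" "par v c'" "anc c' t" "c \<noteq> c'"
      using meet_children[of s t] 3 S by blast
    have "card {c, c'} \<le> card {c \<in> span. par v c}"
      using c 3 by (intro card_mono fin) (auto simp: span_def)
    then show ?thesis using degree_span[OF assms] 3 c by simp
  qed
next
  assume d: "gdegree G v \<noteq> 2"
  show "v \<in> kept"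
  proof (rule ccontr)
    assume n: "v \<notin> kept"
    then have "v \<noteq> r" "v \<notin> S" unfolding kept_def by auto
    obtain s where s: "s \<in> S" "anc v s" using assms unfolding span_def by blast
    have "v \<noteq> s" using s \<open>v \<notin> S\<close> by blast
    then obtain c where c: "par v c" "anc c s" using child_toward[OF s(2)] by blast
    have "c' = c" if c': "par v c'" "c' \<in> span" for c'
    proof (rule ccontr)
      assume ne: "c' \<noteq> c"
      obtain t where t: "t \<in> S" "anc c' t" using c' unfolding span_def by blast
      have "s \<noteq> t" using siblings_disjoint[OF c(1) c'(1)] c t ne by blast
      moreover have "meet s t = v" using meet_eqI[OF c(1) c'(1) _ c(2) t(2)] ne by blast
      ultimately show False using n s t unfolding kept_def by blast
    qed
    moreover have "c \<in> span" using c s unfolding span_def by blast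
    ultimately have "{c \<in> span. par v c} = {c}" using c by blast
    then show False using d degree_span[OF assms] \<open>v \<noteq> r\<close> by simp
  qed
qed

text \<open>This is the covering relation of the ancestor order restricted to \<open>kept\<close>;
  \<open>induced_subtree_eq\<close> identifies it with the edges left after suppression.\<close>

definition cover :: "'a \<Rightarrow> 'a \<Rightarrow> bool" where
  "cover u v \<longleftrightarrow> u \<in> kept \<and> v \<in> kept \<and> anc u v \<and> u \<noteq> v \<and> (\<forall>k\<in>kept. anc u k \<longrightarrow> anc k v \<longrightarrow> k = u \<or> k = v)"

lemma gpath_span: "gpath G u p v \<Longrightarrow> gpath T u p v" for u p v
proof -
  assume p: "gpath G u p v"
  have "edges G \<subseteq> edges T" unfolding edges_root_path_union edges_eq by blast
  moreover have "verts G \<subseteq> V" unfolding verts_root_path_union using span_in by blast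
  ultimately show ?thesis using p unfolding gpath_def by blast
qed

lemma segment: assumes "anc u v" obtains xs zs where "rp u = xs @ [u]" "rp v = xs @ u # zs"
  "gpath T u (u # zs) v"
proof -
  have V: "u \<in> V" "v \<in> V" using assms anc_in by auto
  obtain xs where xs: "rp u = xs @ [u]" using rp_props[OF V(1)] by (metis append_butlast_last_id)
  obtain zs where zs: "rp v = xs @ u # zs" using assms xs unfolding anc_prefix prefix_def by auto
  have "path_edges (u # zs) \<subseteq> path_edges (rp v)" unfolding zs by (cases "xs = []") (auto simp: path_edges_append)
  then have "gpath T u (u # zs) v" unfolding gpath_def using rp_props[OF V(2)] unfolding zs by auto
  then show ?thesis using that xs zs by blast
qed

lemma cover_if_path:
  assumes "u \<in> kept" "v \<in> kept" "u \<noteq> v" "anc u v" and p: "gpath G u p v"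
    and deg: "\<forall>x\<in>set p - {u, v}. gdegree G x = 2"
  shows "cover u v"
proof -
  obtain xs zs where s: "rp u = xs @ [u]" "rp v = xs @ u # zs" "gpath T u (u # zs) v" using segment[OF assms(4)] .
  have pe: "p = u # zs" using gpath_unique gpath_span p s by blast
  have "k = u \<or> k = v" if k: "k \<in> kept" "anc u k" "anc k v" for k
  proof -
    have "k \<in> set p"
    proof (cases "k \<in> set xs")
      case True
      then have "anc k u" using anc_iff s(1) anc_in assms(4) by simp
      then have "k = u" using k anc_antisym by blast
      then show ?thesis using pe by simp
    next
      case False
      then show ?thesis using k(3) s(2) pe unfolding anc_iff by auto
    qed
    moreover have "gdegree G k \<noteq> 2" using kept_iff kept_span k(1) by blast
    ultimately show ?thesis using deg by blast
  qed
  then show ?thesis unfolding cover_def using assms by blast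
qed

lemma path_if_cover:
  assumes "cover u v"
  shows "\<exists>p. gpath G u p v \<and> (\<forall>x\<in>set p - {u, v}. gdegree G x = 2)"
proof -
  have c: "u \<in> kept" "v \<in> kept" "anc u v" using assms unfolding cover_def by auto
  obtain xs zs where s: "rp u = xs @ [u]" "rp v = xs @ u # zs" "gpath T u (u # zs) v" using segment[OF c(3)] .
  have v: "v \<in> span" "v \<in> V" using kept_span c span_in by auto
  have up: "w \<in> span" if "anc w v" for w using that v anc_trans unfolding span_def by blast
  have av: "anc x v" if "x \<in> set (u # zs)" for x using that s(2) v anc_iff by auto
  have "path_edges (u # zs) \<subseteq> path_edges (rp v)" unfolding s(2) by (cases "xs = []") (auto simp: path_edges_append)
  then have "path_edges (u # zs) \<subseteq> edges G"
    unfolding path_edges_rp[OF v(2)] edges_root_path_union using up by blast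
  moreover have "set (u # zs) \<subseteq> span" using av up by blast
  ultimately have "gpath G u (u # zs) v"
    using s(3) unfolding gpath_def verts_root_path_union by blast
  moreover have "gdegree G x = 2" if x: "x \<in> set (u # zs) - {u, v}" for x
  proof -
    have "x \<notin> set xs" using rp_props(4)[OF v(2)] s(2) x by auto
    then have "\<not> anc x u" using anc_iff s(1) x by auto
    then have "anc u x" using anc_chain[OF c(3) av] x by blast
    then have "x \<notin> kept" using assms av x unfolding cover_def by blast
    then show ?thesis using kept_iff up av x by blast
  qed
  ultimately show ?thesis by blast
qed

lemma gpath_rev: "gpath H u p v \<Longrightarrow> gpath H v (rev p) u"
  unfolding gpath_def by (simp add: path_edges_rev hd_rev last_rev)

text \<open>The path climbs to \<open>meet u v\<close> and descends again. That vertex is also the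
  \<open>meet\<close> of two leaves of \<open>S\<close>, one below \<open>u\<close> and one below
  \<open>v\<close>, so it is kept; suppression therefore never joins incomparable vertices.\<close>

lemma incomparable_path:
  assumes uv: "u \<in> span" "v \<in> span" "\<not> anc u v" "\<not> anc v u" and p: "gpath G u p v"
  shows "\<exists>w\<in>kept. w \<in> set p - {u, v}"
proof -
  have V: "u \<in> V" "v \<in> V" using uv span_in by auto
  let ?w = "meet u v"
  have w: "anc ?w u" "anc ?w v" using meet_anc V by auto
  have wne: "?w \<noteq> u" "?w \<noteq> v" using w uv by metis+
  obtain xs us where u: "rp ?w = xs @ [?w]" "rp u = xs @ ?w # us" "gpath T ?w (?w # us) u" using segment[OF w(1)] .
  obtain ys vs where v: "rp ?w = ys @ [?w]" "rp v = ys @ ?w # vs" "gpath T ?w (?w # vs) v" using segment[OF w(2)] .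
  have disj: "set us \<inter> set vs = {}"
  proof (rule ccontr)
    assume "set us \<inter> set vs \<noteq> {}"
    then obtain x where x: "x \<in> set us" "x \<in> set vs" by blast
    then have "anc x u" "anc x v" using anc_iff V u(2) v(2) by auto
    then have "x \<in> set (rp ?w)" using anc_meet V anc_iff by blast
    then show False using u(1) rp_props(4)[OF V(1)] u(2) x by auto
  qed
  let ?q = "rev us @ ?w # vs"
  have ne: "us \<noteq> []" "vs \<noteq> []" using u(2) v(2) rp_props(3) V wne by (metis last_snoc)+
  have "path_edges ?q = path_edges (rev (?w # us)) \<union> path_edges (?w # vs)"
    using ne path_edges_append[of "rev us" "?w # vs"] path_edges_append[of "rev us" "[?w]"]
    by (cases vs) auto
  then have "path_edges ?q \<subseteq> edges T"
    using u(3) v(3) unfolding path_edges_rev gpath_def by simp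
  then have "gpath T u ?q v"
    using u(3) v(3) ne disj unfolding gpath_def by (auto simp: hd_append hd_rev)
  then have "p = ?q" using gpath_unique gpath_span p by blast
  then have mem: "?w \<in> set p - {u, v}" using wne by simp
  obtain s t where st: "s \<in> S" "anc u s" "t \<in> S" "anc v t" using uv unfolding span_def by blast
  have sV: "s \<in> V" "t \<in> V" using st S leaves_in by auto
  have "s \<noteq> t" using st uv anc_chain by blast
  moreover have "meet s t = ?w"
  proof (rule anc_antisym)
    show "anc ?w (meet s t)" using anc_meet sV w st anc_trans by blast
    have "anc (meet s t) u"
      using anc_chain[OF meet_anc(1)[OF sV] st(2)] meet_anc(2)[OF sV] st(4) anc_trans anc_chain uv by blast
    moreover have "anc (meet s t) v"
      using anc_chain[OF meet_anc(2)[OF sV] st(4)] meet_anc(1)[OF sV] st(2) anc_trans anc_chain uv by blast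
    ultimately show "anc (meet s t) ?w" using anc_meet V by blast
  qed
  ultimately have "?w \<in> {meet s t | s t. s \<in> S \<and> t \<in> S \<and> s \<noteq> t}" using st by (metis (mono_tags, lifting) mem_Collect_eq)
  then have "?w \<in> kept" unfolding kept_def by simp
  then show ?thesis using mem by blast
qed

lemma induced_subtree_eq:
  "induced_subtree T S = \<lparr>verts = kept, edges = {{u, v} | u v. cover u v}, root_vertex = r\<rparr>"
proof -
  have K: "{v \<in> verts G. gdegree G v \<noteq> 2} = kept"
    unfolding verts_root_path_union using kept_iff kept_span by blast
  have "{{u, v} | u v. u \<in> kept \<and> v \<in> kept \<and> u \<noteq> v \<and>
      (\<exists>p. gpath G u p v \<and> (\<forall>x\<in>set p - {u, v}. gdegree G x = 2))} = {{u, v} | u v. cover u v}"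
  proof (intro equalityI subsetI)
    fix e assume "e \<in> {{u, v} | u v. u \<in> kept \<and> v \<in> kept \<and> u \<noteq> v \<and>
      (\<exists>p. gpath G u p v \<and> (\<forall>x\<in>set p - {u, v}. gdegree G x = 2))}"
    then obtain u v p where e: "e = {u, v}" "u \<in> kept" "v \<in> kept" "u \<noteq> v" "gpath G u p v"
      "\<forall>x\<in>set p - {u, v}. gdegree G x = 2" by blast
    have "anc u v \<or> anc v u"
      using incomparable_path[of u v p] kept_iff kept_span e by blast
    then show "e \<in> {{u, v} | u v. cover u v}"
    proof
      assume "anc u v"
      then show ?thesis using cover_if_path e by blast
    next
      assume "anc v u"
      then have "cover v u" using cover_if_path[OF e(3,2) _ _ gpath_rev[OF e(5)]] e by auto
      then show ?thesis using e(1) by blast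
    qed
  next
    fix e assume "e \<in> {{u, v} | u v. cover u v}"
    then obtain u v where "e = {u, v}" "cover u v" by blast
    then show "e \<in> {{u, v} | u v. u \<in> kept \<and> v \<in> kept \<and> u \<noteq> v \<and>
      (\<exists>p. gpath G u p v \<and> (\<forall>x\<in>set p - {u, v}. gdegree G x = 2))}"
      using path_if_cover[of u v] unfolding cover_def by blast
  qed
  then show ?thesis unfolding induced_subtree_def suppress_degree2_def Let_def K by simp
qed

lemma cover_unique: assumes "cover u v" "cover u' v" shows "u = u'"
  using assms anc_chain[of u v u'] unfolding cover_def by blast

lemma cover_siblings: assumes "cover u x" "cover u y" "x \<noteq> y" "anc y l" shows "\<not> anc x l"
  using assms anc_chain[of x l y] unfolding cover_def by blast

lemma cover_anc: "cover u v \<Longrightarrow> anc u v" unfolding cover_def by blast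
lemma cover_kept: "cover u v \<Longrightarrow> u \<in> kept \<and> v \<in> kept" unfolding cover_def by blast
lemma cover_not_leaf: "cover u v \<Longrightarrow> u \<notin> leaves T" unfolding cover_def using leaf_anc by blast
lemma cover_not_root: "cover u v \<Longrightarrow> v \<noteq> r"
  unfolding cover_def using anc_antisym anc_root anc_in by blast

end

end

section \<open>The two shapes of an induced subtree on four leaves\<close>

definition balanced_tree where
  "balanced_tree r u1 u2 u3 a b c d = \<lparr>verts = {r, u1, u2, u3, a, b, c, d},
     edges = {{r, u1}, {u1, u2}, {u1, u3}, {u2, a}, {u2, b}, {u3, c}, {u3, d}}, root_vertex = r\<rparr>"

definition caterpillar_tree where
  "caterpillar_tree r u1 u2 u3 a b c d = \<lparr>verts = {r, u1, u2, u3, a, b, c, d},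
     edges = {{r, u1}, {u1, a}, {u1, u2}, {u2, b}, {u2, u3}, {u3, c}, {u3, d}}, root_vertex = r\<rparr>"

context binary_tree begin

text \<open>Every kept vertex except the root is covered by at most one vertex, so a list of cover
  pairs that reaches all of them is complete.\<close>

lemma cover_edges_eqI:
  assumes S: "S \<subseteq> leaves T" "S \<noteq> {}"
    and P: "\<And>u v. (u, v) \<in> P \<Longrightarrow> cover S u v" and K: "kept S \<subseteq> insert r (snd ` P)"
  shows "{{u, v} | u v. cover S u v} = (\<lambda>(u, v). {u, v}) ` P"
proof (intro equalityI subsetI)
  fix e assume "e \<in> {{u, v} | u v. cover S u v}"
  then obtain u v where e: "e = {u, v}" "cover S u v" by blast
  then have "v \<in> snd ` P" using K cover_kept[OF S] cover_not_root[OF S] by blast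
  then obtain u' where u': "(u', v) \<in> P" by force
  then have "u = u'" using cover_unique[OF S e(2)] P by blast
  then show "e \<in> (\<lambda>(u, v). {u, v}) ` P" using e u' by force
qed (use P in auto)

lemma root_anc: "anc x r \<Longrightarrow> x = r" using anc_antisym anc_root anc_in by blast

text \<open>A leaf or the root cannot lie strictly between two vertices, so covering has to be
  tested only against the three inner vertices.\<close>

lemma cover_edgesI:
  assumes l: "{a, b, c, d} \<subseteq> leaves T" and dist: "distinct [r, u1, u2, u3, a, b, c, d]"
    and u: "{meet s t | s t. s \<in> {a, b, c, d} \<and> t \<in> {a, b, c, d} \<and> s \<noteq> t} = {u1, u2, u3}"
    and P: "snd ` P = {u1, u2, u3, a, b, c, d}"
    and anc: "\<And>v w k. (v, w) \<in> P \<Longrightarrow> anc v w \<and> v \<noteq> w \<and> v \<in> {r, u1, u2, u3} \<and>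
      (k \<in> {u1, u2, u3} \<longrightarrow> anc v k \<longrightarrow> anc k w \<longrightarrow> k = v \<or> k = w)"
  shows "induced_subtree T {a, b, c, d} =
    \<lparr>verts = {r, u1, u2, u3, a, b, c, d}, edges = (\<lambda>(u, v). {u, v}) ` P, root_vertex = r\<rparr>"
proof -
  have S: "{a, b, c, d} \<subseteq> leaves T" "{a, b, c, d} \<noteq> {}" using l by auto
  have K: "kept {a, b, c, d} = {r, u1, u2, u3, a, b, c, d}" unfolding kept_def[OF S] u by auto
  have "cover {a, b, c, d} v w" if p: "(v, w) \<in> P" for v w
  proof -
    have "w \<in> {u1, u2, u3, a, b, c, d}" using P p by force
    moreover have "k = v \<or> k = w" if k: "k \<in> insert r ({u1, u2, u3} \<union> {a, b, c, d})" "anc v k" "anc k w" for k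
      using k anc[OF p, of k] leaf_anc[of k w] l root_anc[of v] by blast
    ultimately show ?thesis unfolding cover_def[OF S] K using anc[OF p] by auto
  qed
  then have "{{u, v} | u v. cover {a, b, c, d} u v} = (\<lambda>(u, v). {u, v}) ` P"
    by (rule cover_edges_eqI[OF S]) (auto simp: K P)
  then show ?thesis using induced_subtree_eq[OF S] K by simp
qed

lemma balanced_shape:
  assumes t: "trip a b c" "trip a b d" "trip c d a" "trip c d b" and ne: "a \<noteq> b" "c \<noteq> d"
  obtains u1 u2 u3 where "distinct [r, u1, u2, u3, a, b, c, d]" "{r, u1, u2, u3, a, b, c, d} \<subseteq> V"
    "induced_subtree T {a, b, c, d} = balanced_tree r u1 u2 u3 a b c d"
proof -
  let ?S = "{a, b, c, d}"
  define u1 u2 u3 where u: "u1 = meet a c" "u2 = meet a b" "u3 = meet c d"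
  have l: "a \<in> leaves T" "b \<in> leaves T" "c \<in> leaves T" "d \<in> leaves T" using t unfolding trip_def by auto
  then have V: "a \<in> V" "b \<in> V" "c \<in> V" "d \<in> V" using leaves_in by auto
  have S: "?S \<subseteq> leaves T" "?S \<noteq> {}" using l by auto
  have ne': "a \<noteq> c" "a \<noteq> d" "b \<noteq> c" "b \<noteq> d" using t unfolding trip_def by blast+
  \<comment> \<open>The triples make the four lowest common ancestors between the two cherries
    coincide; the six pairs thus give three inner vertices.\<close>
  have m: "meet b c = u1" "meet a d = u1" "meet b d = u1"
    using trip_meet_eq t meet_commute V unfolding u by metis+
  have m': "meet b a = u2" "meet d c = u3" "meet c a = u1" "meet c b = u1" "meet d a = u1" "meet d b = u1"
    using m meet_commute V unfolding u by metis+
  have mS: "{meet s t | s t. s \<in> ?S \<and> t \<in> ?S \<and> s \<noteq> t} = {u1, u2, u3}"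
    using m m' u ne ne' by auto
  have p: "anc u1 a" "anc u1 b" "anc u1 c" "anc u1 d" "anc u2 a" "anc u2 b" "anc u3 c" "anc u3 d"
    using meet_anc V m u by metis+
  then have p': "anc u1 u2" "anc u1 u3" using anc_meet V u by simp_all
  have n: "\<not> anc u2 c" "\<not> anc u2 d" "\<not> anc u3 a" "\<not> anc u3 b" using t trip_meet u by blast+
  have n': "\<not> anc u2 u1" "\<not> anc u3 u1" "\<not> anc u2 u3" "\<not> anc u3 u2" using n p anc_trans by blast+
  have ul: "u1 \<notin> leaves T" "u2 \<notin> leaves T" "u3 \<notin> leaves T" using meet_not_leaf l ne ne' u by metis+
  have ur: "u1 \<noteq> r" "u2 \<noteq> r" "u3 \<noteq> r" using meet_not_root l ne ne' u by metis+
  have rl: "r \<notin> leaves T" using leaf_iff by blast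
  have dist: "distinct [r, u1, u2, u3, a, b, c, d]"
    using ul ur rl l ne ne' n p by auto
  let ?P = "{(r, u1), (u1, u2), (u1, u3), (u2, a), (u2, b), (u3, c), (u3, d)}"
  have "induced_subtree T ?S =
    \<lparr>verts = {r, u1, u2, u3, a, b, c, d}, edges = (\<lambda>(u, v). {u, v}) ` ?P, root_vertex = r\<rparr>"
  proof (rule cover_edgesI[OF S(1) dist mS])
    fix v w k assume "(v, w) \<in> ?P"
    moreover have "anc r u1" using anc_root anc_in p by blast
    ultimately show "anc v w \<and> v \<noteq> w \<and> v \<in> {r, u1, u2, u3} \<and>
      (k \<in> {u1, u2, u3} \<longrightarrow> anc v k \<longrightarrow> anc k w \<longrightarrow> k = v \<or> k = w)"
      using p p' n n' dist by auto
  qed auto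
  moreover have "{r, u1, u2, u3, a, b, c, d} \<subseteq> V" using anc_in p V root_in by blast
  ultimately show ?thesis using that[of u1 u2 u3] dist unfolding balanced_tree_def by simp
qed

lemma caterpillar_shape:
  assumes t: "trip c d b" "trip c d a" "trip b c a" "trip b d a" and ne: "c \<noteq> d"
  obtains u1 u2 u3 where "distinct [r, u1, u2, u3, a, b, c, d]" "{r, u1, u2, u3, a, b, c, d} \<subseteq> V"
    "induced_subtree T {a, b, c, d} = caterpillar_tree r u1 u2 u3 a b c d"
proof -
  let ?S = "{a, b, c, d}"
  define u1 u2 u3 where u: "u1 = meet a b" "u2 = meet b c" "u3 = meet c d"
  have l: "a \<in> leaves T" "b \<in> leaves T" "c \<in> leaves T" "d \<in> leaves T" using t unfolding trip_def by auto
  then have V: "a \<in> V" "b \<in> V" "c \<in> V" "d \<in> V" using leaves_in by auto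
  have S: "?S \<subseteq> leaves T" "?S \<noteq> {}" using l by auto
  have ne': "a \<noteq> b" "a \<noteq> c" "a \<noteq> d" "b \<noteq> c" "b \<noteq> d" using t unfolding trip_def by blast+
  have m: "meet a c = u1" "meet a d = u1" "meet b d = u2"
    using trip_meet_eq t meet_commute V unfolding u by metis+
  have m': "meet b a = u1" "meet d c = u3" "meet c a = u1" "meet c b = u2" "meet d a = u1" "meet d b = u2"
    using m meet_commute V unfolding u by metis+
  have mS: "{meet s t | s t. s \<in> ?S \<and> t \<in> ?S \<and> s \<noteq> t} = {u1, u2, u3}"
    using m m' u ne ne' by auto
  have p: "anc u1 a" "anc u1 b" "anc u1 c" "anc u1 d" "anc u2 b" "anc u2 c" "anc u2 d" "anc u3 c" "anc u3 d"
    using meet_anc V m u by metis+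
  then have p': "anc u1 u2" "anc u1 u3" "anc u2 u3" using anc_meet V u by simp_all
  have n: "\<not> anc u2 a" "\<not> anc u3 a" "\<not> anc u3 b" using t trip_meet u by blast+
  have n': "\<not> anc u2 u1" "\<not> anc u3 u1" "\<not> anc u3 u2" using n p anc_trans by blast+
  have ul: "u1 \<notin> leaves T" "u2 \<notin> leaves T" "u3 \<notin> leaves T" using meet_not_leaf l ne ne' u by metis+
  have ur: "u1 \<noteq> r" "u2 \<noteq> r" "u3 \<noteq> r" using meet_not_root l ne ne' u by metis+
  have rl: "r \<notin> leaves T" using leaf_iff by blast
  have dist: "distinct [r, u1, u2, u3, a, b, c, d]"
    using ul ur rl l ne ne' n p by auto
  let ?P = "{(r, u1), (u1, a), (u1, u2), (u2, b), (u2, u3), (u3, c), (u3, d)}"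
  have "induced_subtree T ?S =
    \<lparr>verts = {r, u1, u2, u3, a, b, c, d}, edges = (\<lambda>(u, v). {u, v}) ` ?P, root_vertex = r\<rparr>"
  proof (rule cover_edgesI[OF S(1) dist mS])
    fix v w k assume "(v, w) \<in> ?P"
    moreover have "anc r u1" using anc_root anc_in p by blast
    ultimately show "anc v w \<and> v \<noteq> w \<and> v \<in> {r, u1, u2, u3} \<and>
      (k \<in> {u1, u2, u3} \<longrightarrow> anc v k \<longrightarrow> anc k w \<longrightarrow> k = v \<or> k = w)"
      using p p' n n' dist by auto
  qed auto
  moreover have "{r, u1, u2, u3, a, b, c, d} \<subseteq> V" using anc_in p V root_in by blast
  ultimately show ?thesis using that[of u1 u2 u3] dist unfolding caterpillar_tree_def by simp
qed

end

section \<open>Isomorphisms with the two obstructions\<close>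

lemma triple_relation_pullback:
  assumes t: "triple_relation Y t" and h: "inj_on h X" "h ` X \<subseteq> Y" and X: "finite X"
  shows "triple_relation X (\<lambda>a b c. a \<in> X \<and> b \<in> X \<and> c \<in> X \<and> t (h a) (h b) (h c))"
proof -
  interpret triple_relation Y t by (fact t)
  have hY: "h a \<in> Y" if "a \<in> X" for a using h that by blast
  have hn: "h a \<noteq> h b" if "a \<in> X" "b \<in> X" "a \<noteq> b" for a b using h that unfolding inj_on_def by blast
  show ?thesis
  proof (unfold_locales, goal_cases)
    case 1 show ?case by (fact X)
  next
    case 2 then show ?case by blast
  next
    case 3 then show ?case using sym by blast
  next
    case 4 then show ?case using neq by blast
  next
    case 5 then show ?case using refl hY hn by blast
  next
    case 6 then show ?case using asym by blast
  next
    case 7 then show ?case using trans by blast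
  next
    case 8 then show ?case using branch hY by blast
  next
    case (9 a b c) then show ?case using total[OF hY hY hY hn hn hn] by simp
  qed
qed

text \<open>For \<open>K1\<close>, suppose that \<open>a b\<close> precede \<open>c d\<close>, as
  the left tree allows. Then \<open>b\<close> before \<open>c\<close> forces \<open>b d\<close>
  before \<open>a c\<close> in view of the right tree, and \<open>d\<close> would precede
  \<open>a\<close>; the reverse case is symmetric. For \<open>K2\<close>, the elements
  \<open>p\<close> and \<open>s\<close> are the two extremes, while \<open>q\<close> must lie
  neither between \<open>r\<close> and \<open>s\<close> nor between \<open>p\<close> and
  \<open>r\<close>, which leaves no place for it.\<close>

lemma (in triple_pair) common_order_no_pat:
  fixes x y :: "'b \<Rightarrow> real"
  assumes x: "\<And>a b c. tL a b c \<Longrightarrow> x a < x c \<longleftrightarrow> x b < x c" "inj_on x X"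
    and y: "\<And>a b c. tR a b c \<Longrightarrow> y a < y c \<longleftrightarrow> y b < y c"
    and xy: "\<And>a b. a \<in> X \<Longrightarrow> b \<in> X \<Longrightarrow> x a < x b \<longleftrightarrow> y a < y b"
  shows "\<not> pat Q"
proof -
  have tR: "x a < x c \<longleftrightarrow> x b < x c" if "tR a b c" for a b c
    using y[OF that] xy[of a c] xy[of b c] R.dom[OF that] by blast
  have d: "x a < x b \<or> x b < x a" if "a \<in> X" "b \<in> X" "a \<noteq> b" for a b
    using x(2) that unfolding inj_on_def by (metis linorder_neqE_linordered_idom)
  have n1: "\<not> K1q a b c d'" for a b c d'
  proof
    assume K: "K1q a b c d'"
    note k = K1q_full[OF K]
    have X: "a \<in> X" "b \<in> X" "c \<in> X" "d' \<in> X" using k L.dom by blast+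
    show False
      using x(1)[OF k(1)] x(1)[OF k(2)] x(1)[OF k(3)] x(1)[OF k(4)] tR[OF k(5)] tR[OF k(6)] tR[OF k(7)] tR[OF k(8)]
        d[of a b] d[of a c] d[of a d'] d[of b c] d[of b d'] d[of c d'] X k(9-14)
      by (smt (verit))
  qed
  have n2: "\<not> K2q p q r s" for p q r s
  proof
    assume K: "K2q p q r s"
    note k = K2q_full[OF K]
    have X: "p \<in> X" "q \<in> X" "r \<in> X" "s \<in> X" using k L.dom by blast+
    show False
      using x(1)[OF k(1)] x(1)[OF k(2)] x(1)[OF k(3)] x(1)[OF k(4)] tR[OF k(5)] tR[OF k(6)] tR[OF k(7)] tR[OF k(8)]
        d[of p q] d[of p r] d[of p s] d[of q r] d[of q s] d[of r s] X k(9-14)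
      by (smt (verit))
  qed
  show ?thesis unfolding pat_def using n1 n2 by blast
qed

lemma graph_iso_inv_into:
  assumes inj: "inj_on \<psi> (verts K)" and v: "verts G = \<psi> ` verts K" and e: "edges G = (`) \<psi> ` edges K"
    and sub: "\<And>e. e \<in> edges K \<Longrightarrow> e \<subseteq> verts K"
  shows "graph_iso (inv_into (verts K) \<psi>) G K"
  unfolding graph_iso_def
proof (intro conjI ballI)
  show "bij_betw (inv_into (verts K) \<psi>) (verts G) (verts K)"
    unfolding v by (rule bij_betw_inv_into) (use inj in \<open>simp add: bij_betw_def\<close>)
  fix u w assume "u \<in> verts G" "w \<in> verts G"
  then obtain a b where ab: "a \<in> verts K" "b \<in> verts K" "u = \<psi> a" "w = \<psi> b" unfolding v by blast
  have i: "inv_into (verts K) \<psi> u = a" "inv_into (verts K) \<psi> w = b" using inj ab by simp_all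
  have "{u, w} = \<psi> ` e' \<longleftrightarrow> {a, b} = e'" if "e' \<in> edges K" for e'
    using inj_on_image_eq_iff[OF inj, of "{a, b}" e'] sub[OF that] ab by simp
  then have "{u, w} \<in> edges G \<longleftrightarrow> {a, b} \<in> edges K" unfolding e by blast
  then show "{u, w} \<in> edges G \<longleftrightarrow> {inv_into (verts K) \<psi> u, inv_into (verts K) \<psi> w} \<in> edges K"
    unfolding i .
qed

lemma graph_iso_inverse:
  assumes "graph_iso \<phi> G K"
  obtains g where "inj_on g (verts K)" "\<And>k. k \<in> verts K \<Longrightarrow> g k \<in> verts G \<and> \<phi> (g k) = k"
    "\<And>v. v \<in> verts G \<Longrightarrow> g (\<phi> v) = v"
    "\<And>k k'. k \<in> verts K \<Longrightarrow> k' \<in> verts K \<Longrightarrow> {g k, g k'} \<in> edges G \<longleftrightarrow> {k, k'} \<in> edges K"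
proof -
  have b: "bij_betw \<phi> (verts G) (verts K)"
    and e: "\<And>u v. u \<in> verts G \<Longrightarrow> v \<in> verts G \<Longrightarrow> {u, v} \<in> edges G \<longleftrightarrow> {\<phi> u, \<phi> v} \<in> edges K"
    using assms unfolding graph_iso_def by auto
  let ?g = "inv_into (verts G) \<phi>"
  have g: "?g k \<in> verts G \<and> \<phi> (?g k) = k" if "k \<in> verts K" for k
    using b that unfolding bij_betw_def by (auto intro: inv_into_into f_inv_into_f)
  show ?thesis
  proof (rule that[of ?g])
    show "inj_on ?g (verts K)" using g by (metis inj_onI)
    show "?g (\<phi> v) = v" if "v \<in> verts G" for v using b that unfolding bij_betw_def by simp
    show "{?g k, ?g k'} \<in> edges G \<longleftrightarrow> {k, k'} \<in> edges K" if "k \<in> verts K" "k' \<in> verts K" for k k'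
      using e[of "?g k" "?g k'"] g that by simp
  qed (use g in blast)
qed

context binary_tree begin

section \<open>Reading a tree back from the graph of an induced subtanglegram\<close>

context
  fixes S E' X E
  assumes S: "S \<subseteq> leaves T" "S \<noteq> {}"
    and E': "\<forall>e\<in>E'. e \<inter> V = {}"
    and X: "\<forall>m\<in>X. m \<inter> V \<subseteq> leaves T"
    and uniq: "\<forall>m\<in>X. \<forall>m'\<in>X. m \<inter> m' \<noteq> {} \<longrightarrow> m = m'"
    and E: "E = {{u, v} | u v. cover S u v} \<union> E' \<union> X"
begin

lemma not_other_edge: "y \<in> V \<Longrightarrow> {y, z} \<notin> E'"
  using E' by (metis disjoint_iff insertI1)

lemma edge_at_inner: assumes "{y, z} \<in> E" "y \<in> V" "y \<notin> leaves T" shows "cover S y z \<or> cover S z y"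
proof -
  have "{y, z} \<notin> E'" "{y, z} \<notin> X" using not_other_edge X assms by auto
  then show ?thesis using assms(1) unfolding E by (auto simp: doubleton_eq_iff)
qed

lemma edge_at_root: assumes "{r, z} \<in> E" shows "cover S r z"
  using edge_at_inner[OF assms root_in] leaf_iff cover_not_root[OF S] by blast

text \<open>An isomorphism prescribes the images of the roots but does not tell tree edges from
  matching edges. Besides its edge upwards, a leaf has at most one matching edge; a vertex with two
  further neighbours is therefore inner, and these neighbours are below it.\<close>

lemma edges_below: assumes c: "cover S x y" and z: "{y, z1} \<in> E" "{y, z2} \<in> E" "distinct [x, z1, z2]"
  shows "cover S y z1" "cover S y z2"
proof -
  have y: "y \<in> V" using c cover_anc[OF S] anc_in by blast
  have nl: "y \<notin> leaves T"
  proof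
    assume l: "y \<in> leaves T"
    have "{y, z} \<in> X" if "{y, z} \<in> E" "z \<noteq> x" for z
    proof -
      have "\<not> cover S y z" using cover_not_leaf[OF S] l by blast
      moreover have "\<not> cover S z y" using cover_unique[OF S c] that by blast
      moreover have "{y, z} \<notin> E'" using not_other_edge y by blast
      ultimately show ?thesis using that(1) unfolding E by (auto simp: doubleton_eq_iff)
    qed
    then have "{y, z1} \<in> X" "{y, z2} \<in> X" using z by auto
    moreover have "{y, z1} \<inter> {y, z2} \<noteq> {}" by auto
    ultimately have "{y, z1} = {y, z2}" using uniq by simp
    then show False using z(3) by (auto simp: doubleton_eq_iff)
  qed
  show "cover S y z1" "cover S y z2"
    using edge_at_inner[OF z(1) y nl] edge_at_inner[OF z(2) y nl] cover_unique[OF S c] z(3) by auto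
qed

text \<open>The descent starts at the root, whose position is known, and passes from each identified
  vertex to its two lower neighbours. The resulting triples are the two that \<open>K1q\<close>
  demands of one tree.\<close>

lemma balanced_chase:
  assumes e: "{{r, w1}, {w1, w2}, {w1, w3}, {w2, a}, {w2, b}, {w3, c}, {w3, d}} \<subseteq> E"
    and d: "distinct [r, w1, w2, w3, a, b, c, d]"
  shows "{a, b, c, d} \<subseteq> V" "\<exists>v. anc v a \<and> anc v b \<and> \<not> anc v c" "\<exists>v. anc v c \<and> anc v d \<and> \<not> anc v a"
proof -
  have c1: "cover S r w1" using edge_at_root e by simp
  have c2: "cover S w1 w2" "cover S w1 w3" using edges_below[OF c1, of w2 w3] e d by simp_all
  have c3: "cover S w2 a" "cover S w2 b" using edges_below[OF c2(1), of a b] e d by simp_all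
  have c4: "cover S w3 c" "cover S w3 d" using edges_below[OF c2(2), of c d] e d by simp_all
  note an = c3[THEN cover_anc[OF S]] c4[THEN cover_anc[OF S]]
  show "{a, b, c, d} \<subseteq> V" using an anc_in by blast
  have "w2 \<noteq> w3" using d by auto
  then have "\<not> anc w2 c" "\<not> anc w3 a" using cover_siblings[OF S] c2 an by metis+
  then show "\<exists>v. anc v a \<and> anc v b \<and> \<not> anc v c" "\<exists>v. anc v c \<and> anc v d \<and> \<not> anc v a" using an by blast+
qed

lemma caterpillar_chase:
  assumes e: "{{r, w1}, {w1, a}, {w1, w2}, {w2, b}, {w2, w3}, {w3, c}, {w3, d}} \<subseteq> E"
    and d: "distinct [r, w1, w2, w3, a, b, c, d]"
  shows "{a, b, c, d} \<subseteq> V" "\<exists>v. anc v c \<and> anc v d \<and> \<not> anc v b" "\<exists>v. anc v b \<and> anc v d \<and> \<not> anc v a"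
proof -
  have c1: "cover S r w1" using edge_at_root e by simp
  have c2: "cover S w1 a" "cover S w1 w2" using edges_below[OF c1, of w2 a] e d by simp_all
  have c3: "cover S w2 b" "cover S w2 w3" using edges_below[OF c2(2), of w3 b] e d by simp_all
  have c4: "cover S w3 c" "cover S w3 d" using edges_below[OF c3(2), of c d] e d by simp_all
  note an = c2[THEN cover_anc[OF S]] c3[THEN cover_anc[OF S]] c4[THEN cover_anc[OF S]]
  show V: "{a, b, c, d} \<subseteq> V" using an anc_in by blast
  have "w2 \<noteq> a" "w3 \<noteq> b" using d by auto
  then have "\<not> anc w2 a" "\<not> anc w3 b" using cover_siblings[OF S] c2 c3 anc_refl V by (metis insert_subset)+
  then show "\<exists>v. anc v c \<and> anc v d \<and> \<not> anc v b" "\<exists>v. anc v b \<and> anc v d \<and> \<not> anc v a"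
    using an anc_trans by blast+
qed

end

lemma plane_drawing_cong:
  assumes "\<And>v. v \<in> V \<Longrightarrow> f v = g v" "plane_drawing T f n c"
  shows "plane_drawing T g n c"
proof -
  have e: "e \<subseteq> V" if "e \<in> edges T" for e using that edge_cases by blast
  have im: "f ` e = g ` e" if "e \<in> edges T" for e using e[OF that] assms(1) by (intro image_cong) auto
  have im2: "f ` (e \<inter> e') = g ` (e \<inter> e')" if "e \<in> edges T" for e e'
    using e[OF that] assms(1) by (intro image_cong) auto
  have "crossing_free_drawing T f" using assms(2) unfolding plane_drawing_def by blast
  then have "crossing_free_drawing T g"
    unfolding crossing_free_drawing_def using im im2 assms(1) inj_on_cong[of V f g] by simp
  then show ?thesis using assms leaves_in unfolding plane_drawing_def by simp
qed

end

section \<open>Tanglegrams\<close>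

lemma segments_apart:
  fixes p p' q q' :: real
  assumes "p < p'" "q < q'"
  shows "convex hull {(p, p), (q + 1, q)} \<inter> convex hull {(p', p'), (q' + 1, q')} = {}"
proof (rule ccontr)
  assume "convex hull {(p, p), (q + 1, q)} \<inter> convex hull {(p', p'), (q' + 1, q')} \<noteq> {}"
  then obtain u v u' v' where
    h: "0 \<le> u" "0 \<le> v" "u + v = 1" "0 \<le> u'" "0 \<le> v'" "u' + v' = 1"
    and e: "u *\<^sub>R (p, p) + v *\<^sub>R (q + 1, q) = u' *\<^sub>R (p', p') + v' *\<^sub>R (q' + 1, q')"
    unfolding convex_hull_2 by blast
  from e have "u * p + v * q = u' * p' + v' * q'" "u * p + v * q + v = u' * p' + v' * q' + v'"
    by (simp_all add: distrib_left)
  \<comment> \<open>On both segments the difference of the coordinates is the weight of the right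
    end, so a common point divides both in the same ratio.\<close>
  then have "v = v'" "u * p + v * q = u * p' + v * q'" using h by auto
  then have "u * (p' - p) + v * (q' - q) = 0" by (simp add: algebra_simps)
  moreover have "0 \<le> u * (p' - p)" "0 \<le> v * (q' - q)" using h assms by auto
  ultimately have "u * (p' - p) = 0" "v * (q' - q) = 0" by linarith+
  then show False using assms h by simp
qed

text \<open>The balance argument orders matching edges, whereas a drawing needs positions on the
  leaves of its own tree; \<open>h\<close> will be \<open>lam\<close> or \<open>rho\<close>.\<close>

lemma triple_order_transfer:
  fixes x :: "'b \<Rightarrow> real"
  assumes h: "inj_on h X" "h ` X = Y" and x: "inj_on x X"
    and t: "\<And>a b c. t a b c \<Longrightarrow> a \<in> Y \<and> b \<in> Y \<and> c \<in> Y"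
    and o: "\<And>a b c. \<lbrakk>a \<in> X; b \<in> X; c \<in> X; t (h a) (h b) (h c)\<rbrakk> \<Longrightarrow> x a < x c \<longleftrightarrow> x b < x c"
  obtains p where "inj_on p Y" "\<And>a b c. t a b c \<Longrightarrow> p a < p c \<longleftrightarrow> p b < p c" "\<And>m. m \<in> X \<Longrightarrow> p (h m) = x m"
proof (rule that[of "x \<circ> inv_into X h"])
  have i: "inv_into X h y \<in> X" "h (inv_into X h y) = y" if "y \<in> Y" for y
    using that h(2) by (auto intro: inv_into_into f_inv_into_f)
  show "inj_on (x \<circ> inv_into X h) Y"
    using x h by (intro comp_inj_on inj_on_inv_into) (auto intro: inj_on_subset inv_into_into)
  show "(x \<circ> inv_into X h) a < (x \<circ> inv_into X h) c \<longleftrightarrow> (x \<circ> inv_into X h) b < (x \<circ> inv_into X h) c"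
    if "t a b c" for a b c
    unfolding comp_def by (rule o) (use i t that in auto)
  show "(x \<circ> inv_into X h) (h m) = x m" if "m \<in> X" for m using h(1) that by simp
qed

locale tanglegram_loc =
  fixes TT :: "'a tanglegram_data"
  assumes tanglegram: "tanglegram TT"
begin

sublocale L: binary_tree "left_tree TT"
  by unfold_locales (use tanglegram in \<open>simp add: tanglegram_def\<close>)
sublocale R: binary_tree "right_tree TT"
  by unfold_locales (use tanglegram in \<open>simp add: tanglegram_def\<close>)

abbreviation "M \<equiv> matching TT"
abbreviation "lvL \<equiv> leaves (left_tree TT)"
abbreviation "lvR \<equiv> leaves (right_tree TT)"

lemma disjoint_trees: "L.V \<inter> R.V = {}"
  using tanglegram unfolding tanglegram_def by (elim conjE)
lemma matching_ends: "\<forall>m\<in>M. \<exists>l\<in>lvL. \<exists>s\<in>lvR. m = {l, s}"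
  using tanglegram unfolding tanglegram_def by (elim conjE)
lemma matching_perfect: "\<forall>v\<in>lvL \<union> lvR. \<exists>!m. m \<in> M \<and> v \<in> m"
  using tanglegram unfolding tanglegram_def by (elim conjE)

lemma disjoint_leaves: "l \<in> lvL \<Longrightarrow> l \<notin> lvR" using disjoint_trees L.leaves_in R.leaves_in by blast

lemma matching_edge: assumes "m \<in> M" obtains l s where "l \<in> lvL" "s \<in> lvR" "m = {l, s}"
  using matching_ends assms by meson

lemma matching_unique: assumes "m \<in> M" "m' \<in> M" "v \<in> m" "v \<in> m'" shows "m = m'"
proof -
  obtain l s where "l \<in> lvL" "s \<in> lvR" "m = {l, s}" using matching_edge[OF assms(1)] .
  then have "v \<in> lvL \<union> lvR" using assms(3) by auto
  then show ?thesis using matching_perfect assms by blast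
qed

definition lam :: "'a set \<Rightarrow> 'a" where "lam m = (THE l. l \<in> lvL \<and> l \<in> m)"
definition rho :: "'a set \<Rightarrow> 'a" where "rho m = (THE s. s \<in> lvR \<and> s \<in> m)"

lemma lam_rho_eq: assumes "l \<in> lvL" "s \<in> lvR" shows "lam {l, s} = l" "rho {l, s} = s"
  unfolding lam_def rho_def using assms disjoint_leaves by (intro the_equality; auto)+

lemma lam_rho: assumes "m \<in> M" shows "lam m \<in> lvL" "rho m \<in> lvR" "m = {lam m, rho m}"
  using matching_edge[OF assms] lam_rho_eq by metis+

lemma lam_inj: "inj_on lam M"
  using lam_rho(3) matching_unique unfolding inj_on_def by (metis insertI1)
lemma rho_inj: "inj_on rho M"
  using lam_rho(3) matching_unique unfolding inj_on_def by (metis insertI1 insert_commute)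

lemma lam_image: "lam ` M = lvL"
proof
  show "lam ` M \<subseteq> lvL" using lam_rho by blast
  show "lvL \<subseteq> lam ` M"
  proof
    fix l assume l: "l \<in> lvL"
    then obtain m where m: "m \<in> M" "l \<in> m" using matching_perfect by blast
    then have "l \<in> {lam m, rho m}" using lam_rho(3) by simp
    then have "l = lam m" using lam_rho(2)[OF m(1)] l disjoint_leaves by auto
    then show "l \<in> lam ` M" using \<open>m \<in> M\<close> by blast
  qed
qed

lemma rho_image: "rho ` M = lvR"
proof
  show "rho ` M \<subseteq> lvR" using lam_rho by blast
  show "lvR \<subseteq> rho ` M"
  proof
    fix l assume l: "l \<in> lvR"
    then obtain m where m: "m \<in> M" "l \<in> m" using matching_perfect by blast
    then have "l \<in> {lam m, rho m}" using lam_rho(3) by simp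
    then have "l = rho m" using lam_rho(1)[OF m(1)] l disjoint_leaves by auto
    then show "l \<in> rho ` M" using \<open>m \<in> M\<close> by blast
  qed
qed

lemma finite_M: "finite M"
  using lam_inj lam_image L.trip_relation finite_imageD unfolding triple_relation_def by metis

definition tL where "tL a b c \<longleftrightarrow> a \<in> M \<and> b \<in> M \<and> c \<in> M \<and> L.trip (lam a) (lam b) (lam c)"
definition tR where "tR a b c \<longleftrightarrow> a \<in> M \<and> b \<in> M \<and> c \<in> M \<and> R.trip (rho a) (rho b) (rho c)"

lemma tL_relation: "triple_relation M tL"
  using triple_relation_pullback[OF L.trip_relation lam_inj _ finite_M] lam_image
  unfolding tL_def[abs_def] by blast
lemma tR_relation: "triple_relation M tR"
  using triple_relation_pullback[OF R.trip_relation rho_inj _ finite_M] rho_image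
  unfolding tR_def[abs_def] by blast

sublocale P: triple_pair M tL tR
  unfolding triple_pair_def using tL_relation tR_relation by blast

lemma layout_of_agree_off:
  assumes "P.agree_off D"
  shows "\<exists>f. layout TT f \<and> crossing_number TT f \<le> (if D = {} then 0 else 1)"
proof -
  obtain x y :: "'a set \<Rightarrow> real" where inj: "inj_on x M" "inj_on y M"
    and x: "\<And>a b c. tL a b c \<Longrightarrow> x a < x c \<longleftrightarrow> x b < x c"
    and y: "\<And>a b c. tR a b c \<Longrightarrow> y a < y c \<longleftrightarrow> y b < y c"
    and xy: "\<And>a b. \<lbrakk>a \<in> M; b \<in> M; a \<noteq> b; {a, b} \<noteq> D\<rbrakk> \<Longrightarrow> x a < x b \<longleftrightarrow> y a < y b"
    using P.agree_off_positions[OF assms] by blast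
  obtain pL where pL: "inj_on pL lvL" "\<And>a b c. L.trip a b c \<Longrightarrow> pL a < pL c \<longleftrightarrow> pL b < pL c"
    and il: "\<And>m. m \<in> M \<Longrightarrow> pL (lam m) = x m"
    by (rule triple_order_transfer[OF lam_inj lam_image inj(1), of L.trip]) (use x in \<open>auto simp: tL_def L.trip_def\<close>)
  obtain pR where pR: "inj_on pR lvR" "\<And>a b c. R.trip a b c \<Longrightarrow> pR a < pR c \<longleftrightarrow> pR b < pR c"
    and ir: "\<And>m. m \<in> M \<Longrightarrow> pR (rho m) = y m"
    by (rule triple_order_transfer[OF rho_inj rho_image inj(2), of R.trip]) (use y in \<open>auto simp: tR_def R.trip_def\<close>)
  define f where "f v = (if v \<in> L.V then L.draw pL v else ((\<lambda>z. (snd z + 1, fst z)) \<circ> R.draw pR) v)" for v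
  have "plane_drawing (left_tree TT) f (1, -1) 0"
    by (rule L.plane_drawing_cong[OF _ L.draw_left[OF pL]]) (simp_all add: f_def)
  moreover have "plane_drawing (right_tree TT) f (- (1, -1)) (- 1)"
    by (rule R.plane_drawing_cong[OF _ R.draw_right[OF pR]]) (use disjoint_trees in \<open>auto simp: f_def\<close>)
  ultimately have lay: "layout TT f"
    unfolding layout_def by (intro exI[of _ "(1, -1)"] exI[of _ 0] exI[of _ 1]) (simp add: zero_prod_def)
  have dL: "L.draw pL v = (L.lo pL v, L.hi pL v)" for v by (rule L.draw_def[OF pL])
  have dR: "R.draw pR v = (R.lo pR v, R.hi pR v)" for v by (rule R.draw_def[OF pR])
  have fl: "f (lam m) = (x m, x m)" if "m \<in> M" for m
  proof -
    note l = lam_rho(1)[OF that]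
    have "f (lam m) = (pL (lam m), pL (lam m))"
      using L.leaf_bounds(1)[OF pL l] L.leaf_bounds(2)[OF pL l] L.leaves_in[OF l] unfolding f_def dL by simp
    then show ?thesis using il[OF that] by simp
  qed
  have fr: "f (rho m) = (y m + 1, y m)" if "m \<in> M" for m
  proof -
    note l = lam_rho(2)[OF that]
    have "rho m \<notin> L.V" using R.leaves_in[OF l] disjoint_trees by blast
    then have "f (rho m) = (pR (rho m) + 1, pR (rho m))"
      using R.leaf_bounds(1)[OF pR l] R.leaf_bounds(2)[OF pR l] unfolding f_def comp_def dR by simp
    then show ?thesis using ir[OF that] by simp
  qed
  have seg: "f ` m = {(x m, x m), (y m + 1, y m)}" if "m \<in> M" for m
    by (subst lam_rho(3)[OF that]) (simp add: fl[OF that] fr[OF that])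
  have nc: "{m, m'} = D" if m: "m \<in> M" "m' \<in> M" "m \<noteq> m'"
    and c: "convex hull (f ` m) \<inter> convex hull (f ` m') \<noteq> {}" for m m'
  proof (rule ccontr)
    assume n: "{m, m'} \<noteq> D"
    have n': "{m', m} \<noteq> D" using n by (simp add: insert_commute)
    have "x m \<noteq> x m'" "y m \<noteq> y m'" using inj m unfolding inj_on_def by blast+
    then have "x m < x m' \<and> y m < y m' \<or> x m' < x m \<and> y m' < y m"
      using xy[OF m n] xy[OF m(2,1) _ n'] m(3) by auto
    then have "convex hull (f ` m) \<inter> convex hull (f ` m') = {}"
      unfolding seg[OF m(1)] seg[OF m(2)] using segments_apart by blast
    then show False using c by simp
  qed
  let ?C = "{{e, e'} | e e'. e \<in> M \<and> e' \<in> M \<and> e \<noteq> e' \<and> convex hull (f ` e) \<inter> convex hull (f ` e') \<noteq> {}}"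
  \<comment> \<open>A crossing is a set of two edges and never empty; removing \<open>{}\<close>
    gives the bound 0 when nothing is dropped.\<close>
  have sub: "?C \<subseteq> {D} - {{}}" using nc by blast
  have "card ?C \<le> card ({D} - {{}})" by (rule card_mono[OF _ sub]) simp
  also have "\<dots> \<le> (if D = {} then 0 else 1)" by simp
  finally show ?thesis using lay unfolding crossing_number_def by blast
qed

lemma no_pat_if_no_crossing:
  assumes "layout TT f" "crossing_number TT f = 0"
  shows "\<not> P.pat Q"
proof -
  obtain n c d where n: "n \<noteq> 0" and "c < d" and l: "plane_drawing (left_tree TT) f n c"
    and r: "plane_drawing (right_tree TT) f (- n) (- d)"
    using assms(1) unfolding layout_def by blast
  define m :: point where "m = (- snd n, fst n)"
  \<comment> \<open>The right tree is drawn with the opposite normal, for which the turned vector is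
    \<open>- m\<close>. This reverses its leaf order, and the absence of interleaving is unaffected
    by reversal.\<close>
  have mr: "- m = (- snd (- n), fst (- n))" "- n \<noteq> 0" using n unfolding m_def by auto
  have injf: "inj_on f L.V" "inj_on f R.V"
    using l[unfolded plane_drawing_def crossing_free_drawing_def, THEN conjunct1, THEN conjunct1]
      r[unfolded plane_drawing_def crossing_free_drawing_def, THEN conjunct1, THEN conjunct1] .
  have lc: "n \<bullet> f v = c" if "v \<in> lvL" for v using l that unfolding plane_drawing_def by simp
  have rd: "n \<bullet> f v = d" if "v \<in> lvR" for v
  proof -
    have "- n \<bullet> f v = - d" using r that unfolding plane_drawing_def by simp
    then show ?thesis by simp
  qed
  have zero: "f v = f w" if "n \<bullet> f v = n \<bullet> f w" "m \<bullet> f v = m \<bullet> f w" for v w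
  proof -
    have "f v - f w = 0" using point_zero_if[OF n m_def, of "f v - f w"] that by (simp add: inner_diff_right)
    then show ?thesis by simp
  qed
  have ne: "m \<bullet> f v \<noteq> m \<bullet> f w" if "v \<in> lvL \<and> w \<in> lvL \<or> v \<in> lvR \<and> w \<in> lvR" "v \<noteq> w" for v w
    using that zero[of v w] lc rd injf L.leaves_in R.leaves_in unfolding inj_on_def by metis
  have tl: "m \<bullet> f a < m \<bullet> f e \<longleftrightarrow> m \<bullet> f b < m \<bullet> f e" if t: "L.trip a b e" for a b e
  proof -
    have t': "L.trip b a e" using t unfolding L.trip_def by blast
    have "a \<in> lvL" "b \<in> lvL" "e \<in> lvL" "a \<noteq> e" "b \<noteq> e" using t unfolding L.trip_def by auto
    then have "m \<bullet> f a \<noteq> m \<bullet> f e" "m \<bullet> f b \<noteq> m \<bullet> f e" using ne by blast+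
    then show ?thesis
      using L.plane_drawing_no_interleaving[OF l n m_def t] L.plane_drawing_no_interleaving[OF l n m_def t']
      by linarith
  qed
  have tr: "m \<bullet> f a < m \<bullet> f e \<longleftrightarrow> m \<bullet> f b < m \<bullet> f e" if t: "R.trip a b e" for a b e
  proof -
    have t': "R.trip b a e" using t unfolding R.trip_def by blast
    have "a \<in> lvR" "b \<in> lvR" "e \<in> lvR" "a \<noteq> e" "b \<noteq> e" using t unfolding R.trip_def by auto
    then have "m \<bullet> f a \<noteq> m \<bullet> f e" "m \<bullet> f b \<noteq> m \<bullet> f e" using ne by blast+
    then show ?thesis
      using R.plane_drawing_no_interleaving[OF r mr(2,1) t] R.plane_drawing_no_interleaving[OF r mr(2,1) t']
      unfolding inner_minus_left by linarith
  qed
  let ?C = "{{e, e'} | e e'. e \<in> M \<and> e' \<in> M \<and> e \<noteq> e' \<and> convex hull (f ` e) \<inter> convex hull (f ` e') \<noteq> {}}"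
  have "?C \<subseteq> Pow M" by (intro subsetI; elim CollectE exE conjE; simp)
  then have "finite ?C" by (rule finite_subset) (simp add: finite_M)
  then have "?C = {}" using assms(2)[unfolded crossing_number_def] by (rule card_0_eq[THEN iffD1])
  then have nc: "convex hull (f ` e) \<inter> convex hull (f ` e') = {}" if "e \<in> M" "e' \<in> M" "e \<noteq> e'" for e e'
    using that by blast
  have mono: "m \<bullet> f (rho a) < m \<bullet> f (rho b)" if ab: "a \<in> M" "b \<in> M" "m \<bullet> f (lam a) < m \<bullet> f (lam b)" for a b
  proof (rule ccontr)
    assume no: "\<not> m \<bullet> f (rho a) < m \<bullet> f (rho b)"
    have im: "f ` e = {f (lam e), f (rho e)}" if "e \<in> M" for e
      by (subst lam_rho(3)[OF that]) simp
    have "convex hull (f ` a) \<inter> convex hull (f ` b) \<noteq> {}"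
      unfolding im[OF ab(1)] im[OF ab(2)]
      by (rule segments_cross[OF n m_def]) (use lc rd lam_rho ab no in auto)
    moreover have "a \<noteq> b" using ab by auto
    ultimately show False using nc ab by blast
  qed
  show ?thesis
  proof (rule P.common_order_no_pat[of "\<lambda>e. m \<bullet> f (lam e)" "\<lambda>e. m \<bullet> f (rho e)"])
    show "inj_on (\<lambda>e. m \<bullet> f (lam e)) M"
      using ne lam_inj lam_rho(1) unfolding inj_on_def by metis
    show "m \<bullet> f (lam a) < m \<bullet> f (lam b) \<longleftrightarrow> m \<bullet> f (rho a) < m \<bullet> f (rho b)" if "a \<in> M" "b \<in> M" for a b
    proof (cases "a = b")
      case False
      then have "m \<bullet> f (lam a) \<noteq> m \<bullet> f (lam b)" using that ne lam_inj lam_rho(1) unfolding inj_on_def by metis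
      then consider "m \<bullet> f (lam a) < m \<bullet> f (lam b)" | "m \<bullet> f (lam b) < m \<bullet> f (lam a)" by linarith
      then show ?thesis using mono[OF that] mono[OF that(2,1)] by cases linarith+
    qed simp
    show "m \<bullet> f (lam a) < m \<bullet> f (lam e) \<longleftrightarrow> m \<bullet> f (lam b) < m \<bullet> f (lam e)" if "tL a b e" for a b e
      by (rule tl) (use that in \<open>simp add: tL_def\<close>)
    show "m \<bullet> f (rho a) < m \<bullet> f (rho e) \<longleftrightarrow> m \<bullet> f (rho b) < m \<bullet> f (rho e)" if "tR a b e" for a b e
      by (rule tr) (use that in \<open>simp add: tR_def\<close>)
  qed
qed

end

section \<open>From the ternary patterns to cross-responsible sets\<close>

definition place :: "'a list \<Rightarrow> 'a list \<Rightarrow> kvertex \<Rightarrow> 'a" where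
  "place xs ys k = (case k of LRoot \<Rightarrow> xs ! 0 | LInner n \<Rightarrow> xs ! n | LLeaf n \<Rightarrow> xs ! (n + 3)
    | RRoot \<Rightarrow> ys ! 0 | RInner n \<Rightarrow> ys ! n | RLeaf n \<Rightarrow> ys ! (n + 3))"

abbreviation left_kverts :: "kvertex list" where
  "left_kverts \<equiv> [LRoot, LInner 1, LInner 2, LInner 3, LLeaf 1, LLeaf 2, LLeaf 3, LLeaf 4]"
abbreviation right_kverts :: "kvertex list" where
  "right_kverts \<equiv> [RRoot, RInner 1, RInner 2, RInner 3, RLeaf 1, RLeaf 2, RLeaf 3, RLeaf 4]"

abbreviation kverts :: "kvertex set" where
  "kverts \<equiv> set left_kverts \<union> set right_kverts"

lemma verts_K1: "verts (tanglegram_graph K1) = kverts"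
  and verts_K2: "verts (tanglegram_graph K2) = kverts"
  by (simp_all add: tanglegram_graph_def K1_def K2_def)

text \<open>Each list names the root, three inner vertices and four leaves of one tree in this
  order, whence the offset 3 for leaves in \<open>place\<close>. The map from \<open>K\<close> into
  the subtanglegram is easy to write down, and the isomorphism is its inverse.\<close>

lemma tanglegram_iso_place:
  fixes xs ys :: "'a list"
  assumes map: "map (place xs ys) left_kverts = xs" "map (place xs ys) right_kverts = ys"
    and d: "distinct xs" "distinct ys" "set xs \<inter> set ys = {}"
    and K: "verts (tanglegram_graph K) = kverts"
      "\<And>e. e \<in> edges (tanglegram_graph K) \<Longrightarrow> e \<subseteq> verts (tanglegram_graph K)"
      "root_vertex (left_tree K) = LRoot" "root_vertex (right_tree K) = RRoot"
    and S: "verts (tanglegram_graph S) = set xs \<union> set ys"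
      "edges (tanglegram_graph S) = (`) (place xs ys) ` edges (tanglegram_graph K)"
      "root_vertex (left_tree S) = hd xs" "root_vertex (right_tree S) = hd ys"
  shows "tanglegram_iso S K"
proof -
  let ?p = "place xs ys" and ?V = "verts (tanglegram_graph K)"
  have "distinct (map ?p (left_kverts @ right_kverts))" unfolding map_append map distinct_append using d by blast
  then have inj: "inj_on ?p ?V" unfolding K(1) set_append[symmetric] by (simp only: distinct_map)
  have "set xs \<union> set ys = ?p ` ?V" unfolding K(1) image_Un set_map[symmetric] map ..
  then have "graph_iso (inv_into ?V ?p) (tanglegram_graph S) (tanglegram_graph K)"
    using graph_iso_inv_into[OF inj] S(1,2) K(2) by simp
  moreover have "hd xs = ?p LRoot" "hd ys = ?p RRoot"
    using arg_cong[OF map(1), of hd] arg_cong[OF map(2), of hd] by simp_all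
  then have "inv_into ?V ?p (hd xs) = LRoot" "inv_into ?V ?p (hd ys) = RRoot"
    using inv_into_f_f[OF inj, of LRoot] inv_into_f_f[OF inj, of RRoot] unfolding K(1) by simp_all
  ultimately show ?thesis unfolding tanglegram_iso_def S(3,4) K(3,4) by blast
qed

context tanglegram_loc begin

lemma covered_leaves: assumes "X \<subseteq> M" shows "lvL \<inter> \<Union>X = lam ` X" "lvR \<inter> \<Union>X = rho ` X"
proof -
  have e: "lvL \<inter> m = {lam m}" "lvR \<inter> m = {rho m}" if "m \<in> X" for m
  proof -
    have m: "m \<in> M" using that assms by blast
    note l = lam_rho(1,2)[OF m] disjoint_leaves[OF lam_rho(1)[OF m]]
    have "rho m \<notin> lvL" using l disjoint_leaves by blast
    then have "lvL \<inter> {lam m, rho m} = {lam m}" "lvR \<inter> {lam m, rho m} = {rho m}" using l by auto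
    then show "lvL \<inter> m = {lam m}" "lvR \<inter> m = {rho m}" using lam_rho(3)[OF m] by simp_all
  qed
  have "lvL \<inter> \<Union>X = (\<Union>m\<in>X. lvL \<inter> m)" "lvR \<inter> \<Union>X = (\<Union>m\<in>X. lvR \<inter> m)" by blast+
  then show "lvL \<inter> \<Union>X = lam ` X" "lvR \<inter> \<Union>X = rho ` X" using e by auto
qed

lemma K1q_cross_responsible:
  assumes K: "P.K1q a b c d" shows "cross_responsible TT {a, b, c, d}"
proof -
  note k = P.K1q_full[OF K]
  have M: "a \<in> M" "b \<in> M" "c \<in> M" "d \<in> M" using k(1-4) unfolding tL_def by auto
  have l: "L.trip (lam a) (lam b) (lam c)" "L.trip (lam a) (lam b) (lam d)"
    "L.trip (lam c) (lam d) (lam a)" "L.trip (lam c) (lam d) (lam b)"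
    using k(1-4) unfolding tL_def by auto
  have s: "R.trip (rho a) (rho c) (rho b)" "R.trip (rho a) (rho c) (rho d)"
    "R.trip (rho b) (rho d) (rho a)" "R.trip (rho b) (rho d) (rho c)"
    using k(5-8) unfolding tR_def by auto
  have ne: "lam a \<noteq> lam b" "lam c \<noteq> lam d" "rho a \<noteq> rho c" "rho b \<noteq> rho d"
    using k(9-14) M by (simp_all add: inj_on_eq_iff[OF lam_inj] inj_on_eq_iff[OF rho_inj])
  obtain u1 u2 u3 where u: "distinct [L.r, u1, u2, u3, lam a, lam b, lam c, lam d]"
    "{L.r, u1, u2, u3, lam a, lam b, lam c, lam d} \<subseteq> L.V"
    "induced_subtree (left_tree TT) {lam a, lam b, lam c, lam d} =
      balanced_tree L.r u1 u2 u3 (lam a) (lam b) (lam c) (lam d)"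
    by (rule L.balanced_shape[OF l ne(1,2)])
  \<comment> \<open>The right leaves \<open>r1\<close>, \<open>r2\<close>, \<open>r3\<close>,
    \<open>r4\<close> of \<open>K1\<close> belong to the edges \<open>a\<close>, \<open>c\<close>,
    \<open>b\<close>, \<open>d\<close> in this order.\<close>
  obtain w1 w2 w3 where w: "distinct [R.r, w1, w2, w3, rho a, rho c, rho b, rho d]"
    "{R.r, w1, w2, w3, rho a, rho c, rho b, rho d} \<subseteq> R.V"
    "induced_subtree (right_tree TT) {rho a, rho c, rho b, rho d} =
      balanced_tree R.r w1 w2 w3 (rho a) (rho c) (rho b) (rho d)"
    by (rule R.balanced_shape[OF s ne(3,4)])
  let ?X = "{a, b, c, d}"
  have XM: "?X \<subseteq> M" using M by simp
  have SL: "lvL \<inter> \<Union>?X = {lam a, lam b, lam c, lam d}" and SR: "lvR \<inter> \<Union>?X = {rho a, rho c, rho b, rho d}"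
    unfolding covered_leaves[OF XM] by auto
  have X: "?X = {{lam a, rho a}, {lam b, rho b}, {lam c, rho c}, {lam d, rho d}}" using lam_rho(3) M by simp
  have IT: "induced_subtanglegram TT ?X =
    \<lparr>left_tree = balanced_tree L.r u1 u2 u3 (lam a) (lam b) (lam c) (lam d),
     right_tree = balanced_tree R.r w1 w2 w3 (rho a) (rho c) (rho b) (rho d),
     matching = {{lam a, rho a}, {lam b, rho b}, {lam c, rho c}, {lam d, rho d}}\<rparr>"
    unfolding induced_subtanglegram_def SL SR u(3) w(3) using X by simp
  have "tanglegram_iso (induced_subtanglegram TT ?X) K1"
  proof (rule tanglegram_iso_place[OF _ _ u(1) w(1) _ verts_K1])
    show "set [L.r, u1, u2, u3, lam a, lam b, lam c, lam d] \<inter> set [R.r, w1, w2, w3, rho a, rho c, rho b, rho d] = {}"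
      using u(2) w(2) disjoint_trees by (simp only: set_simps) blast
  qed (auto simp: IT tanglegram_graph_def K1_def place_def balanced_tree_def)
  then show ?thesis unfolding cross_responsible_def using XM by blast
qed

lemma K2q_cross_responsible:
  assumes K: "P.K2q a b c d" shows "cross_responsible TT {a, b, c, d}"
proof -
  note k = P.K2q_full[OF K]
  have M: "a \<in> M" "b \<in> M" "c \<in> M" "d \<in> M" using k(1-4) unfolding tL_def by auto
  have l: "L.trip (lam c) (lam d) (lam b)" "L.trip (lam c) (lam d) (lam a)"
    "L.trip (lam b) (lam c) (lam a)" "L.trip (lam b) (lam d) (lam a)"
    using k(1-4) unfolding tL_def by auto
  have s: "R.trip (rho c) (rho a) (rho b)" "R.trip (rho c) (rho a) (rho d)"
    "R.trip (rho b) (rho c) (rho d)" "R.trip (rho b) (rho a) (rho d)"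
    using k(5-8) unfolding tR_def by auto
  have ne: "lam c \<noteq> lam d" "rho c \<noteq> rho a"
    using k(9-14) M by (simp_all add: inj_on_eq_iff[OF lam_inj] inj_on_eq_iff[OF rho_inj])
  obtain u1 u2 u3 where u: "distinct [L.r, u1, u2, u3, lam a, lam b, lam c, lam d]"
    "{L.r, u1, u2, u3, lam a, lam b, lam c, lam d} \<subseteq> L.V"
    "induced_subtree (left_tree TT) {lam a, lam b, lam c, lam d} =
      caterpillar_tree L.r u1 u2 u3 (lam a) (lam b) (lam c) (lam d)"
    by (rule L.caterpillar_shape[OF l ne(1)])
  \<comment> \<open>The right leaves \<open>r1\<close>, \<open>r2\<close>, \<open>r3\<close>,
    \<open>r4\<close> of \<open>K2\<close> belong to the edges \<open>d\<close>, \<open>b\<close>,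
    \<open>c\<close>, \<open>a\<close> in this order.\<close>
  obtain w1 w2 w3 where w: "distinct [R.r, w1, w2, w3, rho d, rho b, rho c, rho a]"
    "{R.r, w1, w2, w3, rho d, rho b, rho c, rho a} \<subseteq> R.V"
    "induced_subtree (right_tree TT) {rho d, rho b, rho c, rho a} =
      caterpillar_tree R.r w1 w2 w3 (rho d) (rho b) (rho c) (rho a)"
    by (rule R.caterpillar_shape[OF s ne(2)])
  let ?X = "{a, b, c, d}"
  have XM: "?X \<subseteq> M" using M by simp
  have SL: "lvL \<inter> \<Union>?X = {lam a, lam b, lam c, lam d}" and SR: "lvR \<inter> \<Union>?X = {rho d, rho b, rho c, rho a}"
    unfolding covered_leaves[OF XM] by auto
  have X: "?X = {{lam a, rho a}, {lam b, rho b}, {lam c, rho c}, {lam d, rho d}}" using lam_rho(3) M by simp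
  have IT: "induced_subtanglegram TT ?X =
    \<lparr>left_tree = caterpillar_tree L.r u1 u2 u3 (lam a) (lam b) (lam c) (lam d),
     right_tree = caterpillar_tree R.r w1 w2 w3 (rho d) (rho b) (rho c) (rho a),
     matching = {{lam a, rho a}, {lam b, rho b}, {lam c, rho c}, {lam d, rho d}}\<rparr>"
    unfolding induced_subtanglegram_def SL SR u(3) w(3) using X by simp
  have "tanglegram_iso (induced_subtanglegram TT ?X) K2"
  proof (rule tanglegram_iso_place[OF _ _ u(1) w(1) _ verts_K2])
    show "set [L.r, u1, u2, u3, lam a, lam b, lam c, lam d] \<inter> set [R.r, w1, w2, w3, rho d, rho b, rho c, rho a] = {}"
      using u(2) w(2) disjoint_trees by (simp only: set_simps) blast
  qed (auto simp: IT tanglegram_graph_def K2_def place_def caterpillar_tree_def)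
  then show ?thesis unfolding cross_responsible_def using XM by blast
qed

lemma pat_cross_responsible: "P.pat Q \<Longrightarrow> cross_responsible TT Q"
  unfolding P.pat_def using K1q_cross_responsible K2q_cross_responsible by blast

end

section \<open>From cross-responsible sets to the ternary patterns\<close>

context tanglegram_loc begin

lemma ends_in_trees: assumes "{l, s} \<in> M" "l \<in> L.V" "s \<in> R.V" shows "lam {l, s} = l" "rho {l, s} = s"
proof -
  note m = lam_rho[OF assms(1)]
  have "lam {l, s} \<noteq> s" "rho {l, s} \<noteq> l"
    using L.leaves_in[OF m(1)] R.leaves_in[OF m(2)] assms(2,3) disjoint_trees by auto
  then show "lam {l, s} = l" "rho {l, s} = s" using m(3) by (auto simp: doubleton_eq_iff)
qed

context
  fixes X
  assumes X: "X \<subseteq> M" "X \<noteq> {}"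
begin

abbreviation "GX \<equiv> tanglegram_graph (induced_subtanglegram TT X)"

lemma lam_S: "lam ` X \<subseteq> lvL" "lam ` X \<noteq> {}" using lam_rho X by auto
lemma rho_S: "rho ` X \<subseteq> lvR" "rho ` X \<noteq> {}" using lam_rho X by auto

lemma GX_edges:
  "edges GX = {{u, v} | u v. L.cover (lam ` X) u v} \<union> {{u, v} | u v. R.cover (rho ` X) u v} \<union> X"
  "edges GX = {{u, v} | u v. R.cover (rho ` X) u v} \<union> {{u, v} | u v. L.cover (lam ` X) u v} \<union> X"
  unfolding tanglegram_graph_def induced_subtanglegram_def covered_leaves[OF X(1)]
    L.induced_subtree_eq[OF lam_S] R.induced_subtree_eq[OF rho_S] by auto

lemma GX_roots: "L.r \<in> verts GX" "R.r \<in> verts GX"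
  unfolding tanglegram_graph_def induced_subtanglegram_def covered_leaves[OF X(1)]
    L.induced_subtree_eq[OF lam_S] R.induced_subtree_eq[OF rho_S]
    L.kept_def[OF lam_S] R.kept_def[OF rho_S] by auto

lemma cover_edges_in:
  "\<forall>e \<in> {{u, v} | u v. L.cover (lam ` X) u v}. e \<inter> R.V = {}"
  "\<forall>e \<in> {{u, v} | u v. R.cover (rho ` X) u v}. e \<inter> L.V = {}"
  using L.cover_anc[OF lam_S] R.cover_anc[OF rho_S] L.anc_in R.anc_in disjoint_trees by fast+

lemma matching_leaf: "\<forall>m\<in>X. m \<inter> L.V \<subseteq> lvL" "\<forall>m\<in>X. m \<inter> R.V \<subseteq> lvR"
proof -
  have "m \<inter> L.V \<subseteq> lvL \<and> m \<inter> R.V \<subseteq> lvR" if "m \<in> M" for m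
  proof -
    note l = lam_rho[OF that]
    have "{lam m, rho m} \<inter> L.V \<subseteq> lvL \<and> {lam m, rho m} \<inter> R.V \<subseteq> lvR"
      using l(1,2) L.leaves_in[OF l(1)] R.leaves_in[OF l(2)] disjoint_trees by auto
    then show ?thesis using l(3) by simp
  qed
  then show "\<forall>m\<in>X. m \<inter> L.V \<subseteq> lvL" "\<forall>m\<in>X. m \<inter> R.V \<subseteq> lvR" using X by blast+
qed

lemma matching_unique_X: "\<forall>m\<in>X. \<forall>m'\<in>X. m \<inter> m' \<noteq> {} \<longrightarrow> m = m'"
  using matching_unique X by blast

text \<open>Cover edges stay inside their own tree, so an edge between the trees must come from the
  matching.\<close>

lemma cross_edge: assumes "{l, s} \<in> edges GX" "l \<in> L.V" "s \<in> R.V"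
  shows "{l, s} \<in> M" "lam {l, s} = l" "rho {l, s} = s"
proof -
  have "{l, s} \<inter> L.V \<noteq> {}" "{l, s} \<inter> R.V \<noteq> {}" using assms by auto
  then have "{l, s} \<notin> {{u, v} | u v. L.cover (lam ` X) u v}" "{l, s} \<notin> {{u, v} | u v. R.cover (rho ` X) u v}"
    using bspec[OF cover_edges_in(1)] bspec[OF cover_edges_in(2)] by blast+
  then have "{l, s} \<in> X" using assms(1) unfolding GX_edges(1) by (elim UnE) (erule (1) notE | assumption)+
  then show "{l, s} \<in> M" using X by blast
  then show "lam {l, s} = l" "rho {l, s} = s" using ends_in_trees assms by blast+
qed

lemmas L_balanced = L.balanced_chase[OF lam_S cover_edges_in(2) matching_leaf(1) matching_unique_X GX_edges(1)]
lemmas R_balanced = R.balanced_chase[OF rho_S cover_edges_in(1) matching_leaf(2) matching_unique_X GX_edges(2)]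
lemmas L_caterpillar = L.caterpillar_chase[OF lam_S cover_edges_in(2) matching_leaf(1) matching_unique_X GX_edges(1)]
lemmas R_caterpillar = R.caterpillar_chase[OF rho_S cover_edges_in(1) matching_leaf(2) matching_unique_X GX_edges(2)]

lemma iso_inverse:
  fixes K :: "kvertex tanglegram_data"
  assumes iso: "tanglegram_iso (induced_subtanglegram TT X) K"
    and K: "verts (tanglegram_graph K) = kverts"
      "root_vertex (left_tree K) = LRoot" "root_vertex (right_tree K) = RRoot"
  obtains g where "g LRoot = L.r" "g RRoot = R.r"
    "distinct (map g left_kverts)" "distinct (map g right_kverts)"
    "\<And>k k'. k \<in> kverts \<Longrightarrow> k' \<in> kverts \<Longrightarrow>
      {k, k'} \<in> edges (tanglegram_graph K) \<Longrightarrow> {g k, g k'} \<in> edges GX"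
proof -
  obtain \<phi> where \<phi>: "graph_iso \<phi> GX (tanglegram_graph K)"
    and r: "\<phi> (root_vertex (left_tree (induced_subtanglegram TT X))) = LRoot"
      "\<phi> (root_vertex (right_tree (induced_subtanglegram TT X))) = RRoot"
    using iso K unfolding tanglegram_iso_def by auto
  have r': "\<phi> L.r = LRoot" "\<phi> R.r = RRoot"
    using r unfolding induced_subtanglegram_def by (simp_all add: induced_subtree_def Let_def)
  obtain g where g0: "inj_on g (verts (tanglegram_graph K))" "\<And>v. v \<in> verts GX \<Longrightarrow> g (\<phi> v) = v"
    "\<And>k k'. k \<in> verts (tanglegram_graph K) \<Longrightarrow> k' \<in> verts (tanglegram_graph K) \<Longrightarrow>
      {g k, g k'} \<in> edges GX \<longleftrightarrow> {k, k'} \<in> edges (tanglegram_graph K)"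
    using graph_iso_inverse[OF \<phi>] by metis
  note g = g0[unfolded K(1)]
  have "distinct (map g left_kverts)" "distinct (map g right_kverts)"
    unfolding distinct_map by (intro conjI inj_on_subset[OF g(1)]; simp)+
  then show ?thesis
    by (rule that[OF g(2)[OF GX_roots(1), unfolded r'] g(2)[OF GX_roots(2), unfolded r']]) (simp only: g(3))
qed

text \<open>The two descents give the triples of both trees, and the images of the matching edges of
  \<open>K1\<close> link the left leaves to the right ones. The existence of some pattern is what
  the lower bound on crossings requires.\<close>

lemma K1_pattern: assumes "tanglegram_iso (induced_subtanglegram TT X) K1" shows "\<exists>Q. P.pat Q"
proof -
  have "root_vertex (left_tree K1) = LRoot" "root_vertex (right_tree K1) = RRoot" by (simp_all add: K1_def)
  then obtain g where g: "g LRoot = L.r" "g RRoot = R.r"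
    and d: "distinct (map g left_kverts)" "distinct (map g right_kverts)"
    and edge: "\<And>k k'. k \<in> kverts \<Longrightarrow> k' \<in> kverts \<Longrightarrow>
      {k, k'} \<in> edges (tanglegram_graph K1) \<Longrightarrow> {g k, g k'} \<in> edges GX"
    using iso_inverse[OF assms verts_K1] by blast
  note dl = d(1)[unfolded list.map g] and dr = d(2)[unfolded list.map g]
  have el: "{{L.r, g (LInner 1)}, {g (LInner 1), g (LInner 2)}, {g (LInner 1), g (LInner 3)}, {g (LInner 2), g (LLeaf 1)},
    {g (LInner 2), g (LLeaf 2)}, {g (LInner 3), g (LLeaf 3)}, {g (LInner 3), g (LLeaf 4)}} \<subseteq> edges GX"
    unfolding g(1)[symmetric] insert_subset by (intro conjI; (rule edge)?; simp add: tanglegram_graph_def K1_def)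
  have er: "{{R.r, g (RInner 1)}, {g (RInner 1), g (RInner 2)}, {g (RInner 1), g (RInner 3)}, {g (RInner 2), g (RLeaf 1)},
    {g (RInner 2), g (RLeaf 2)}, {g (RInner 3), g (RLeaf 3)}, {g (RInner 3), g (RLeaf 4)}} \<subseteq> edges GX"
    unfolding g(2)[symmetric] insert_subset by (intro conjI; (rule edge)?; simp add: tanglegram_graph_def K1_def)
  have em: "{g (LLeaf 1), g (RLeaf 1)} \<in> edges GX" "{g (LLeaf 2), g (RLeaf 3)} \<in> edges GX"
    "{g (LLeaf 3), g (RLeaf 2)} \<in> edges GX" "{g (LLeaf 4), g (RLeaf 4)} \<in> edges GX"
    by (rule edge; simp add: tanglegram_graph_def K1_def)+
  note lb = L_balanced[OF el dl] and rb = R_balanced[OF er dr]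
  have V: "g (LLeaf 1) \<in> L.V" "g (LLeaf 2) \<in> L.V" "g (LLeaf 3) \<in> L.V" "g (LLeaf 4) \<in> L.V"
    "g (RLeaf 1) \<in> R.V" "g (RLeaf 2) \<in> R.V" "g (RLeaf 3) \<in> R.V" "g (RLeaf 4) \<in> R.V"
    using lb(1) rb(1) by auto
  note c1 = cross_edge[OF em(1) V(1,5)] and c2 = cross_edge[OF em(2) V(2,7)]
    and c3 = cross_edge[OF em(3) V(3,6)] and c4 = cross_edge[OF em(4) V(4,8)]
  note lv = lam_rho(1,2)[OF c1(1)] lam_rho(1,2)[OF c2(1)] lam_rho(1,2)[OF c3(1)] lam_rho(1,2)[OF c4(1)]
  have "P.K1q {g (LLeaf 1), g (RLeaf 1)} {g (LLeaf 2), g (RLeaf 3)}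
    {g (LLeaf 3), g (RLeaf 2)} {g (LLeaf 4), g (RLeaf 4)}"
    unfolding P.K1q_def tL_def tR_def L.trip_def R.trip_def
    using lb(2,3) rb(2,3) lv c1(1) c2(1) c3(1) c4(1) unfolding c1(2,3) c2(2,3) c3(2,3) c4(2,3) by simp
  then show ?thesis using P.K1q_pat by blast
qed

lemma K2_pattern: assumes "tanglegram_iso (induced_subtanglegram TT X) K2" shows "\<exists>Q. P.pat Q"
proof -
  have "root_vertex (left_tree K2) = LRoot" "root_vertex (right_tree K2) = RRoot" by (simp_all add: K2_def)
  then obtain g where g: "g LRoot = L.r" "g RRoot = R.r"
    and d: "distinct (map g left_kverts)" "distinct (map g right_kverts)"
    and edge: "\<And>k k'. k \<in> kverts \<Longrightarrow> k' \<in> kverts \<Longrightarrow>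
      {k, k'} \<in> edges (tanglegram_graph K2) \<Longrightarrow> {g k, g k'} \<in> edges GX"
    using iso_inverse[OF assms verts_K2] by blast
  note dl = d(1)[unfolded list.map g] and dr = d(2)[unfolded list.map g]
  have el: "{{L.r, g (LInner 1)}, {g (LInner 1), g (LLeaf 1)}, {g (LInner 1), g (LInner 2)}, {g (LInner 2), g (LLeaf 2)},
    {g (LInner 2), g (LInner 3)}, {g (LInner 3), g (LLeaf 3)}, {g (LInner 3), g (LLeaf 4)}} \<subseteq> edges GX"
    unfolding g(1)[symmetric] insert_subset by (intro conjI; (rule edge)?; simp add: tanglegram_graph_def K2_def)
  have er: "{{R.r, g (RInner 1)}, {g (RInner 1), g (RLeaf 1)}, {g (RInner 1), g (RInner 2)}, {g (RInner 2), g (RLeaf 2)},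
    {g (RInner 2), g (RInner 3)}, {g (RInner 3), g (RLeaf 3)}, {g (RInner 3), g (RLeaf 4)}} \<subseteq> edges GX"
    unfolding g(2)[symmetric] insert_subset by (intro conjI; (rule edge)?; simp add: tanglegram_graph_def K2_def)
  have em: "{g (LLeaf 1), g (RLeaf 4)} \<in> edges GX" "{g (LLeaf 2), g (RLeaf 2)} \<in> edges GX"
    "{g (LLeaf 3), g (RLeaf 3)} \<in> edges GX" "{g (LLeaf 4), g (RLeaf 1)} \<in> edges GX"
    by (rule edge; simp add: tanglegram_graph_def K2_def)+
  note lb = L_caterpillar[OF el dl] and rb = R_caterpillar[OF er dr]
  have V: "g (LLeaf 1) \<in> L.V" "g (LLeaf 2) \<in> L.V" "g (LLeaf 3) \<in> L.V" "g (LLeaf 4) \<in> L.V"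
    "g (RLeaf 1) \<in> R.V" "g (RLeaf 2) \<in> R.V" "g (RLeaf 3) \<in> R.V" "g (RLeaf 4) \<in> R.V"
    using lb(1) rb(1) by auto
  note c1 = cross_edge[OF em(1) V(1,8)] and c2 = cross_edge[OF em(2) V(2,6)]
    and c3 = cross_edge[OF em(3) V(3,7)] and c4 = cross_edge[OF em(4) V(4,5)]
  note lv = lam_rho(1,2)[OF c1(1)] lam_rho(1,2)[OF c2(1)] lam_rho(1,2)[OF c3(1)] lam_rho(1,2)[OF c4(1)]
  have "P.K2q {g (LLeaf 1), g (RLeaf 4)} {g (LLeaf 2), g (RLeaf 2)}
    {g (LLeaf 3), g (RLeaf 3)} {g (LLeaf 4), g (RLeaf 1)}"
    unfolding P.K2q_def tL_def tR_def L.trip_def R.trip_def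
    using lb(2,3) rb(2,3) lv c1(1) c2(1) c3(1) c4(1) unfolding c1(2,3) c2(2,3) c3(2,3) c4(2,3) by simp
  then show ?thesis using P.K2q_pat by blast
qed

end

text \<open>Without leaves the union of root paths has no vertex, not even the root. The induced
  graph is then empty and not isomorphic to a graph on 16 vertices.\<close>

lemma cross_responsible_nonempty: assumes "cross_responsible TT X" shows "X \<noteq> {}"
proof
  assume e: "X = {}"
  have "verts (root_path_union T {}) = {}" for T :: "'a rooted_graph" unfolding root_path_union_def by simp
  then have "verts (induced_subtree T {}) = {}" for T :: "'a rooted_graph"
    unfolding induced_subtree_def suppress_degree2_def by (simp add: Let_def)
  then have v: "verts (tanglegram_graph (induced_subtanglegram TT X)) = {}"
    unfolding e tanglegram_graph_def induced_subtanglegram_def by simp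
  have no_iso: "verts (tanglegram_graph K) = {}" if "tanglegram_iso (induced_subtanglegram TT X) K" for K :: "kvertex tanglegram_data"
    using that v unfolding tanglegram_iso_def graph_iso_def bij_betw_def by auto
  have "LRoot \<in> verts (tanglegram_graph K1)" "LRoot \<in> verts (tanglegram_graph K2)"
    by (simp_all add: tanglegram_graph_def K1_def K2_def)
  then show False using assms no_iso unfolding cross_responsible_def by auto
qed

lemma cross_responsible_pat: "cross_responsible TT X \<Longrightarrow> \<exists>Q. P.pat Q"
  using cross_responsible_nonempty K1_pattern K2_pattern unfolding cross_responsible_def by blast

text \<open>Assuming at most one cross-responsible set, possibly none, makes the bound serve both
  halves of the theorem.\<close>

lemma layout_le_1:
  assumes "\<And>Y Z. cross_responsible TT Y \<Longrightarrow> cross_responsible TT Z \<Longrightarrow> Y = Z"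
  shows "\<exists>f. layout TT f \<and> crossing_number TT f \<le> 1"
proof -
  obtain D where "P.agree_off D" using P.agree_off_unique assms pat_cross_responsible by blast
  then obtain f where "layout TT f" "crossing_number TT f \<le> (if D = {} then 0 else 1)"
    using layout_of_agree_off by blast
  then show ?thesis by (intro exI[of _ f]) (auto split: if_splits)
qed

end

theorem theorem2:
  shows "(\<forall>\<T> :: 'a tanglegram_data.
            tanglegram \<T> \<and> (\<exists>!X. cross_responsible \<T> X) \<longrightarrow> crt \<T> = 1) \<and>
         (\<forall>\<T> :: 'a tanglegram_data.
            two_crossing_critical \<T> \<longrightarrow> card {X. cross_responsible \<T> X} \<ge> 2)"
proof (intro conjI allI impI)
  fix TT :: "'a tanglegram_data"
  assume h: "tanglegram TT \<and> (\<exists>!X. cross_responsible TT X)"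
  interpret tanglegram_loc TT by unfold_locales (use h in simp)
  from h obtain X0 where X0: "cross_responsible TT X0" "\<And>Y. cross_responsible TT Y \<Longrightarrow> Y = X0" by metis
  have "Y = Z" if "cross_responsible TT Y" "cross_responsible TT Z" for Y Z using that[THEN X0(2)] by simp
  then obtain f where f: "layout TT f" "crossing_number TT f \<le> 1" using layout_le_1 by blast
  obtain Q where "P.pat Q" using cross_responsible_pat[OF X0(1)] by blast
  then have pos: "1 \<le> crossing_number TT g" if "layout TT g" for g
    using no_pat_if_no_crossing[OF that] by (cases "crossing_number TT g") auto
  show "crt TT = 1" unfolding crt_def
  proof (rule Least_equality)
    show "\<exists>f. layout TT f \<and> crossing_number TT f = 1" using f pos[OF f(1)] by (intro exI[of _ f]) simp
  qed (use pos in blast)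
next
  fix TT :: "'a tanglegram_data"
  assume h: "two_crossing_critical TT"
  interpret tanglegram_loc TT by unfold_locales (use h in \<open>simp add: two_crossing_critical_def\<close>)
  show "2 \<le> card {X. cross_responsible TT X}"
  proof (rule ccontr)
    assume "\<not> 2 \<le> card {X. cross_responsible TT X}"
    then have c: "card {X. cross_responsible TT X} \<le> 1" by simp
    \<comment> \<open>Finiteness is required because \<open>card\<close> of an infinite set is 0, so
      a small cardinality alone would not yield uniqueness.\<close>
    have "finite {X. cross_responsible TT X}"
      by (rule finite_subset[of _ "Pow M"]) (use finite_M in \<open>auto simp: cross_responsible_def\<close>)
    then have "Y = Z" if "cross_responsible TT Y" "cross_responsible TT Z" for Y Z
      using c that card_le_Suc0_iff_eq[of "{X. cross_responsible TT X}"] by simp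
    then obtain f where f: "layout TT f" "crossing_number TT f \<le> 1" using layout_le_1 by blast
    have "crt TT \<le> crossing_number TT f" unfolding crt_def by (rule Least_le) (use f in blast)
    then show False using f h unfolding two_crossing_critical_def by simp
  qed
qed

end
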